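(* Assume the LgLCAA for extendible, and let $\mathcal P$ be the class of all posets. Then for every $A\subseteq\mathcal H(\aleph_1)$ and every poset $\mathbb P$ there is a $\mathbb P$-name $\dot{\mathbb Q}$ of a poset such that for every $(V,\mathbb P*\dot{\mathbb Q})$-generic $\mathbb H$ there is $A^*\subseteq\mathcal H(\aleph_1)^{V[\mathbb H]}$ with $(\mathcal H(\aleph_1)^V,A,\in)\prec(\mathcal H(\aleph_1)^{V[\mathbb H]},A^*,\in)$.
   Context: The LgLCAA for extendible: for every $\lambda>2^{\aleph_0}$ and every poset $\mathbb P$ there is a $\mathbb P$-name $\dot{\mathbb Q}$ of a poset such that for every $(V,\mathbb P*\dot{\mathbb Q})$-generic $\mathbb H$ there are classes $j,M$ of $V[\mathbb H]$, $M$ transitive, with $j:V\to M$ elementary with critical point $2^{\aleph_0}$, $j(2^{\aleph_0})>\lambda$, $\mathbb P,\mathbb P*\dot{\mathbb Q},\mathbb H\in M$, $|RO(\mathbb P*\dot{\mathbb Q})|\le j(2^{\aleph_0})$ ($RO$ = Boolean completion), and $V^{V[\mathbb H]}_{j(\lambda)}\in M$. *)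

theory Defs
  imports "HOL-Library.Countable_Set_Type"
begin

section \<open>The ambient universe\<close>

text \<open>
  Forcing is formalised with countable transitive ground models. Such models, their names, and
  all their generic extensions consist of hereditarily countable sets, so the type of
  hereditarily countable sets (well-founded and extensional by construction) is the ambient
  universe. Classes of this universe, in particular the models, have type \<open>hc set\<close>.
\<close>

datatype hc = HC "hc cset"

primrec elts :: "hc \<Rightarrow> hc set" where
  "elts (HC X) = rcset X"

text \<open>\<open>hset S\<close> is the set with the elements \<open>S\<close>; it is meaningful for countable \<open>S\<close> only.\<close>

definition hset :: "hc set \<Rightarrow> hc" where
  "hset S = HC (acset S)"

lemma elts_hset [simp]: "countable S \<Longrightarrow> elts (hset S) = S"
  by (simp add: hset_def acset_inverse)

lemma countable_elts [simp]: "countable (elts x)"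
  by (cases x) (simp add: rcset)

lemma hc_ext: "x = y \<longleftrightarrow> elts x = elts y"
  by (cases x; cases y) (simp add: rcset_inject)

definition mem_rel :: "(hc \<times> hc) set" where
  "mem_rel = {(x, y). x \<in> elts y}"

lemma wf_mem_rel: "wf mem_rel"
proof (rule wfUNIVI)
  fix P :: "hc \<Rightarrow> bool" and x
  assume "\<forall>x. (\<forall>y. (y, x) \<in> mem_rel \<longrightarrow> P y) \<longrightarrow> P x"
  then have step: "(\<And>y. y \<in> elts x \<Longrightarrow> P y) \<Longrightarrow> P x" for x
    by (simp add: mem_rel_def)
  show "P x"
    by (induction x) (rule step, simp)
qed

definition tc :: "hc \<Rightarrow> hc" where
  "tc x = hset {y. (y, x) \<in> mem_rel\<^sup>+}"

definition hpair :: "hc \<Rightarrow> hc \<Rightarrow> hc" where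
  "hpair x y = hset {hset {x}, hset {x, y}}"

lemma hpair_inject [simp]: "hpair x y = hpair x' y' \<longleftrightarrow> x = x' \<and> y = y'"
  by (auto simp: hpair_def hc_ext[of "hset _" "hset _"] doubleton_eq_iff)

lemma hpair_fst_below: "hpair x y \<in> elts z \<Longrightarrow> (x, z) \<in> mem_rel\<^sup>+"
proof -
  assume "hpair x y \<in> elts z"
  moreover have "x \<in> elts (hset {x})" "hset {x} \<in> elts (hpair x y)"
    by (simp_all add: hpair_def)
  ultimately have "(x, hset {x}) \<in> mem_rel" "(hset {x}, hpair x y) \<in> mem_rel" "(hpair x y, z) \<in> mem_rel"
    by (simp_all add: mem_rel_def)
  then show ?thesis
    by (meson r_into_trancl trancl_into_trancl)
qed

primrec hnat :: "nat \<Rightarrow> hc" where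
  "hnat 0 = hset {}"
| "hnat (Suc n) = hset (insert (hnat n) (elts (hnat n)))"

definition homega :: hc where
  "homega = hset (range hnat)"

definition transitive :: "hc set \<Rightarrow> bool" where
  "transitive N \<longleftrightarrow> (\<forall>x\<in>N. elts x \<subseteq> N)"

definition ordinal :: "hc \<Rightarrow> bool" where
  "ordinal a \<longleftrightarrow> transitive (elts a) \<and> (\<forall>b\<in>elts a. transitive (elts b))"

text \<open>\<open>f\<close> is (the graph of) a function from \<open>a\<close> to \<open>b\<close>.\<close>

definition hfun :: "hc \<Rightarrow> hc \<Rightarrow> hc \<Rightarrow> bool" where
  "hfun f a b \<longleftrightarrow>
     (\<forall>z\<in>elts f. \<exists>x\<in>elts a. \<exists>y\<in>elts b. z = hpair x y) \<and>
     (\<forall>x\<in>elts a. \<exists>!y. hpair x y \<in> elts f)"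

definition hinj :: "hc \<Rightarrow> hc \<Rightarrow> hc \<Rightarrow> bool" where
  "hinj f a b \<longleftrightarrow> hfun f a b \<and>
     (\<forall>x x' y. hpair x y \<in> elts f \<and> hpair x' y \<in> elts f \<longrightarrow> x = x')"

definition hbij :: "hc \<Rightarrow> hc \<Rightarrow> hc \<Rightarrow> bool" where
  "hbij f a b \<longleftrightarrow> hinj f a b \<and> (\<forall>y\<in>elts b. \<exists>x. hpair x y \<in> elts f)"


section \<open>Satisfaction, elementarity, models of ZFC\<close>

text \<open>
  First-order formulas over membership and equality with one additional unary predicate; the
  language of set theory consists of the formulas with \<open>pred_free\<close>.
\<close>

datatype fm = Mem nat nat | Eq nat nat | Pred nat | Neg fm | And fm fm | All nat fm

primrec pred_free :: "fm \<Rightarrow> bool" where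
  "pred_free (Mem m n) = True"
| "pred_free (Eq m n) = True"
| "pred_free (Pred n) = False"
| "pred_free (Neg \<phi>) = pred_free \<phi>"
| "pred_free (And \<phi> \<psi>) = (pred_free \<phi> \<and> pred_free \<psi>)"
| "pred_free (All n \<phi>) = pred_free \<phi>"

text \<open>\<open>sat D U e \<phi>\<close>: the structure \<open>(D, U, \<in>)\<close> satisfies \<open>\<phi>\<close> under the assignment \<open>e\<close>.\<close>

primrec sat :: "hc set \<Rightarrow> hc set \<Rightarrow> (nat \<Rightarrow> hc) \<Rightarrow> fm \<Rightarrow> bool" where
  "sat D U e (Mem m n) \<longleftrightarrow> e m \<in> elts (e n)"
| "sat D U e (Eq m n) \<longleftrightarrow> e m = e n"
| "sat D U e (Pred n) \<longleftrightarrow> e n \<in> U"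
| "sat D U e (Neg \<phi>) \<longleftrightarrow> \<not> sat D U e \<phi>"
| "sat D U e (And \<phi> \<psi>) \<longleftrightarrow> sat D U e \<phi> \<and> sat D U e \<psi>"
| "sat D U e (All n \<phi>) \<longleftrightarrow> (\<forall>x\<in>D. sat D U (e(n := x)) \<phi>)"

text \<open>Satisfaction in \<open>(D, \<in>)\<close>; to be used for formulas without the predicate only.\<close>

abbreviation sat_set :: "hc set \<Rightarrow> (nat \<Rightarrow> hc) \<Rightarrow> fm \<Rightarrow> bool" where
  "sat_set D \<equiv> sat D {}"

text \<open>\<open>(D, U, \<in>)\<close> is an elementary substructure of \<open>(D', U', \<in>)\<close>.\<close>

definition elem_substructure :: "hc set \<Rightarrow> hc set \<Rightarrow> hc set \<Rightarrow> hc set \<Rightarrow> bool" where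
  "elem_substructure D U D' U' \<longleftrightarrow> D \<subseteq> D' \<and>
     (\<forall>\<phi> e. range e \<subseteq> D \<longrightarrow> (sat D U e \<phi> \<longleftrightarrow> sat D' U' e \<phi>))"

definition elem_embedding :: "(hc \<Rightarrow> hc) \<Rightarrow> hc set \<Rightarrow> hc set \<Rightarrow> bool" where
  "elem_embedding j N M \<longleftrightarrow> j ` N \<subseteq> M \<and>
     (\<forall>\<phi> e. pred_free \<phi> \<and> range e \<subseteq> N \<longrightarrow> (sat_set N e \<phi> \<longleftrightarrow> sat_set M (j \<circ> e) \<phi>))"

text \<open>\<open>C\<close> is a class of \<open>N\<close>: definable over \<open>(N, \<in>)\<close> with parameters.\<close>

definition class_of :: "hc set \<Rightarrow> hc set \<Rightarrow> bool" where
  "class_of N C \<longleftrightarrow>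
     (\<exists>\<phi> e. pred_free \<phi> \<and> range e \<subseteq> N \<and> C = {x \<in> N. sat_set N (e(0 := x)) \<phi>})"

text \<open>The axioms of ZFC, relativised to \<open>N\<close>.\<close>

definition zfc_model :: "hc set \<Rightarrow> bool" where
  "zfc_model N \<longleftrightarrow> N \<noteq> {} \<and>
    \<comment> \<open>Extensionality\<close>
    (\<forall>x\<in>N. \<forall>y\<in>N. (\<forall>z\<in>N. z \<in> elts x \<longleftrightarrow> z \<in> elts y) \<longrightarrow> x = y) \<and>
    \<comment> \<open>Foundation\<close>
    (\<forall>x\<in>N. (\<exists>y\<in>N. y \<in> elts x) \<longrightarrow>
      (\<exists>y\<in>N. y \<in> elts x \<and> \<not> (\<exists>z\<in>N. z \<in> elts x \<and> z \<in> elts y))) \<and>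
    \<comment> \<open>Pairing\<close>
    (\<forall>x\<in>N. \<forall>y\<in>N. \<exists>z\<in>N. \<forall>u\<in>N. u \<in> elts z \<longleftrightarrow> u = x \<or> u = y) \<and>
    \<comment> \<open>Union\<close>
    (\<forall>x\<in>N. \<exists>z\<in>N. \<forall>u\<in>N. u \<in> elts z \<longleftrightarrow> (\<exists>y\<in>N. y \<in> elts x \<and> u \<in> elts y)) \<and>
    \<comment> \<open>Power set\<close>
    (\<forall>x\<in>N. \<exists>z\<in>N. \<forall>u\<in>N. u \<in> elts z \<longleftrightarrow> (\<forall>v\<in>N. v \<in> elts u \<longrightarrow> v \<in> elts x)) \<and>
    \<comment> \<open>Infinity\<close>
    (\<exists>w\<in>N. (\<exists>z\<in>N. z \<in> elts w \<and> \<not> (\<exists>u\<in>N. u \<in> elts z)) \<and>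
      (\<forall>x\<in>N. x \<in> elts w \<longrightarrow>
        (\<exists>y\<in>N. y \<in> elts w \<and> (\<forall>u\<in>N. u \<in> elts y \<longleftrightarrow> u \<in> elts x \<or> u = x)))) \<and>
    \<comment> \<open>Separation\<close>
    (\<forall>\<phi> e. pred_free \<phi> \<and> range e \<subseteq> N \<longrightarrow>
      (\<forall>a\<in>N. \<exists>b\<in>N. \<forall>x\<in>N. x \<in> elts b \<longleftrightarrow> x \<in> elts a \<and> sat_set N (e(0 := x)) \<phi>)) \<and>
    \<comment> \<open>Replacement\<close>
    (\<forall>\<phi> e. pred_free \<phi> \<and> range e \<subseteq> N \<longrightarrow>
      (\<forall>a\<in>N. (\<forall>x\<in>N. x \<in> elts a \<longrightarrow> (\<exists>!y. y \<in> N \<and> sat_set N (e(0 := x, 1 := y)) \<phi>)) \<longrightarrow>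
        (\<exists>b\<in>N. \<forall>y\<in>N. y \<in> elts b \<longleftrightarrow>
          (\<exists>x\<in>N. x \<in> elts a \<and> sat_set N (e(0 := x, 1 := y)) \<phi>)))) \<and>
    \<comment> \<open>Choice\<close>
    (\<forall>F\<in>N. (\<forall>x\<in>N. x \<in> elts F \<longrightarrow> (\<exists>y\<in>N. y \<in> elts x)) \<and>
        (\<forall>x\<in>N. \<forall>y\<in>N. x \<in> elts F \<and> y \<in> elts F \<and> x \<noteq> y \<longrightarrow>
          \<not> (\<exists>z\<in>N. z \<in> elts x \<and> z \<in> elts y)) \<longrightarrow>
      (\<exists>c\<in>N. \<forall>x\<in>N. x \<in> elts F \<longrightarrow> (\<exists>!y. y \<in> N \<and> y \<in> elts x \<and> y \<in> elts c)))"

definition ctm :: "hc set \<Rightarrow> bool" where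
  "ctm N \<longleftrightarrow> countable N \<and> transitive N \<and> zfc_model N"


section \<open>Set-theoretic notions relative to a transitive model\<close>

text \<open>\<open>|a| \<le> |b|\<close> and \<open>|a| = |b|\<close> in the sense of \<open>N\<close>.\<close>

definition card_le :: "hc set \<Rightarrow> hc \<Rightarrow> hc \<Rightarrow> bool" where
  "card_le N a b \<longleftrightarrow> (\<exists>f\<in>N. hinj f a b)"

definition card_eq :: "hc set \<Rightarrow> hc \<Rightarrow> hc \<Rightarrow> bool" where
  "card_eq N a b \<longleftrightarrow> (\<exists>f\<in>N. hbij f a b)"

text \<open>\<open>\<H>(\<aleph>\<^sub>1)\<close> of \<open>N\<close>: the elements whose transitive closure is countable in \<open>N\<close>.\<close>

definition H_aleph1 :: "hc set \<Rightarrow> hc set" where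
  "H_aleph1 N = {x \<in> N. card_le N (tc x) homega}"

text \<open>\<open>k\<close> is the cardinal \<open>2\<^sup>\<aleph>\<^sup>0\<close> of \<open>N\<close>: the least ordinal equinumerous with the power set of \<open>\<omega>\<close>.\<close>

definition is_continuum :: "hc set \<Rightarrow> hc \<Rightarrow> bool" where
  "is_continuum N k \<longleftrightarrow> (let reals = hset {x \<in> N. elts x \<subseteq> elts homega} in
     k \<in> N \<and> ordinal k \<and> card_eq N k reals \<and> (\<forall>b\<in>elts k. \<not> card_eq N b reals))"

text \<open>The cumulative hierarchy of \<open>N\<close>: \<open>V\<^sub>a\<close> is the union of the power sets of \<open>V\<^sub>b\<close> for \<open>b \<in> a\<close>.\<close>

function Vstage :: "hc set \<Rightarrow> hc \<Rightarrow> hc" where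
  "Vstage N a = hset (\<Union>b\<in>elts a. {x \<in> N. elts x \<subseteq> elts (Vstage N b)})"
  by pat_completeness auto
termination
  by (relation "inv_image mem_rel snd") (rule wf_inv_image[OF wf_mem_rel], simp add: mem_rel_def)

declare Vstage.simps [simp del]


section \<open>Forcing\<close>

text \<open>
  A forcing poset is a nonempty preordered set, given by its set of conditions and its ordering;
  antisymmetry is not required, as usual in forcing (two-step iterations are preorders only).
  As a set of the universe it is the ordered pair of the two components.
\<close>

type_synonym poset = "hc \<times> hc"

definition code :: "poset \<Rightarrow> hc" where
  "code P = hpair (fst P) (snd P)"

definition conds :: "poset \<Rightarrow> hc set" where
  "conds P = elts (fst P)"

definition le :: "poset \<Rightarrow> hc \<Rightarrow> hc \<Rightarrow> bool" where
  "le P q p \<longleftrightarrow> hpair q p \<in> elts (snd P)"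

definition is_poset :: "poset \<Rightarrow> bool" where
  "is_poset P \<longleftrightarrow> conds P \<noteq> {} \<and>
     (\<forall>z\<in>elts (snd P). \<exists>q\<in>conds P. \<exists>p\<in>conds P. z = hpair q p) \<and>
     (\<forall>p\<in>conds P. le P p p) \<and>
     (\<forall>r q p. le P r q \<and> le P q p \<longrightarrow> le P r p)"

definition dense :: "poset \<Rightarrow> hc set \<Rightarrow> bool" where
  "dense P D \<longleftrightarrow> D \<subseteq> conds P \<and> (\<forall>p\<in>conds P. \<exists>q\<in>D. le P q p)"

definition is_filter :: "poset \<Rightarrow> hc set \<Rightarrow> bool" where
  "is_filter P G \<longleftrightarrow> G \<subseteq> conds P \<and> G \<noteq> {} \<and>
     (\<forall>q\<in>G. \<forall>p\<in>conds P. le P q p \<longrightarrow> p \<in> G) \<and>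
     (\<forall>p\<in>G. \<forall>q\<in>G. \<exists>r\<in>G. le P r p \<and> le P r q)"

text \<open>\<open>G\<close> is a \<open>(V, P)\<close>-generic filter.\<close>

definition generic :: "hc set \<Rightarrow> poset \<Rightarrow> hc \<Rightarrow> bool" where
  "generic V P G \<longleftrightarrow> is_filter P (elts G) \<and>
     (\<forall>D\<in>V. dense P (elts D) \<longrightarrow> elts D \<inter> elts G \<noteq> {})"

inductive is_name :: "poset \<Rightarrow> hc \<Rightarrow> bool" for P where
  "(\<And>x. x \<in> elts t \<Longrightarrow> \<exists>s p. x = hpair s p \<and> p \<in> conds P \<and> is_name P s) \<Longrightarrow> is_name P t"

text \<open>The evaluation of the name \<open>t\<close> by \<open>G\<close>.\<close>

function val :: "hc \<Rightarrow> hc \<Rightarrow> hc" where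
  "val G t = hset (val G ` {s. \<exists>p\<in>elts G. hpair s p \<in> elts t})"
  by pat_completeness auto
termination
  by (relation "inv_image (mem_rel\<^sup>+) snd") (auto simp: wf_mem_rel wf_trancl hpair_fst_below)

declare val.simps [simp del]

definition gen_ext :: "hc set \<Rightarrow> poset \<Rightarrow> hc \<Rightarrow> hc set" where
  "gen_ext V P G = val G ` {t \<in> V. is_name P t}"

text \<open>
  The condition \<open>p\<close> forces \<open>\<Phi>\<close>, a property of the generic extension (depending on the generic
  filter).
\<close>

definition forces :: "hc set \<Rightarrow> poset \<Rightarrow> hc \<Rightarrow> (hc \<Rightarrow> bool) \<Rightarrow> bool" where
  "forces V P p \<Phi> \<longleftrightarrow> (\<forall>G. generic V P G \<and> p \<in> elts G \<longrightarrow> \<Phi> G)"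

text \<open>
  A \<open>P\<close>-name for a poset is a pair of \<open>P\<close>-names (for the set of conditions and the ordering)
  that is forced to be a poset.
\<close>

definition is_poset_name :: "hc set \<Rightarrow> poset \<Rightarrow> poset \<Rightarrow> bool" where
  "is_poset_name V P Q \<longleftrightarrow>
     fst Q \<in> V \<and> snd Q \<in> V \<and> is_name P (fst Q) \<and> is_name P (snd Q) \<and>
     (\<forall>p\<in>conds P. forces V P p (\<lambda>G. is_poset (val G (fst Q), val G (snd Q))))"

text \<open>
  \<open>R\<close> is the two-step iteration \<open>P * Q\<close>, as an element of \<open>V\<close>. Its conditions are the pairs
  \<open>(p, q)\<close> with \<open>p \<in> P\<close>, \<open>q\<close> in the domain of the name for the conditions of \<open>Q\<close> and
  \<open>p\<close> forcing that \<open>q \<in> Q\<close>; and \<open>(p', q') \<le> (p, q)\<close> iff \<open>p' \<le> p\<close> and \<open>p'\<close> forces \<open>q' \<le> q\<close>.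
\<close>

definition is_iteration :: "hc set \<Rightarrow> poset \<Rightarrow> poset \<Rightarrow> poset \<Rightarrow> bool" where
  "is_iteration V P Q R \<longleftrightarrow> code R \<in> V \<and>
     conds R = {hpair p q | p q. p \<in> conds P \<and> (\<exists>s. hpair q s \<in> elts (fst Q)) \<and>
                  forces V P p (\<lambda>G. val G q \<in> elts (val G (fst Q)))} \<and>
     elts (snd R) = {hpair (hpair p' q') (hpair p q) | p' q' p q.
                  hpair p' q' \<in> conds R \<and> hpair p q \<in> conds R \<and> le P p' p \<and>
                  forces V P p' (\<lambda>G. hpair (val G q') (val G q) \<in> elts (val G (snd Q)))}"

text \<open>
  The Boolean completion of \<open>P\<close> in \<open>V\<close>: the regular open subsets of \<open>P\<close> with respect to the
  topology whose open sets are the downward closed ones.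
\<close>

definition pclosure :: "poset \<Rightarrow> hc set \<Rightarrow> hc set" where
  "pclosure P S = {p \<in> conds P. \<exists>r\<in>S. le P r p}"

definition pinterior :: "poset \<Rightarrow> hc set \<Rightarrow> hc set" where
  "pinterior P S = {p \<in> conds P. \<forall>q\<in>conds P. le P q p \<longrightarrow> q \<in> S}"

definition RO :: "hc set \<Rightarrow> poset \<Rightarrow> hc" where
  "RO V P = hset {b \<in> V. elts b \<subseteq> conds P \<and> pinterior P (pclosure P (elts b)) = elts b}"


section \<open>The axiom\<close>

definition crit :: "(hc \<Rightarrow> hc) \<Rightarrow> hc \<Rightarrow> bool" where
  "crit j k \<longleftrightarrow> ordinal k \<and> (\<forall>a\<in>elts k. j a = a) \<and> j k \<noteq> k"

text \<open>
  The LgLCAA for extendible (for the class of all posets) holds in \<open>V\<close>. Here \<open>k\<close> is \<open>2\<^sup>\<aleph>\<^sup>0\<close>, and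
  \<open>l\<close> ranges over the ordinals above \<open>k\<close>.
\<close>

definition LgLCAA_extendible :: "hc set \<Rightarrow> bool" where
  "LgLCAA_extendible V \<longleftrightarrow>
    (\<exists>k. is_continuum V k \<and>
      (\<forall>l\<in>V. ordinal l \<and> k \<in> elts l \<longrightarrow>
        (\<forall>P. is_poset P \<and> code P \<in> V \<longrightarrow>
          (\<exists>Q R. is_poset_name V P Q \<and> is_iteration V P Q R \<and>
            (\<forall>H. generic V R H \<longrightarrow>
              (let W = gen_ext V R H in
                \<exists>j M. M \<subseteq> W \<and> class_of W M \<and> class_of W ((\<lambda>x. hpair x (j x)) ` V) \<and>
                  transitive M \<and> elem_embedding j V M \<and> crit j k \<and> l \<in> elts (j k) \<and>
                  code P \<in> M \<and> code R \<in> M \<and> H \<in> M \<and>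
                  card_le V (RO V R) (j k) \<and>
                  Vstage W (j l) \<in> M))))))"

end

theory Submission
  imports Defs
begin

text \<open>
  Apply the axiom to an ordinal \<open>l\<close> above \<open>2\<^sup>\<aleph>\<^sup>0\<close> and \<open>\<omega>\<close>, and put \<open>A\<^sup>* = j(A)\<close>. The embedding fixes
  every element of \<open>H(\<aleph>\<^sub>1)\<^sup>V\<close>, because it fixes the natural numbers and the elements of a countable set
  are indexed by natural numbers. Hence relativising formulas to \<open>H(\<aleph>\<^sub>1)\<close> turns the elementarity of
  \<open>j\<close> into \<open>(H(\<aleph>\<^sub>1)\<^sup>V, A) \<prec> (H(\<aleph>\<^sub>1)\<^sup>M, j(A))\<close>, and it remains to see that \<open>M\<close> and \<open>W = V[H]\<close> have the
  same \<open>H(\<aleph>\<^sub>1)\<close>. If \<open>x\<close> is hereditarily countable in \<open>W\<close>, an enumeration of its transitive closure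
  yields sets of (pairs of) natural numbers that code \<open>x\<close>. They belong to \<open>W\<close> because \<open>W\<close> satisfies
  Separation (the forcing theorem), hence to the stage \<open>j(l)\<close> of the cumulative hierarchy of \<open>W\<close>, which
  is an element of \<open>M\<close>. By elementarity \<open>M\<close> satisfies ZF, so it can decode them by a Mostowski
  collapse, which recovers \<open>x\<close> and its enumeration in \<open>M\<close>.
\<close>

section \<open>Formulas\<close>

text \<open>The obstacle is to find a hereditarily countable set of \<open>W\<close> inside
  \<open>M\<close>. The axiom supplies a large stage of the hierarchy of \<open>W\<close> as an
  element of \<open>M\<close>, but placing the set itself in that stage would need a bound on its
  rank. Its codes are subsets of \<open>\<omega>\<close> or of
  \<open>\<omega> \<times> \<omega>\<close>, and \<open>\<omega> \<in> j(l)\<close> alone puts them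
  there. The codes are defined over \<open>W\<close> from an enumeration, which is why Separation in
  \<open>W\<close> is wanted. The relation \<open>forces\<close> quantifies over generic filters and
  gives no definition inside \<open>V\<close>; a second relation, \<open>forced\<close>, is
  therefore built from formulas evaluated in \<open>V\<close> and tied to \<open>W\<close> by a
  truth lemma. Elementarity of \<open>j\<close> concerns formulas without the predicate and
  assignments in \<open>V\<close>. So \<open>A\<close> becomes a parameter of relativised formulas,
  and ZF reaches \<open>M\<close> one universally closed formula at a time.\<close>

definition env :: "hc set \<Rightarrow> (nat \<Rightarrow> hc) \<Rightarrow> bool" where
  "env N e \<longleftrightarrow> range e \<subseteq> N"

lemma env_upd [simp]: "env N e \<Longrightarrow> x \<in> N \<Longrightarrow> env N (e(n := x))"
  by (auto simp: env_def)

lemma env_in [simp]: "env N e \<Longrightarrow> e n \<in> N"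
  by (auto simp: env_def)

lemma env_const [simp]: "x \<in> N \<Longrightarrow> env N (\<lambda>_. x)"
  by (auto simp: env_def)

text \<open>Quantified variables are counted too, so every index from \<open>fbound \<phi>\<close>
  on is fresh for \<open>\<phi>\<close>, and quantifying all indices below it closes the
  formula.\<close>

primrec fbound :: "fm \<Rightarrow> nat" where
  "fbound (Mem m n) = Suc (max m n)"
| "fbound (Eq m n) = Suc (max m n)"
| "fbound (Pred n) = Suc n"
| "fbound (Neg \<phi>) = fbound \<phi>"
| "fbound (And \<phi> \<psi>) = max (fbound \<phi>) (fbound \<psi>)"
| "fbound (All n \<phi>) = max (Suc n) (fbound \<phi>)"

lemma sat_cong:
  "(\<And>i. i < fbound \<phi> \<Longrightarrow> e i = e' i) \<Longrightarrow> sat D U e \<phi> \<longleftrightarrow> sat D U e' \<phi>"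
proof (induction \<phi> arbitrary: e e')
  case (All n \<phi>)
  have "sat D U (e(n := x)) \<phi> \<longleftrightarrow> sat D U (e'(n := x)) \<phi>" for x
    by (rule All.IH) (use All.prems in auto)
  then show ?case by simp
next
  case (And \<phi> \<psi>)
  have "sat D U e \<phi> \<longleftrightarrow> sat D U e' \<phi>" "sat D U e \<psi> \<longleftrightarrow> sat D U e' \<psi>"
    by (rule And.IH; use And.prems in simp)+
  then show ?case by simp
next
  case (Neg \<phi>)
  have "sat D U e \<phi> \<longleftrightarrow> sat D U e' \<phi>"
    by (rule Neg.IH) (use Neg.prems in simp)
  then show ?case by simp
qed auto

definition fOr :: "fm \<Rightarrow> fm \<Rightarrow> fm" where "fOr \<phi> \<psi> = Neg (And (Neg \<phi>) (Neg \<psi>))"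
definition fImp :: "fm \<Rightarrow> fm \<Rightarrow> fm" where "fImp \<phi> \<psi> = Neg (And \<phi> (Neg \<psi>))"
definition fIff :: "fm \<Rightarrow> fm \<Rightarrow> fm" where "fIff \<phi> \<psi> = And (fImp \<phi> \<psi>) (fImp \<psi> \<phi>)"
definition fEx :: "nat \<Rightarrow> fm \<Rightarrow> fm" where "fEx n \<phi> = Neg (All n (Neg \<phi>))"
definition fBall :: "nat \<Rightarrow> nat \<Rightarrow> fm \<Rightarrow> fm" where "fBall n m \<phi> = All n (fImp (Mem n m) \<phi>)"
definition fBex :: "nat \<Rightarrow> nat \<Rightarrow> fm \<Rightarrow> fm" where "fBex n m \<phi> = fEx n (And (Mem n m) \<phi>)"

lemma pred_free_connectives [simp]:
  "pred_free (fOr \<phi> \<psi>) \<longleftrightarrow> pred_free \<phi> \<and> pred_free \<psi>"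
  "pred_free (fImp \<phi> \<psi>) \<longleftrightarrow> pred_free \<phi> \<and> pred_free \<psi>"
  "pred_free (fIff \<phi> \<psi>) \<longleftrightarrow> pred_free \<phi> \<and> pred_free \<psi>"
  "pred_free (fEx n \<phi>) \<longleftrightarrow> pred_free \<phi>"
  "pred_free (fBall n m \<phi>) \<longleftrightarrow> pred_free \<phi>"
  "pred_free (fBex n m \<phi>) \<longleftrightarrow> pred_free \<phi>"
  by (auto simp: fOr_def fImp_def fIff_def fEx_def fBall_def fBex_def)

lemma sat_connectives [simp]:
  "sat D U e (fOr \<phi> \<psi>) \<longleftrightarrow> sat D U e \<phi> \<or> sat D U e \<psi>"
  "sat D U e (fImp \<phi> \<psi>) \<longleftrightarrow> (sat D U e \<phi> \<longrightarrow> sat D U e \<psi>)"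
  "sat D U e (fIff \<phi> \<psi>) \<longleftrightarrow> (sat D U e \<phi> \<longleftrightarrow> sat D U e \<psi>)"
  "sat D U e (fEx n \<phi>) \<longleftrightarrow> (\<exists>x\<in>D. sat D U (e(n := x)) \<phi>)"
  by (auto simp: fOr_def fImp_def fIff_def fEx_def)

lemma transitiveD: "transitive N \<Longrightarrow> x \<in> N \<Longrightarrow> y \<in> elts x \<Longrightarrow> y \<in> N"
  by (auto simp: transitive_def)

text \<open>A copy of \<open>transitive\<close>: with \<open>transitive\<close> itself the simplification rule below would loop on
  goals about transitive sets \<open>elts x\<close>.\<close>

definition tmodel :: "hc set \<Rightarrow> bool" where
  "tmodel N \<longleftrightarrow> transitive N"

lemma tmodel_memI [simp]: "tmodel N \<Longrightarrow> y \<in> elts x \<Longrightarrow> x \<in> N \<Longrightarrow> y \<in> N"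
  by (auto simp: tmodel_def transitive_def)

text \<open>The quantified variable must be known to lie in the bound when \<open>env\<close> is checked.\<close>

lemmas [cong] = ball_cong_simp bex_cong_simp

text \<open>Elements of a member of a transitive model are in the model, so bounded quantifiers mean
  the same inside and outside. The condition \<open>n \<noteq> m\<close> keeps the bound from being
  overwritten by the quantified variable.\<close>

lemma sat_bounded [simp]:
  assumes "tmodel N" "env N e" "n \<noteq> m"
  shows "sat N U e (fBall n m \<phi>) \<longleftrightarrow> (\<forall>x\<in>elts (e m). sat N U (e(n := x)) \<phi>)"
    and "sat N U e (fBex n m \<phi>) \<longleftrightarrow> (\<exists>x\<in>elts (e m). sat N U (e(n := x)) \<phi>)"
  using assms tmodel_memI[OF assms(1), of _ "e m"] by (auto simp: fBall_def fBex_def)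

text \<open>In this and similar formulas the bound variable is the successor of the sum of the free
  ones, hence different from each of them.\<close>

definition fSub :: "nat \<Rightarrow> nat \<Rightarrow> fm" where
  "fSub m n = (let k = Suc (m + n) in fBall k m (Mem k n))"

definition fUpair :: "nat \<Rightarrow> nat \<Rightarrow> nat \<Rightarrow> fm" where
  "fUpair z x y = (let k = Suc (z + x + y) in
     And (And (Mem x z) (Mem y z)) (fBall k z (fOr (Eq k x) (Eq k y))))"

definition fPair :: "nat \<Rightarrow> nat \<Rightarrow> nat \<Rightarrow> fm" where
  "fPair z x y = (let k = Suc (z + x + y) in
     And (And (fBex k z (fUpair k x x)) (fBex k z (fUpair k x y)))
       (fBall k z (fOr (fUpair k x x) (fUpair k x y))))"

definition fPairIn :: "nat \<Rightarrow> nat \<Rightarrow> nat \<Rightarrow> fm" where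
  "fPairIn x y f = (let k = Suc (x + y + f) in fBex k f (fPair k x y))"

definition fTrans :: "nat \<Rightarrow> fm" where
  "fTrans x = fBall (Suc x) x (fSub (Suc x) x)"

lemma pred_free_macros [simp]:
  "pred_free (fSub m n)" "pred_free (fUpair z x y)" "pred_free (fPair z x y)"
  "pred_free (fPairIn x y f)" "pred_free (fTrans x)"
  by (simp_all add: fSub_def fUpair_def fPair_def fPairIn_def fTrans_def Let_def)

lemma elts_eq_iff: "x = hset S \<longleftrightarrow> elts x = S" if "countable S"
  using that by (simp add: hc_ext)

lemma hc_eqI: "elts x = elts y \<Longrightarrow> x = y"
  by (simp add: hc_ext)

context
  fixes N e assumes N: "tmodel N" "env N e"
begin

lemma sat_fSub [simp]: "sat N U e (fSub m n) \<longleftrightarrow> elts (e m) \<subseteq> elts (e n)"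
  using N by (auto simp: fSub_def Let_def)

lemma sat_fUpair [simp]: "sat N U e (fUpair z x y) \<longleftrightarrow> e z = hset {e x, e y}"
  using N by (auto simp: fUpair_def Let_def elts_eq_iff)

end

lemma doubleton_char: "S = {a, b} \<longleftrightarrow> a \<in> S \<and> b \<in> S \<and> (\<forall>x\<in>S. x = a \<or> x = b)"
  by auto

context
  fixes N e assumes N: "tmodel N" "env N e"
begin

text \<open>The context is closed and reopened because the formula for pairs evaluates
  \<open>fUpair\<close> at an updated assignment, and \<open>sat_fUpair\<close> becomes available
  for other assignments only outside the context that fixes \<open>e\<close>.\<close>

lemma sat_fPair [simp]: "sat N U e (fPair z x y) \<longleftrightarrow> e z = hpair (e x) (e y)"
  using N by (simp add: fPair_def Let_def hpair_def hc_ext[of "e z"] doubleton_char)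

end

context
  fixes N e assumes N: "tmodel N" "env N e"
begin

lemma sat_fPairIn [simp]: "sat N U e (fPairIn x y f) \<longleftrightarrow> hpair (e x) (e y) \<in> elts (e f)"
  using N by (auto simp add: fPairIn_def Let_def)

lemma sat_fTrans [simp]: "sat N U e (fTrans x) \<longleftrightarrow> transitive (elts (e x))"
  using N by (simp add: fTrans_def transitive_def[of "elts _"])

end

lemma hpair_components:
  assumes "tmodel N" "hpair x y \<in> N"
  shows "x \<in> N" "y \<in> N"
proof -
  have "hset {x, y} \<in> N"
    by (rule tmodel_memI[OF assms(1) _ assms(2)]) (simp add: hpair_def)
  then show "x \<in> N" "y \<in> N"
    by (auto intro: tmodel_memI[OF assms(1), of _ "hset {x, y}"])
qed

definition fEmpty :: "nat \<Rightarrow> fm" where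
  "fEmpty x = All (Suc x) (Neg (Mem (Suc x) x))"

definition fSucc :: "nat \<Rightarrow> nat \<Rightarrow> fm" where
  "fSucc y x = (let k = Suc (x + y) in
     And (And (Mem x y) (fSub x y)) (fBall k y (fOr (Eq k x) (Mem k x))))"

definition hsucc :: "hc \<Rightarrow> hc" where
  "hsucc x = hset (insert x (elts x))"

lemma elts_hsucc [simp]: "elts (hsucc x) = insert x (elts x)"
  by (simp add: hsucc_def)

lemma hnat_Suc: "hnat (Suc n) = hsucc (hnat n)"
  by (simp add: hsucc_def)

lemma elts_homega [simp]: "elts homega = range hnat"
  by (simp add: homega_def)

lemma elts_hnat: "elts (hnat n) = hnat ` {..<n}"
  by (induction n) (auto simp: hnat_Suc lessThan_Suc simp del: hnat.simps(2))

definition fOmega :: "nat \<Rightarrow> fm" where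
  "fOmega w = And (And (fBex (Suc w) w (fEmpty (Suc w)))
     (fBall (Suc w) w (fBex (Suc (Suc w)) w (fSucc (Suc (Suc w)) (Suc w)))))
     (fBall (Suc w) w (fOr (fEmpty (Suc w)) (fBex (Suc (Suc w)) w (fSucc (Suc w) (Suc (Suc w))))))"

lemma pred_free_macros2 [simp]:
  "pred_free (fEmpty x)" "pred_free (fSucc y x)" "pred_free (fOmega w)"
  by (simp_all add: fEmpty_def fSucc_def fOmega_def Let_def)

lemma hc_induct [case_names step]:
  assumes "\<And>x. (\<And>y. y \<in> elts x \<Longrightarrow> P y) \<Longrightarrow> P x"
  shows "P x"
  by (rule wf_induct_rule[OF wf_mem_rel]) (use assms in \<open>auto simp: mem_rel_def\<close>)

text \<open>A bounded characterisation, hence absolute for transitive models. The last clause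
  excludes further elements: a descent through predecessors inside \<open>w\<close> must stop at the
  empty set, as membership is well-founded.\<close>

lemma homega_iff:
  "w = homega \<longleftrightarrow> hset {} \<in> elts w \<and> (\<forall>x\<in>elts w. hsucc x \<in> elts w) \<and>
     (\<forall>x\<in>elts w. x = hset {} \<or> (\<exists>y\<in>elts w. x = hsucc y))" (is "_ \<longleftrightarrow> ?R")
proof
  assume "w = homega"
  moreover have "hnat n = hset {} \<or> (\<exists>m. hnat n = hsucc (hnat m))" for n
    by (cases n) (auto simp: hsucc_def)
  moreover have "hset {} = hnat 0" "hsucc (hnat n) = hnat (Suc n)" for n
    by (simp_all add: hsucc_def)
  ultimately show ?R
    by (auto simp del: hnat.simps)
next
  assume R: ?R
  have "hnat n \<in> elts w" for n
    by (induction n) (use R in \<open>auto simp: hsucc_def\<close>)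
  moreover have "x \<in> elts w \<Longrightarrow> x \<in> range hnat" for x
  proof (induction x rule: hc_induct)
    case (step x)
    with R consider "x = hset {}" | y where "y \<in> elts w" "x = hsucc y" by blast
    then show ?case
    proof cases
      case 1 then show ?thesis by (metis hnat.simps(1) rangeI)
    next
      case 2
      then obtain n where "y = hnat n" using step.IH[of y] by auto
      then show ?thesis using 2 hnat_Suc by (metis rangeI)
    qed
  qed
  ultimately show "w = homega"
    by (intro hc_eqI) auto
qed

context
  fixes N e assumes N: "tmodel N" "env N e"
begin

lemma sat_fEmpty [simp]: "sat N U e (fEmpty x) \<longleftrightarrow> e x = hset {}"
  using N by (auto simp: fEmpty_def elts_eq_iff)

lemma sat_fSucc [simp]: "sat N U e (fSucc y x) \<longleftrightarrow> e y = hsucc (e x)"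
  using N by (auto simp: fSucc_def Let_def hc_ext[of "e y" "hsucc _"])

end

lemma sat_fOmega [simp]:
  assumes N: "tmodel N" "env N e"
  shows "sat N U e (fOmega w) \<longleftrightarrow> e w = homega"
  unfolding homega_iff fOmega_def
  using N by simp

section \<open>Transitive models of ZF\<close>

lemma trancl_mem_rel_iff:
  "(y, x) \<in> mem_rel\<^sup>+ \<longleftrightarrow> y \<in> elts x \<or> (\<exists>z\<in>elts x. (y, z) \<in> mem_rel\<^sup>+)"
proof
  assume "(y, x) \<in> mem_rel\<^sup>+"
  then show "y \<in> elts x \<or> (\<exists>z\<in>elts x. (y, z) \<in> mem_rel\<^sup>+)"
    by (cases rule: tranclE) (auto simp: mem_rel_def)
next
  assume "y \<in> elts x \<or> (\<exists>z\<in>elts x. (y, z) \<in> mem_rel\<^sup>+)"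
  then show "(y, x) \<in> mem_rel\<^sup>+"
    by (auto simp: mem_rel_def intro: trancl_into_trancl)
qed

lemma countable_below: "countable {y. (y, x) \<in> mem_rel\<^sup>+}"
proof (induction x rule: hc_induct)
  case (step x)
  have "{y. (y, x) \<in> mem_rel\<^sup>+} = elts x \<union> (\<Union>z\<in>elts x. {y. (y, z) \<in> mem_rel\<^sup>+})"
    by (auto simp: trancl_mem_rel_iff[of _ x])
  then show ?case
    using step by auto
qed

lemma in_tc_iff: "y \<in> elts (tc x) \<longleftrightarrow> (y, x) \<in> mem_rel\<^sup>+"
  by (simp add: tc_def countable_below)

lemma elts_tc: "elts (tc x) = elts x \<union> (\<Union>z\<in>elts x. elts (tc z))"
  by (simp only: set_eq_iff Un_iff UN_iff in_tc_iff) (rule allI, rule trancl_mem_rel_iff)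

lemma tc_induct [case_names step]:
  assumes "\<And>x. (\<And>y. y \<in> elts (tc x) \<Longrightarrow> P y) \<Longrightarrow> P x"
  shows "P x"
  by (rule wf_induct_rule[OF wf_trancl[OF wf_mem_rel]]) (use assms in \<open>auto simp: in_tc_iff\<close>)

lemma transitive_tc: "transitive (elts (tc x))"
proof -
  have "(z, x) \<in> mem_rel\<^sup>+" if "(y, x) \<in> mem_rel\<^sup>+" "z \<in> elts y" for y z
    by (rule trancl_into_trancl2[OF _ that(1)]) (simp add: mem_rel_def that(2))
  then show ?thesis
    by (auto simp: transitive_def in_tc_iff)
qed

lemma tc_least: "transitive T \<Longrightarrow> elts x \<subseteq> T \<Longrightarrow> elts (tc x) \<subseteq> T"
proof (induction x rule: hc_induct)
  case (step x)
  have "elts (tc z) \<subseteq> T" if "z \<in> elts x" for z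
    using step.prems that by (intro step.IH) (auto simp: transitive_def)
  then show ?case
    using step.prems by (subst elts_tc) blast
qed

lemma elts_subset_tc: "elts x \<subseteq> elts (tc x)"
  by (subst elts_tc) auto

lemma countable_hpair_image [simp]: "countable {hpair x y | x y. x \<in> elts a \<and> y \<in> elts b}"
proof -
  have "{hpair x y | x y. x \<in> elts a \<and> y \<in> elts b} = (\<lambda>(x, y). hpair x y) ` (elts a \<times> elts b)"
    by auto
  then show ?thesis by simp
qed

definition hprod :: "hc \<Rightarrow> hc \<Rightarrow> hc" where
  "hprod a b = hset {hpair x y | x y. x \<in> elts a \<and> y \<in> elts b}"

lemma elts_hprod [simp]: "elts (hprod a b) = {hpair x y | x y. x \<in> elts a \<and> y \<in> elts b}"
  by (simp add: hprod_def)

definition fTc :: "nat \<Rightarrow> nat \<Rightarrow> fm" where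
  "fTc t x = (let k = Suc (t + x) in And (And (fTrans t) (fSub x t))
     (All k (fImp (And (fTrans k) (fSub x k)) (fSub t k))))"

lemma pred_free_fTc [simp]: "pred_free (fTc t x)"
  by (simp add: fTc_def Let_def)

text \<open>ZF in external form: since \<open>N\<close> is transitive, the set asserted by an axiom
  is the actual one, and since \<open>N\<close> is countable, \<open>hset\<close> names it.
  Foundation is inherited from the ambient type.\<close>

locale zf =
  fixes N :: "hc set"
  assumes countable_N [simp]: "countable N"
    and trans [simp]: "tmodel N"
    and upair [simp]: "x \<in> N \<Longrightarrow> y \<in> N \<Longrightarrow> hset {x, y} \<in> N"
    and union: "x \<in> N \<Longrightarrow> hset (\<Union>y\<in>elts x. elts y) \<in> N"
    and power: "x \<in> N \<Longrightarrow> hset {y \<in> N. elts y \<subseteq> elts x} \<in> N"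
    and omega [simp]: "homega \<in> N"
    and separation: "pred_free \<phi> \<Longrightarrow> env N e \<Longrightarrow> a \<in> N \<Longrightarrow>
      hset {x \<in> elts a. sat N {} (e(0 := x)) \<phi>} \<in> N"
    and replacement: "pred_free \<phi> \<Longrightarrow> env N e \<Longrightarrow> a \<in> N \<Longrightarrow>
      (\<And>x. x \<in> elts a \<Longrightarrow> \<exists>!y. y \<in> N \<and> sat N {} (e(0 := x, 1 := y)) \<phi>) \<Longrightarrow>
      hset {y \<in> N. \<exists>x\<in>elts a. sat N {} (e(0 := x, 1 := y)) \<phi>} \<in> N"
begin

lemma mem_N: "y \<in> elts x \<Longrightarrow> x \<in> N \<Longrightarrow> y \<in> N"
  by (rule tmodel_memI[OF trans])

lemma countable_subset_N [simp]: "countable {x \<in> N. P x}"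
  by (rule countable_subset[OF _ countable_N]) auto

lemma sep_set:
  assumes "pred_free \<phi>" "env N e" "a \<in> N" "S \<subseteq> elts a"
    and "\<And>x. x \<in> elts a \<Longrightarrow> x \<in> N \<Longrightarrow> x \<in> S \<longleftrightarrow> sat N {} (e(0 := x)) \<phi>"
  shows "hset S \<in> N"
proof -
  have "S = {x \<in> elts a. sat N {} (e(0 := x)) \<phi>}"
    using assms(3-5) mem_N by blast
  then show ?thesis using separation[OF assms(1-3)] by simp
qed

lemma sing [simp]: "x \<in> N \<Longrightarrow> hset {x} \<in> N"
  using upair[of x x] by simp

lemma hpair_N [simp]: "hpair x y \<in> N \<longleftrightarrow> x \<in> N \<and> y \<in> N"
  using hpair_components[OF trans, of x y] by (auto simp: hpair_def)

lemma un [simp]: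
  assumes "x \<in> N" "y \<in> N"
  shows "hset (elts x \<union> elts y) \<in> N"
  using union[OF upair[OF assms]] by simp

lemma insert_N [simp]: "x \<in> N \<Longrightarrow> y \<in> N \<Longrightarrow> hset (insert x (elts y)) \<in> N"
  using un[of "hset {x}" y] by simp

lemma hsucc_N [simp]: "x \<in> N \<Longrightarrow> hsucc x \<in> N"
  by (simp add: hsucc_def)

lemma hprod_N [simp]:
  assumes ab: "a \<in> N" "b \<in> N"
  shows "hprod a b \<in> N"
proof -
  let ?p = "\<lambda>x. hset {y \<in> N. elts y \<subseteq> elts x}"
  \<comment> \<open>Both \<open>{x}\<close> and \<open>{x, y}\<close> are subsets of the union of
    \<open>a\<close> and \<open>b\<close>, so the pair lies in the second power set.\<close>
  define u where "u = ?p (?p (hset (elts a \<union> elts b)))"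
  have u: "u \<in> N"
    unfolding u_def by (intro power un ab)
  have in_u: "hpair x y \<in> elts u" if "x \<in> elts a" "y \<in> elts b" for x y
  proof -
    have "x \<in> N" "y \<in> N"
      using that ab by (auto intro: mem_N)
    then have "hpair x y \<in> N" by simp
    then show ?thesis
      using that \<open>x \<in> N\<close> \<open>y \<in> N\<close> by (simp add: u_def) (auto simp: hpair_def)
  qed
  obtain e where e: "env N e" "e = (\<lambda>_. a)(1 := a, 2 := b)"
    using ab by auto
  have "hset {hpair x y | x y. x \<in> elts a \<and> y \<in> elts b} \<in> N"
    by (rule sep_set[where \<phi> = "fBex 3 1 (fBex 4 2 (fPair 0 3 4))" and e = e and a = u])
       (use u in_u ab e in \<open>auto intro: mem_N\<close>)
  then show ?thesis by (simp add: hprod_def)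
qed

lemma repl_fun:
  assumes \<phi>: "pred_free \<phi>" "env N e" "a \<in> N"
    and F: "\<And>x y. x \<in> elts a \<Longrightarrow> y \<in> N \<Longrightarrow> sat N {} (e(0 := x, 1 := y)) \<phi> \<longleftrightarrow> y = F x"
      "\<And>x. x \<in> elts a \<Longrightarrow> F x \<in> N"
  shows "hset (F ` elts a) \<in> N"
proof -
  have "F ` elts a = {y \<in> N. \<exists>x\<in>elts a. sat N {} (e(0 := x, 1 := y)) \<phi>}"
    using F by auto
  moreover have "\<exists>!y. y \<in> N \<and> sat N {} (e(0 := x, 1 := y)) \<phi>" if "x \<in> elts a" for x
    using F[OF that] by auto
  ultimately show ?thesis
    using replacement[OF \<phi>] by simp
qed

lemma repl_graph:
  assumes \<phi>: "pred_free \<phi>" "env N e" "a \<in> N"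
    and F: "\<And>x y. x \<in> elts a \<Longrightarrow> y \<in> N \<Longrightarrow> sat N {} (e(0 := x, 1 := y)) \<phi> \<longleftrightarrow> y = F x"
      "\<And>x. x \<in> elts a \<Longrightarrow> F x \<in> N"
  shows "hset ((\<lambda>x. hpair x (F x)) ` elts a) \<in> N"
proof -
  obtain k where k: "fbound \<phi> \<le> k" "k > 1"
    by (metis less_add_one max.cobounded1 max.strict_coboundedI2)
  then have [simp]: "k \<noteq> 0" "k \<noteq> Suc 0" "0 \<noteq> k" "Suc 0 \<noteq> k" by auto
  \<comment> \<open>Variable 1 holds the pair and must be rebound to the value \<open>F x\<close>;
    the fresh variable \<open>k\<close> keeps the pair.\<close>
  let ?\<psi> = "fEx k (And (Eq k 1) (fEx 1 (And (fPair k 0 1) \<phi>)))"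
  show ?thesis
  proof (rule repl_fun[where \<phi> = ?\<psi> and e = e])
    fix x u assume x: "x \<in> elts a" and u: "u \<in> N"
    have xN: "x \<in> N" using x \<phi> by (blast intro: mem_N)
    have eq: "sat N {} (e(0 := x, k := v, Suc 0 := d)) \<phi> \<longleftrightarrow> d = F x" if "d \<in> N" for d v
    proof -
      have "sat N {} (e(0 := x, k := v, Suc 0 := d)) \<phi> \<longleftrightarrow> sat N {} (e(0 := x, 1 := d)) \<phi>"
        using k by (intro sat_cong) auto
      then show ?thesis using F(1)[OF x that] by simp
    qed
    show "sat N {} (e(0 := x, 1 := u)) ?\<psi> \<longleftrightarrow> u = hpair x (F x)"
      using \<phi>(2) u xN F(2)[OF x] by (auto simp: eq)
  qed (use \<phi> F in \<open>auto intro: mem_N\<close>)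
qed

text \<open>Unlike the bounded formulas, \<open>fTc\<close> compares the candidate with all
  transitive supersets in the model. The comparison pins down the true closure once this is known to
  be in the model, hence the second hypothesis; \<open>tc_N\<close> discharges it.\<close>

lemma sat_fTc_tc:
  assumes "env N e" "tc (e x) \<in> N"
  shows "sat N U e (fTc t x) \<longleftrightarrow> e t = tc (e x)"
proof -
  have "sat N U e (fTc t x) \<longleftrightarrow> transitive (elts (e t)) \<and> elts (e x) \<subseteq> elts (e t) \<and>
      (\<forall>s\<in>N. transitive (elts s) \<and> elts (e x) \<subseteq> elts s \<longrightarrow> elts (e t) \<subseteq> elts s)"
    using assms(1) by (simp add: fTc_def Let_def)
  also have "\<dots> \<longleftrightarrow> e t = tc (e x)"
    (is "?L \<longleftrightarrow> _")
  proof
    assume L: ?L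
    then have "elts (e t) \<subseteq> elts (tc (e x))"
      using assms(2) transitive_tc elts_subset_tc by blast
    moreover have "elts (tc (e x)) \<subseteq> elts (e t)"
      using L tc_least by blast
    ultimately show "e t = tc (e x)"
      by (intro hc_eqI) blast
  next
    assume "e t = tc (e x)"
    then show ?L
      using transitive_tc elts_subset_tc tc_least by simp
  qed
  finally show ?thesis .
qed

text \<open>Induction on membership in the ambient universe replaces a recursion inside the model:
  when the closures of all elements of \<open>x\<close> are in \<open>N\<close>, \<open>fTc\<close>
  defines them, Replacement collects them, and unions yield the closure of \<open>x\<close>.\<close>

lemma tc_N [simp]: "x \<in> N \<Longrightarrow> tc x \<in> N"
proof (induction x rule: hc_induct)
  case (step x)
  have IH: "y \<in> elts x \<Longrightarrow> tc y \<in> N" for y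
    using step mem_N by blast
  have "hset (tc ` elts x) \<in> N"
    by (rule repl_fun[where \<phi> = "fTc 1 0" and e = "\<lambda>_. x"])
       (use step.prems IH in \<open>auto simp: sat_fTc_tc intro: mem_N\<close>)
  from un[OF step.prems union[OF this]]
  have "hset (elts x \<union> (\<Union>y\<in>elts x. elts (tc y))) \<in> N"
    by simp
  moreover have "hset (elts x \<union> (\<Union>y\<in>elts x. elts (tc y))) = tc x"
    by (rule hc_eqI, subst (2) elts_tc) simp
  ultimately show ?case by simp
qed

lemma sat_fTc [simp]: "env N e \<Longrightarrow> sat N U e (fTc t x) \<longleftrightarrow> e t = tc (e x)"
  by (rule sat_fTc_tc) auto

end

text \<open>Recursion on membership inside the model: \<open>\<phi>\<close> expresses that the value of the function
  at the argument \<open>0\<close> is \<open>1\<close>, as computed from the part \<open>2\<close> of its graph.\<close>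

locale zf_rec = zf +
  fixes K :: "hc set" and \<Phi> :: "hc \<Rightarrow> hc" and \<phi> :: fm and e :: "nat \<Rightarrow> hc"
  assumes \<phi>: "pred_free \<phi>" and e: "env N e"
    and correct: "\<And>z y d. z \<in> N \<Longrightarrow> y \<in> N \<Longrightarrow> d \<in> N \<Longrightarrow> sat N {} (e(2 := z, 0 := y, 1 := d)) \<phi> \<Longrightarrow>
        (\<And>y' d'. y' \<in> elts y \<Longrightarrow> hpair y' d' \<in> elts z \<Longrightarrow> y' \<in> K \<and> d' = \<Phi> y') \<Longrightarrow> y \<in> K \<and> d = \<Phi> y"
    and exist: "\<And>z y. z \<in> N \<Longrightarrow> y \<in> N \<Longrightarrow> y \<in> K \<Longrightarrow>
        (\<And>y'. y' \<in> elts y \<Longrightarrow> hpair y' (\<Phi> y') \<in> elts z) \<Longrightarrow>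
        (\<And>y' d'. hpair y' d' \<in> elts z \<Longrightarrow> y' \<in> K \<and> d' = \<Phi> y') \<Longrightarrow>
        \<Phi> y \<in> N \<and> sat N {} (e(2 := z, 0 := y, 1 := \<Phi> y)) \<phi>"
    and K_down: "\<And>y z. y \<in> K \<Longrightarrow> z \<in> elts y \<Longrightarrow> z \<in> K"
begin

text \<open>Closure of the domain under elements is left to \<open>\<phi>\<close>, which in each use
  demands that \<open>z\<close> have a value at every element of its argument.\<close>

definition attempt :: "hc \<Rightarrow> bool" where
  "attempt z \<longleftrightarrow> (\<forall>y\<in>N. \<forall>d\<in>N. hpair y d \<in> elts z \<longrightarrow> sat N {} (e(2 := z, 0 := y, 1 := d)) \<phi>)"

definition fGraph :: fm where
  "fGraph = fEx 2 (And (fPairIn 0 1 2) (All 0 (All 1 (fImp (fPairIn 0 1 2) \<phi>))))"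

lemma pred_free_fGraph [simp]: "pred_free fGraph"
  using \<phi> by (simp add: fGraph_def)

lemma sat_fGraph_attempt:
  "y \<in> N \<Longrightarrow> d \<in> N \<Longrightarrow>
    sat N {} (e(0 := y, 1 := d)) fGraph \<longleftrightarrow> (\<exists>z\<in>N. attempt z \<and> hpair y d \<in> elts z)"
  using e by (auto simp: fGraph_def attempt_def)

lemma attempt_correct:
  "attempt z \<Longrightarrow> z \<in> N \<Longrightarrow> hpair y d \<in> elts z \<Longrightarrow> y \<in> K \<and> d = \<Phi> y"
proof (induction y arbitrary: d rule: hc_induct)
  case (step y)
  then have "hpair y d \<in> N" by (blast intro: mem_N)
  then have "y \<in> N" "d \<in> N" by simp_all
  with step show ?case
    by (intro correct[of z y d]) (auto simp: attempt_def)
qed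

definition good :: "hc \<Rightarrow> bool" where
  "good y \<longleftrightarrow> \<Phi> y \<in> N \<and> (\<exists>z\<in>N. attempt z \<and> hpair y (\<Phi> y) \<in> elts z)"

lemma graph_good:
  assumes t: "t \<in> N" and good: "\<And>y. y \<in> elts t \<Longrightarrow> good y"
  shows "hset ((\<lambda>y. hpair y (\<Phi> y)) ` elts t) \<in> N"
proof (rule repl_graph[where \<phi> = fGraph and e = e])
  fix y d assume y: "y \<in> elts t" and d: "d \<in> N"
  then have "y \<in> N" using t by (blast intro: mem_N)
  show "sat N {} (e(0 := y, 1 := d)) fGraph \<longleftrightarrow> d = \<Phi> y"
    unfolding sat_fGraph_attempt[OF \<open>y \<in> N\<close> d]
    using good[OF y] attempt_correct[of _ y d] by (auto simp: good_def)
qed (use t e good in \<open>auto simp: good_def\<close>)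

text \<open>Induction along the transitive closure. The graph on \<open>tc x\<close> is a set by
  Replacement, and \<open>exist\<close> applied to it puts the value at \<open>x\<close> into the
  model. The graph enlarged by the new pair must again be an attempt, so \<open>exist\<close> is
  applied once more at every argument of it.\<close>

lemma good: "y \<in> N \<Longrightarrow> y \<in> K \<Longrightarrow> good y"
proof (induction y rule: tc_induct)
  case (step x)
  have K: "y \<in> K" if "y \<in> elts (tc x)" for y
    using tc_least[of K x] K_down step.prems that by (auto simp: transitive_def)
  define z where "z = hset ((\<lambda>y. hpair y (\<Phi> y)) ` elts (tc x))"
  have z: "elts z = (\<lambda>y. hpair y (\<Phi> y)) ` elts (tc x)"
    by (simp add: z_def)
  have "good y" if "y \<in> elts (tc x)" for y
    using step.IH[OF that] K that step.prems mem_N[OF that] by simp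
  then have "z \<in> N"
    unfolding z_def by (intro graph_good tc_N step.prems) simp_all
  then have \<Phi>x: "\<Phi> x \<in> N"
    using step.prems K elts_subset_tc[of x]
    by (intro exist[of z x, THEN conjunct1]) (auto simp: z)
  define z' where "z' = hset (insert (hpair x (\<Phi> x)) (elts z))"
  have z': "elts z' = insert (hpair x (\<Phi> x)) (elts z)" "z' \<in> N"
    using \<open>z \<in> N\<close> \<Phi>x step.prems by (simp_all add: z'_def)
  have down: "y' \<in> elts (tc x)" if "hpair y (\<Phi> y) \<in> elts z'" "y' \<in> elts y" for y y'
    using that transitive_tc[of x] elts_subset_tc[of x] by (auto simp: z' z transitive_def)
  have "sat N {} (e(2 := z', 0 := y, 1 := d)) \<phi>"
    if y: "y \<in> N" "d \<in> N" "hpair y d \<in> elts z'" for y d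
  proof -
    have "d = \<Phi> y" "y \<in> K"
      using y K step.prems by (auto simp: z' z)
    have below: "hpair y' (\<Phi> y') \<in> elts z'" if "y' \<in> elts y" for y'
      using down[OF _ that] y(3) \<open>d = \<Phi> y\<close> by (simp add: z' z)
    have "\<Phi> y \<in> N \<and> sat N {} (e(2 := z', 0 := y, 1 := \<Phi> y)) \<phi>"
      using z'(2) y(1) \<open>y \<in> K\<close> below
    proof (rule exist)
      show "y' \<in> K \<and> d' = \<Phi> y'" if "hpair y' d' \<in> elts z'" for y' d'
        using that K step.prems by (auto simp: z' z)
    qed
    then show ?thesis using \<open>d = \<Phi> y\<close> by simp
  qed
  then have "attempt z'" by (simp add: attempt_def)
  then show ?case
    using \<Phi>x z' by (auto simp: good_def)
qed

text \<open>The formula also defines \<open>K\<close> inside \<open>N\<close>, which matters when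
  \<open>K\<close> is given only externally, as in the Mostowski collapse.\<close>

lemma sat_fGraph:
  assumes "y \<in> N" "d \<in> N"
  shows "sat N {} (e(0 := y, 1 := d)) fGraph \<longleftrightarrow> y \<in> K \<and> d = \<Phi> y"
  unfolding sat_fGraph_attempt[OF assms]
  using attempt_correct good assms by (auto simp: good_def)

lemma graph_N: "t \<in> N \<Longrightarrow> elts t \<subseteq> K \<Longrightarrow> hset ((\<lambda>y. hpair y (\<Phi> y)) ` elts t) \<in> N"
  by (rule graph_good) (auto intro!: good intro: mem_N)

lemma value_N: "y \<in> N \<Longrightarrow> y \<in> K \<Longrightarrow> \<Phi> y \<in> N"
  using good by (simp add: good_def)

end

section \<open>From relativised ZFC axioms to closure properties of a transitive model\<close>

lemma elts_unique:
  assumes "transitive N" "z \<in> N" "\<And>u. u \<in> N \<Longrightarrow> u \<in> elts z \<longleftrightarrow> P u" "\<And>u. P u \<Longrightarrow> u \<in> N"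
  shows "hset {u. P u} \<in> N"
proof -
  have "elts z = {u. P u}"
    using assms by (auto simp: transitive_def)
  then have "hset {u. P u} = z"
    by (metis countable_elts elts_hset hc_eqI)
  then show ?thesis using assms(2) by simp
qed

definition fNat :: "nat \<Rightarrow> fm" where
  "fNat n = And (fOr (fEmpty n) (fBex (Suc n) n (fSucc n (Suc n))))
     (fBall (Suc n) n (fOr (fEmpty (Suc n)) (fBex (Suc (Suc n)) n (fSucc (Suc n) (Suc (Suc n))))))"

lemma pred_free_fNat [simp]: "pred_free (fNat n)"
  by (simp add: fNat_def)

text \<open>This bounded description of a single natural number serves to cut
  \<open>\<omega>\<close> out of an arbitrary inductive set by Separation, at a stage where
  \<open>\<omega>\<close> itself is not yet known to be in the model.\<close>

lemma hnat_iff: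
  "n \<in> range hnat \<longleftrightarrow> (n = hset {} \<or> (\<exists>m\<in>elts n. n = hsucc m)) \<and>
     (\<forall>m\<in>elts n. m = hset {} \<or> (\<exists>k\<in>elts n. m = hsucc k))" (is "_ \<longleftrightarrow> ?R")
proof
  have "hnat k = hset {} \<or> (\<exists>m<k. hnat k = hsucc (hnat m))" for k
    by (cases k) (auto simp: hnat_Suc simp del: hnat.simps(2))
  then have *: "hnat k = hset {} \<or> (\<exists>m\<in>hnat ` {..<l}. hnat k = hsucc m)" if "k \<le> l" for k l
    using that by fastforce
  assume "n \<in> range hnat"
  then obtain k where k: "n = hnat k" by auto
  show ?R
    unfolding k elts_hnat using *[of k k] *[of _ k] by auto
next
  assume R: ?R
  have nat: "m \<in> elts n \<Longrightarrow> m \<in> range hnat" for m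
  proof (induction m rule: hc_induct)
    case (step m)
    with R consider "m = hset {}" | k where "k \<in> elts n" "m = hsucc k" by blast
    then show ?case
    proof cases
      case 1 then show ?thesis by (metis hnat.simps(1) rangeI)
    next
      case 2
      then obtain l where "k = hnat l" using step.IH[of k] by auto
      then show ?thesis using 2 hnat_Suc by (metis rangeI)
    qed
  qed
  from R consider "n = hset {}" | m where "m \<in> elts n" "n = hsucc m" by blast
  then show "n \<in> range hnat"
  proof cases
    case 1 then show ?thesis by (metis hnat.simps(1) rangeI)
  next
    case 2
    then show ?thesis using nat[of m] hnat_Suc by (metis image_iff rangeI)
  qed
qed

lemma sat_fNat [simp]: "tmodel N \<Longrightarrow> env N e \<Longrightarrow> sat N U e (fNat n) \<longleftrightarrow> e n \<in> range hnat"
  unfolding hnat_iff by (simp add: fNat_def)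

lemma homega_in_model:
  assumes N: "transitive N"
    and sep: "\<And>\<phi> e a. pred_free \<phi> \<Longrightarrow> env N e \<Longrightarrow> a \<in> N \<Longrightarrow>
      hset {x \<in> elts a. sat N {} (e(0 := x)) \<phi>} \<in> N"
    and w: "w \<in> N" "hset {} \<in> elts w" "\<And>x. x \<in> elts w \<Longrightarrow> hsucc x \<in> elts w"
  shows "homega \<in> N"
proof -
  have t: "tmodel N" using N by (simp add: tmodel_def)
  have "hnat n \<in> elts w" for n
    using w by (induction n) (auto simp: hnat_Suc simp del: hnat.simps(2))
  then have "{x \<in> elts w. x \<in> range hnat} = range hnat"
    by auto
  moreover have "{x \<in> elts w. sat N {} ((\<lambda>_. w)(0 := x)) (fNat 0)} = {x \<in> elts w. x \<in> range hnat}"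
    using w(1) t by (auto simp del: fun_upd_apply) (simp_all add: tmodel_memI)
  ultimately show ?thesis
    using sep[of "fNat 0" "\<lambda>_. w" w] w(1) by (simp add: homega_def)
qed

lemma zf_of_ctm:
  assumes "ctm V"
  shows "zf V"
proof -
  have tr: "transitive V" and cV: "countable V" and zfc: "zfc_model V"
    using assms by (simp_all add: ctm_def)
  have mem: "y \<in> V" if "y \<in> elts x" "x \<in> V" for x y
    using tr that by (auto simp: transitive_def)
  note z = zfc[unfolded zfc_model_def]
  have sep: "hset {x \<in> elts a. sat V {} (e(0 := x)) \<phi>} \<in> V"
    if "pred_free \<phi>" "env V e" "a \<in> V" for \<phi> e a
  proof -
    have "\<forall>\<phi> e. pred_free \<phi> \<and> range e \<subseteq> V \<longrightarrow>
      (\<forall>a\<in>V. \<exists>b\<in>V. \<forall>x\<in>V. x \<in> elts b \<longleftrightarrow> x \<in> elts a \<and> sat V {} (e(0 := x)) \<phi>)"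
      using z by (elim conjE)
    from this[rule_format, OF conjI, OF that(1) that(2)[unfolded env_def] that(3)]
    obtain b where "b \<in> V" "\<And>x. x \<in> V \<Longrightarrow> x \<in> elts b \<longleftrightarrow> x \<in> elts a \<and> sat V {} (e(0 := x)) \<phi>"
      by blast
    then show ?thesis
      by (rule elts_unique[OF tr]) (use that in \<open>auto intro: mem\<close>)
  qed
  show ?thesis
  proof
    show "tmodel V" using tr by (simp add: tmodel_def)
  next
    fix x y assume xy: "x \<in> V" "y \<in> V"
    have "\<forall>x\<in>V. \<forall>y\<in>V. \<exists>z\<in>V. \<forall>u\<in>V. u \<in> elts z \<longleftrightarrow> u = x \<or> u = y"
      using z by (elim conjE)
    from this[THEN bspec, OF xy(1), THEN bspec, OF xy(2)]
    obtain z where "z \<in> V" "\<And>u. u \<in> V \<Longrightarrow> u \<in> elts z \<longleftrightarrow> u = x \<or> u = y"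
      by blast
    then have "hset {u. u = x \<or> u = y} \<in> V"
      by (rule elts_unique[OF tr]) (use xy in auto)
    moreover have "{u. u = x \<or> u = y} = {x, y}" by auto
    ultimately show "hset {x, y} \<in> V" by simp
  next
    fix x assume x: "x \<in> V"
    have "\<forall>x\<in>V. \<exists>z\<in>V. \<forall>u\<in>V. u \<in> elts z \<longleftrightarrow> (\<exists>y\<in>V. y \<in> elts x \<and> u \<in> elts y)"
      using z by (elim conjE)
    from this[THEN bspec, OF x] obtain z where "z \<in> V" "\<And>u. u \<in> V \<Longrightarrow> u \<in> elts z \<longleftrightarrow> (\<exists>y\<in>V. y \<in> elts x \<and> u \<in> elts y)"
      by blast
    then have "hset {u. \<exists>y\<in>V. y \<in> elts x \<and> u \<in> elts y} \<in> V"
      by (rule elts_unique[OF tr]) (use x in \<open>auto intro: mem\<close>)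
    moreover have "{u. \<exists>y\<in>V. y \<in> elts x \<and> u \<in> elts y} = (\<Union>y\<in>elts x. elts y)"
      using x by (auto intro: mem)
    ultimately show "hset (\<Union>y\<in>elts x. elts y) \<in> V" by simp
  next
    fix x assume x: "x \<in> V"
    have "\<forall>x\<in>V. \<exists>z\<in>V. \<forall>u\<in>V. u \<in> elts z \<longleftrightarrow> (\<forall>v\<in>V. v \<in> elts u \<longrightarrow> v \<in> elts x)"
      using z by (elim conjE)
    from this[THEN bspec, OF x] obtain z where "z \<in> V" "\<And>u. u \<in> V \<Longrightarrow> u \<in> elts z \<longleftrightarrow> (\<forall>v\<in>V. v \<in> elts u \<longrightarrow> v \<in> elts x)"
      by blast
    then have "hset {u. u \<in> V \<and> elts u \<subseteq> elts x} \<in> V"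
      by (intro elts_unique[OF tr, of z]) (auto intro: mem)
    then show "hset {y \<in> V. elts y \<subseteq> elts x} \<in> V" by simp
  next
    have "\<exists>w\<in>V. (\<exists>z\<in>V. z \<in> elts w \<and> \<not> (\<exists>u\<in>V. u \<in> elts z)) \<and>
      (\<forall>x\<in>V. x \<in> elts w \<longrightarrow> (\<exists>y\<in>V. y \<in> elts w \<and> (\<forall>u\<in>V. u \<in> elts y \<longleftrightarrow> u \<in> elts x \<or> u = x)))"
      using z by (elim conjE)
    then obtain w z where w: "w \<in> V" "z \<in> V" "z \<in> elts w" "\<not> (\<exists>u\<in>V. u \<in> elts z)"
      "\<And>x. x \<in> V \<Longrightarrow> x \<in> elts w \<Longrightarrow> \<exists>y\<in>V. y \<in> elts w \<and> (\<forall>u\<in>V. u \<in> elts y \<longleftrightarrow> u \<in> elts x \<or> u = x)"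
      by blast
    have "z = hset {}"
      using w(2,4) by (intro hc_eqI) (auto intro: mem)
    moreover have "hsucc x \<in> elts w" if x: "x \<in> elts w" for x
    proof -
      obtain y where y: "y \<in> V" "y \<in> elts w" "\<forall>u\<in>V. u \<in> elts y \<longleftrightarrow> u \<in> elts x \<or> u = x"
        using w(1,5) mem[OF x] x by blast
      then have "y = hsucc x"
        using mem[OF x w(1)] by (intro hc_eqI) (auto intro: mem)
      then show ?thesis using y by simp
    qed
    ultimately show "homega \<in> V"
      using homega_in_model[OF tr sep] w by blast
  next
    fix \<phi> e a
    assume \<phi>: "pred_free \<phi>" "env V e" "a \<in> V"
      and un: "\<And>x. x \<in> elts a \<Longrightarrow> \<exists>!y. y \<in> V \<and> sat V {} (e(0 := x, 1 := y)) \<phi>"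
    have "\<forall>\<phi> e. pred_free \<phi> \<and> range e \<subseteq> V \<longrightarrow>
      (\<forall>a\<in>V. (\<forall>x\<in>V. x \<in> elts a \<longrightarrow> (\<exists>!y. y \<in> V \<and> sat V {} (e(0 := x, 1 := y)) \<phi>)) \<longrightarrow>
        (\<exists>b\<in>V. \<forall>y\<in>V. y \<in> elts b \<longleftrightarrow> (\<exists>x\<in>V. x \<in> elts a \<and> sat V {} (e(0 := x, 1 := y)) \<phi>)))"
      using z by (elim conjE)
    from this[rule_format, OF conjI, OF \<phi>(1) \<phi>(2)[unfolded env_def] \<phi>(3) un]
    obtain b where "b \<in> V"
      "\<And>y. y \<in> V \<Longrightarrow> y \<in> elts b \<longleftrightarrow> (\<exists>x\<in>V. x \<in> elts a \<and> sat V {} (e(0 := x, 1 := y)) \<phi>)"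
      by blast
    then show "hset {y \<in> V. \<exists>x\<in>elts a. sat V {} (e(0 := x, 1 := y)) \<phi>} \<in> V"
      by (intro elts_unique[OF tr, of b]) (use \<phi> in \<open>auto intro: mem\<close>)
  qed (use cV sep in auto)
qed

section \<open>Elementary embeddings\<close>

primrec closure :: "nat \<Rightarrow> fm \<Rightarrow> fm" where
  "closure 0 \<phi> = \<phi>"
| "closure (Suc n) \<phi> = All n (closure n \<phi>)"

lemma pred_free_closure [simp]: "pred_free (closure n \<phi>) = pred_free \<phi>"
  by (induction n) auto

lemma sat_closure:
  "sat D U e (closure n \<phi>) \<longleftrightarrow>
     (\<forall>g. (\<forall>i<n. g i \<in> D) \<longrightarrow> sat D U (\<lambda>i. if i < n then g i else e i) \<phi>)"
proof (induction n arbitrary: e)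
  case (Suc n)
  have eq: "(\<lambda>i. if i < n then g i else (e(n := x)) i) = (\<lambda>i. if i < Suc n then (g(n := x)) i else e i)" for g x
    by (auto simp: less_Suc_eq)
  show ?case
  proof
    assume L: "sat D U e (closure (Suc n) \<phi>)"
    show "\<forall>g. (\<forall>i<Suc n. g i \<in> D) \<longrightarrow> sat D U (\<lambda>i. if i < Suc n then g i else e i) \<phi>"
    proof (intro allI impI)
      fix g assume g: "\<forall>i<Suc n. g i \<in> D"
      then have "sat D U (e(n := g n)) (closure n \<phi>)"
        using L by simp
      then have "sat D U (\<lambda>i. if i < n then g i else (e(n := g n)) i) \<phi>"
        unfolding Suc.IH using g by (meson less_SucI)
      then show "sat D U (\<lambda>i. if i < Suc n then g i else e i) \<phi>"
        by (simp only: eq fun_upd_triv)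
    qed
  next
    assume R: "\<forall>g. (\<forall>i<Suc n. g i \<in> D) \<longrightarrow> sat D U (\<lambda>i. if i < Suc n then g i else e i) \<phi>"
    have "sat D U (e(n := x)) (closure n \<phi>)" if "x \<in> D" for x
      unfolding Suc.IH eq using R that by (simp add: less_Suc_eq)
    then show "sat D U e (closure (Suc n) \<phi>)" by simp
  qed
qed simp

text \<open>Elementarity by itself concerns assignments of the form \<open>j \<circ> e\<close>.
  Universal closure turns a formula valid in \<open>V\<close> into one whose truth is independent of
  the assignment; it transfers and may then be instantiated at arbitrary elements of
  \<open>M\<close>.\<close>

lemma elem_transfer:
  assumes j: "elem_embedding j V M" and \<phi>: "pred_free \<phi>" and V: "\<And>e. env V e \<Longrightarrow> sat V {} e \<phi>"
    and e: "env M e" and "V \<noteq> {}"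
  shows "sat M {} e \<phi>"
proof -
  from \<open>V \<noteq> {}\<close> obtain v where v: "v \<in> V" by blast
  let ?n = "fbound \<phi>"
  have "sat V {} (\<lambda>_. v) (closure ?n \<phi>)"
    unfolding sat_closure using v by (auto intro!: V simp: env_def)
  then have "sat M {} (j \<circ> (\<lambda>_. v)) (closure ?n \<phi>)"
    using j \<phi> v unfolding elem_embedding_def by (metis image_subset_iff pred_free_closure range_eqI rangeE subsetI)
  then have "sat M {} (\<lambda>i. if i < ?n then e i else (j \<circ> (\<lambda>_. v)) i) \<phi>"
    unfolding sat_closure using e by (auto simp: env_def)
  then show ?thesis
    by (subst (asm) sat_cong[where e' = e]) auto
qed

lemma elem_sat:
  assumes "elem_embedding j V M" "pred_free \<phi>" "env V e"
  shows "sat V {} e \<phi> \<longleftrightarrow> sat M {} (\<lambda>n. j (e n)) \<phi>"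
  using assms by (simp add: elem_embedding_def env_def comp_def)

text \<open>Every axiom, and every instance of a scheme with its parameters as free variables, is a
  single formula valid in \<open>V\<close> under all assignments, so \<open>elem_transfer\<close>
  applies to each.\<close>

lemma zf_elem:
  assumes V: "zf V" and j: "elem_embedding j V M" and tr: "transitive M" and cM: "countable M"
  shows "zf M"
proof -
  interpret V: zf V by (rule V)
  have ne: "V \<noteq> {}" using V.omega by blast
  note T = elem_transfer[OF j _ _ _ ne]
  have tM [simp]: "tmodel M" using tr by (simp add: tmodel_def)
  have mem: "y \<in> M" if "y \<in> elts x" "x \<in> M" for x y
    using tr that by (auto simp: transitive_def)
  have shift: "\<exists>k. fbound \<phi> \<le> k \<and> k > 1" for \<phi>
    by (meson le_SucI less_Suc_eq_le linorder_le_less_linear max.cobounded1 max.strict_coboundedI2)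
  show ?thesis
  proof
    fix x y assume xy: "x \<in> M" "y \<in> M"
    have "sat M {} ((\<lambda>_. x)(1 := y)) (fEx 2 (fUpair 2 0 1))"
      by (rule T) (use xy in auto)
    then show "hset {x, y} \<in> M" using xy by auto
  next
    fix x assume x: "x \<in> M"
    have "sat V {} e (fEx 1 (All 2 (fIff (Mem 2 1) (fBex 3 0 (Mem 2 3)))))" if "env V e" for e
      using that V.union[of "e 0"] by simp (rule bexI[of _ "hset (\<Union>y\<in>elts (e 0). elts y)"], simp_all)
    then have "sat M {} (\<lambda>_. x) (fEx 1 (All 2 (fIff (Mem 2 1) (fBex 3 0 (Mem 2 3)))))"
      using x by (intro T) auto
    then obtain z where z: "z \<in> M" "\<And>u. u \<in> M \<Longrightarrow> u \<in> elts z \<longleftrightarrow> (\<exists>y\<in>elts x. u \<in> elts y)"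
      using x by auto
    have "hset {u. \<exists>y\<in>elts x. u \<in> elts y} \<in> M"
      by (rule elts_unique[OF tr z]) (use x in \<open>auto intro: mem\<close>)
    moreover have "{u. \<exists>y\<in>elts x. u \<in> elts y} = (\<Union>y\<in>elts x. elts y)" by auto
    ultimately show "hset (\<Union>y\<in>elts x. elts y) \<in> M" by simp
  next
    fix x assume x: "x \<in> M"
    have "sat V {} e (fEx 1 (All 2 (fIff (Mem 2 1) (fSub 2 0))))" if "env V e" for e
      using that V.power[of "e 0"] by simp (rule bexI[of _ "hset {y \<in> V. elts y \<subseteq> elts (e 0)}"], simp_all)
    then have "sat M {} (\<lambda>_. x) (fEx 1 (All 2 (fIff (Mem 2 1) (fSub 2 0))))"
      using x by (intro T) auto
    then obtain z where z: "z \<in> M" "\<And>u. u \<in> M \<Longrightarrow> u \<in> elts z \<longleftrightarrow> elts u \<subseteq> elts x"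
      using x by auto
    have "hset {u. u \<in> M \<and> elts u \<subseteq> elts x} \<in> M"
      by (rule elts_unique[OF tr z(1)]) (use z in auto)
    then show "hset {y \<in> M. elts y \<subseteq> elts x} \<in> M" by simp
  next
    have "sat V {} e (fEx 0 (fOmega 0))" if "env V e" for e
      using that V.omega by auto
    moreover from ne j have "M \<noteq> {}" by (auto simp: elem_embedding_def)
    then obtain e where e: "env M e" by (metis env_const ex_in_conv)
    ultimately have "sat M {} e (fEx 0 (fOmega 0))" by (intro T) auto
    then show "homega \<in> M" using e by auto
  next
    fix \<phi> e a assume \<phi>: "pred_free \<phi>" "env M e" "a \<in> M"
    obtain k where k: "fbound \<phi> \<le> k" "k > 1" using shift by blast
    then have [simp]: "k \<noteq> 0" "0 \<noteq> k" by auto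
    \<comment> \<open>Variable \<open>k\<close> carries the given set and \<open>Suc k\<close> the
      subset to be found; both are fresh for \<open>\<phi>\<close>.\<close>
    let ?\<psi> = "fEx (Suc k) (All 0 (fIff (Mem 0 (Suc k)) (And (Mem 0 k) \<phi>)))"
    have fresh: "sat D {} (e(k := u, Suc k := v, 0 := x)) \<phi> \<longleftrightarrow> sat D {} (e(0 := x)) \<phi>"
      "sat D {} (e(Suc k := v, 0 := x)) \<phi> \<longleftrightarrow> sat D {} (e(0 := x)) \<phi>"
      "sat D {} (e(k := u, 0 := x)) \<phi> \<longleftrightarrow> sat D {} (e(0 := x)) \<phi>" for e D u v x
      using k by (intro sat_cong; simp)+
    have "sat V {} e ?\<psi>" if "env V e" for e
      using V.separation[OF \<phi>(1) that, of "e k"] that V.mem_N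
      by (auto simp: fresh intro!: bexI[of _ "hset {x \<in> elts (e k). sat V {} (e(0 := x)) \<phi>}"])
    then have "sat M {} (e(k := a)) ?\<psi>"
      using \<phi> by (intro T) auto
    then obtain b where b: "b \<in> M" "\<And>x. x \<in> M \<Longrightarrow> x \<in> elts b \<longleftrightarrow> x \<in> elts a \<and> sat M {} (e(0 := x)) \<phi>"
      using \<phi> by (auto simp: fresh)
    show "hset {x \<in> elts a. sat M {} (e(0 := x)) \<phi>} \<in> M"
      by (rule elts_unique[OF tr b]) (use \<phi> in \<open>auto intro: mem\<close>)
  next
    fix \<phi> e a
    assume \<phi>: "pred_free \<phi>" "env M e" "a \<in> M"
      and un: "\<And>x. x \<in> elts a \<Longrightarrow> \<exists>!y. y \<in> M \<and> sat M {} (e(0 := x, 1 := y)) \<phi>"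
    obtain k where k: "fbound \<phi> \<le> k" "k > 1" using shift by blast
    then have [simp]: "k \<noteq> 0" "0 \<noteq> k" "k \<noteq> Suc 0" "Suc 0 \<noteq> k" by auto
    \<comment> \<open>Functionality is assumed in \<open>M\<close> for the given parameters, so it
      becomes the premise of the transferred implication. Unique existence is expressed by a value
      in \<open>Suc k\<close> that \<open>\<phi>\<close> singles out.\<close>
    let ?un = "fBall 0 k (fEx (Suc k) (All 1 (fIff \<phi> (Eq 1 (Suc k)))))"
    let ?\<psi> = "fImp ?un (fEx (Suc k) (All 1 (fIff (Mem 1 (Suc k)) (fBex 0 k \<phi>))))"
    have fresh:
      "sat D {} (e(k := u, 0 := x, Suc k := v, Suc 0 := y)) \<phi> \<longleftrightarrow> sat D {} (e(0 := x, Suc 0 := y)) \<phi>"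
      "sat D {} (e(0 := x, Suc k := v, Suc 0 := y)) \<phi> \<longleftrightarrow> sat D {} (e(0 := x, Suc 0 := y)) \<phi>"
      "sat D {} (e(k := u, Suc k := v, Suc 0 := y, 0 := x)) \<phi> \<longleftrightarrow> sat D {} (e(0 := x, Suc 0 := y)) \<phi>"
      "sat D {} (e(Suc k := v, Suc 0 := y, 0 := x)) \<phi> \<longleftrightarrow> sat D {} (e(0 := x, Suc 0 := y)) \<phi>"
      "sat D {} (e(k := u, 0 := x, Suc 0 := y)) \<phi> \<longleftrightarrow> sat D {} (e(0 := x, Suc 0 := y)) \<phi>"
      "sat D {} (e(k := u, Suc 0 := y, 0 := x)) \<phi> \<longleftrightarrow> sat D {} (e(0 := x, Suc 0 := y)) \<phi>"
      for e D u v x y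
      using k by (intro sat_cong; simp)+
    have "sat V {} e ?\<psi>" if e: "env V e" for e
    proof (cases "\<forall>x\<in>elts (e k). \<exists>z\<in>V. \<forall>y\<in>V. sat V {} (e(0 := x, Suc 0 := y)) \<phi> \<longleftrightarrow> y = z")
      case True
      then have "\<exists>!y. y \<in> V \<and> sat V {} (e(0 := x, 1 := y)) \<phi>" if "x \<in> elts (e k)" for x
        using that by fastforce
      then have "hset {y \<in> V. \<exists>x\<in>elts (e k). sat V {} (e(0 := x, 1 := y)) \<phi>} \<in> V"
        using V.replacement[OF \<phi>(1) e, of "e k"] e by simp
      then show ?thesis
        using e by (simp add: fresh) (rule impI, rule bexI[of _ "hset {y \<in> V. \<exists>x\<in>elts (e k). sat V {} (e(0 := x, 1 := y)) \<phi>}"], simp_all)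
    next
      case False
      then have "\<not> sat V {} e ?un"
        using e by (simp add: fresh)
      then show ?thesis by (simp del: sat_bounded)
    qed
    then have "sat M {} (e(k := a)) ?\<psi>"
      using \<phi> by (intro T) auto
    moreover have "sat M {} (e(k := a)) ?un"
    proof -
      have "\<exists>z\<in>M. \<forall>y\<in>M. sat M {} (e(0 := x, Suc 0 := y)) \<phi> \<longleftrightarrow> y = z" if "x \<in> elts a" for x
        using un[OF that] by auto
      then show ?thesis using \<phi> by (simp add: fresh)
    qed
    ultimately obtain b where b: "b \<in> M"
      "\<And>y. y \<in> M \<Longrightarrow> y \<in> elts b \<longleftrightarrow> (\<exists>x\<in>elts a. sat M {} (e(0 := x, Suc 0 := y)) \<phi>)"
      using \<phi> by (auto simp: fresh)
    show "hset {y \<in> M. \<exists>x\<in>elts a. sat M {} (e(0 := x, 1 := y)) \<phi>} \<in> M"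
      by (rule elts_unique[OF tr b(1)]) (use b in auto)
  qed (use cM in auto)
qed

section \<open>Forcing\<close>

lemma countable_pairs: "countable {(s, p). hpair s p \<in> elts t}"
proof (rule countable_image_inj_on)
  show "inj_on (\<lambda>(s, p). hpair s p) {(s, p). hpair s p \<in> elts t}"
    by (auto simp: inj_on_def)
  show "countable ((\<lambda>(s, p). hpair s p) ` {(s, p). hpair s p \<in> elts t})"
    by (rule countable_subset[OF _ countable_elts[of t]]) auto
qed

lemma elts_val: "elts (val g t) = {val g s | s p. p \<in> elts g \<and> hpair s p \<in> elts t}"
proof -
  have "{s. \<exists>p\<in>elts g. hpair s p \<in> elts t} \<subseteq> fst ` {(s, p). hpair s p \<in> elts t}"
    by force
  then have "countable {s. \<exists>p\<in>elts g. hpair s p \<in> elts t}"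
    by (rule countable_subset) (simp add: countable_pairs)
  then show ?thesis
    by (subst val.simps) auto
qed

lemma hpair_fst_tc: "hpair u q \<in> elts s \<Longrightarrow> u \<in> elts (tc s)"
  using hpair_fst_below by (simp add: in_tc_iff)

lemma hpair_fst_trans: "transitive T \<Longrightarrow> s \<in> T \<Longrightarrow> hpair u q \<in> elts s \<Longrightarrow> u \<in> T"
  using hpair_components(1)[of T u q] transitiveD[of T s "hpair u q"] by (simp add: tmodel_def)

lemma is_nameD: "is_name P t \<Longrightarrow> x \<in> elts t \<Longrightarrow> \<exists>s p. x = hpair s p \<and> p \<in> conds P \<and> is_name P s"
  by (erule is_name.cases) auto

definition fTriple :: "nat \<Rightarrow> nat \<Rightarrow> nat \<Rightarrow> nat \<Rightarrow> fm" where
  "fTriple z x y w = (let k = Suc (z + x + y + w) in fEx k (And (fPair k y w) (fPair z x k)))"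

definition fTripleIn :: "nat \<Rightarrow> nat \<Rightarrow> nat \<Rightarrow> nat \<Rightarrow> fm" where
  "fTripleIn x y w z = (let k = Suc (z + x + y + w) in fEx k (And (fPair k y w) (fPairIn x k z)))"

lemma pred_free_fTriple [simp]: "pred_free (fTriple z x y w)" "pred_free (fTripleIn x y w z)"
  by (simp_all add: fTriple_def fTripleIn_def Let_def)

lemma (in zf) sat_fTriple [simp]:
  assumes "env N e"
  shows "sat N U e (fTriple z x y w) \<longleftrightarrow> e z = hpair (e x) (hpair (e y) (e w))"
    and "sat N U e (fTripleIn x y w z) \<longleftrightarrow> hpair (e x) (hpair (e y) (e w)) \<in> elts (e z)"
  using assms by (auto simp: fTriple_def fTripleIn_def Let_def)

section \<open>A forcing relation definable in the ground model\<close>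

locale forcing_poset = zf V for V :: "hc set" +
  fixes R :: poset
  assumes R_V [simp]: "fst R \<in> V" "snd R \<in> V"
    and le_conds: "le R q p \<Longrightarrow> q \<in> conds R \<and> p \<in> conds R"
    and le_refl: "p \<in> conds R \<Longrightarrow> le R p p"
    and le_trans: "le R r q \<Longrightarrow> le R q p \<Longrightarrow> le R r p"
begin

lemma conds_V: "p \<in> conds R \<Longrightarrow> p \<in> V"
  by (auto simp: conds_def intro: mem_N)

lemma pair_V: "hpair x y \<in> elts s \<Longrightarrow> s \<in> V \<Longrightarrow> x \<in> V \<and> y \<in> V"
  using mem_N[of "hpair x y" s] by simp

text \<open>With \<open>Q\<close> in the role of forced equality, this says that \<open>p\<close>
  forces \<open>s\<close> to be a subset of \<open>t\<close>.\<close>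

definition half :: "(hc \<Rightarrow> hc \<Rightarrow> hc \<Rightarrow> bool) \<Rightarrow> hc \<Rightarrow> hc \<Rightarrow> hc \<Rightarrow> bool" where
  "half Q p s t \<longleftrightarrow> (\<forall>u\<in>V. \<forall>q\<in>V. \<forall>r\<in>V. hpair u q \<in> elts s \<and> le R r p \<and> le R r q \<longrightarrow>
     (\<exists>r'\<in>V. le R r' r \<and> (\<exists>v\<in>V. \<exists>q'\<in>V. hpair v q' \<in> elts t \<and> le R r' q' \<and> Q r' u v)))"

text \<open>The second inclusion transposes \<open>Q\<close>, so that \<open>Q\<close> is always
  asked about a name from \<open>s\<close> on the left and one from \<open>t\<close> on the right.
  Symmetry is thus not built in; it is proved as \<open>eqf_sym\<close>.\<close>

definition eq_step :: "(hc \<Rightarrow> hc \<Rightarrow> hc \<Rightarrow> bool) \<Rightarrow> hc \<Rightarrow> hc \<Rightarrow> hc \<Rightarrow> bool" where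
  "eq_step Q p s t \<longleftrightarrow> p \<in> conds R \<and> half Q p s t \<and> half (\<lambda>r v u. Q r u v) p t s"

text \<open>Forcing of equality is the greatest fixed point of \<open>eq_step\<close>, approximated from below by the
  post-fixed points that are elements of the model. This makes it definable without recursion.\<close>

definition eqf :: "hc \<Rightarrow> hc \<Rightarrow> hc \<Rightarrow> bool" where
  "eqf p s t \<longleftrightarrow> (\<exists>z\<in>V. (\<forall>p\<in>V. \<forall>s\<in>V. \<forall>t\<in>V. hpair p (hpair s t) \<in> elts z \<longrightarrow>
      eq_step (\<lambda>p s t. hpair p (hpair s t) \<in> elts z) p s t) \<and> hpair p (hpair s t) \<in> elts z)"

text \<open>Variable convention: 0 holds the condition, 1 and 2 the set of conditions and the order,
  3 and 4 the two names, 5 the post-fixed point. The indices from 6 on are auxiliary.\<close>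

definition fHalf :: "nat \<Rightarrow> nat \<Rightarrow> fm \<Rightarrow> fm" where
  "fHalf a b \<psi> = All 6 (All 7 (All 8 (fImp (And (fPairIn 6 7 a) (And (fPairIn 8 0 2) (fPairIn 8 7 2)))
     (fEx 9 (And (fPairIn 9 8 2) (fEx 10 (fEx 11 (And (fPairIn 10 11 b) (And (fPairIn 9 11 2) \<psi>)))))))))"

definition fEqf :: fm where
  "fEqf = fEx 5 (And (All 0 (All 3 (All 4 (fImp (fTripleIn 0 3 4 5)
     (And (Mem 0 1) (And (fHalf 3 4 (fTripleIn 9 6 10 5)) (fHalf 4 3 (fTripleIn 9 10 6 5))))))))
     (fTripleIn 0 3 4 5))"

lemma pred_free_fEqf [simp]: "pred_free fEqf"
  by (simp add: fEqf_def fHalf_def)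

definition penv :: "(nat \<Rightarrow> hc) \<Rightarrow> bool" where
  "penv e \<longleftrightarrow> env V e \<and> e 1 = fst R \<and> e 2 = snd R"

lemma penv_env [simp]: "penv e \<Longrightarrow> env V e"
  by (simp add: penv_def)

lemma penv_upd [simp]: "penv e \<Longrightarrow> x \<in> V \<Longrightarrow> n \<noteq> 1 \<Longrightarrow> n \<noteq> 2 \<Longrightarrow> penv (e(n := x))"
  by (simp add: penv_def)

lemma penv_simps [simp]: "penv e \<Longrightarrow> e (Suc 0) = fst R" "penv e \<Longrightarrow> e 2 = snd R"
  by (simp_all add: penv_def)

definition E0 :: "nat \<Rightarrow> hc" where
  "E0 = (\<lambda>_. fst R)(2 := snd R)"

lemma penv_E0 [simp]: "penv E0"
  by (simp add: penv_def E0_def)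

lemma sat_fEqf [simp]: "penv e \<Longrightarrow> sat V U e fEqf \<longleftrightarrow> eqf (e 0) (e 3) (e 4)"
  by (simp add: fEqf_def fHalf_def eqf_def eq_step_def half_def le_def conds_def)

text \<open>The new relation is required only at names occurring in \<open>s\<close> and
  \<open>t\<close>. This restriction lets a relation that is a set of the model take the place of
  \<open>eqf\<close>.\<close>

lemma eq_step_mono:
  assumes "eq_step Q p s t" "\<And>p u v. Q p u v \<Longrightarrow> p \<in> conds R \<Longrightarrow> u \<in> V \<Longrightarrow> v \<in> V \<Longrightarrow>
    (\<exists>q. hpair u q \<in> elts s) \<Longrightarrow> (\<exists>q. hpair v q \<in> elts t) \<Longrightarrow> Q' p u v"
  shows "eq_step Q' p s t"
proof -
  have "Q' r u v" if "Q r u v" "le R r q" "u \<in> V" "v \<in> V" "hpair u q1 \<in> elts s" "hpair v q2 \<in> elts t" for r u v q q1 q2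
    using assms(2) that le_conds by blast
  then show ?thesis
    using assms(1) unfolding eq_step_def half_def by (metis (no_types, lifting))
qed

lemma eqf_V: "eqf p s t \<Longrightarrow> p \<in> V \<and> s \<in> V \<and> t \<in> V"
proof -
  assume "eqf p s t"
  then obtain z where "z \<in> V" "hpair p (hpair s t) \<in> elts z" by (auto simp: eqf_def)
  then have "hpair p (hpair s t) \<in> V" by (blast intro: mem_N)
  then show ?thesis by simp
qed

lemma eqf_imp_step: "eqf p s t \<Longrightarrow> eq_step eqf p s t"
proof -
  assume e: "eqf p s t"
  then obtain z where z: "z \<in> V" "hpair p (hpair s t) \<in> elts z"
    and post: "\<forall>p\<in>V. \<forall>s\<in>V. \<forall>t\<in>V. hpair p (hpair s t) \<in> elts z \<longrightarrow>
      eq_step (\<lambda>p s t. hpair p (hpair s t) \<in> elts z) p s t"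
    by (auto simp: eqf_def)
  have "eqf p s t" if "hpair p (hpair s t) \<in> elts z" for p s t
    using z post that by (auto simp: eqf_def)
  then show ?thesis
    using post z eqf_V[OF e] by (blast intro: eq_step_mono)
qed

text \<open>One unfolding asks only about names in the transitive closure \<open>T\<close> of the
  two given ones. The true triples over \<open>T\<close> therefore form a set, and together with the
  triple under consideration they are a post-fixed point in \<open>V\<close>.\<close>

lemma eqf_iff:
  assumes "s \<in> V" "t \<in> V"
  shows "eqf p s t \<longleftrightarrow> eq_step eqf p s t"
proof
  assume st: "eq_step eqf p s t"
  then have p: "p \<in> conds R" by (simp add: eq_step_def)
  define T where "T = tc (hset {s, t})"
  define B where "B = hprod (fst R) (hprod T T)"
  define Z where "Z = {x \<in> elts B. \<exists>p s t. x = hpair p (hpair s t) \<and> eqf p s t}"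
  have "hset {s, t} \<in> V" using assms by simp
  then have BV: "B \<in> V" by (simp add: B_def T_def)
  have T: "s \<in> elts T" "t \<in> elts T" "transitive (elts T)"
    using elts_subset_tc[of "hset {s, t}"] by (auto simp: T_def transitive_tc)
  have "hset Z \<in> V"
  \<comment> \<open>Variable 7 keeps the candidate triple, because \<open>fEqf\<close> expects the
    condition in variable 0.\<close>
  proof (rule sep_set[where \<phi> = "fEx 7 (And (Eq 7 0) (fEx 0 (fEx 3 (fEx 4 (And (fTriple 7 0 3 4) fEqf)))))" and e = E0])
    fix x assume "x \<in> elts B" "x \<in> V"
    then show "x \<in> Z \<longleftrightarrow> sat V {} (E0(0 := x)) (fEx 7 (And (Eq 7 0) (fEx 0 (fEx 3 (fEx 4 (And (fTriple 7 0 3 4) fEqf))))))"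
      using eqf_V by (auto simp: Z_def)
  qed (use BV in \<open>auto simp: Z_def\<close>)
  define Y where "Y = hset (insert (hpair p (hpair s t)) Z)"
  have cZ: "countable Z"
    by (rule countable_subset[OF _ countable_elts[of B]]) (auto simp: Z_def)
  then have Y: "elts Y = insert (hpair p (hpair s t)) Z"
    by (simp add: Y_def)
  have YV: "Y \<in> V"
    using insert_N[of "hpair p (hpair s t)" "hset Z"] \<open>hset Z \<in> V\<close> cZ assms conds_V[OF p] by (simp add: Y_def)
  have post: "eq_step (\<lambda>p s t. hpair p (hpair s t) \<in> elts Y) p' s' t'" if "hpair p' (hpair s' t') \<in> elts Y" for p' s' t'
  proof -
    have "s' \<in> elts T" "t' \<in> elts T" "eq_step eqf p' s' t'"
      using that st T eqf_imp_step by (auto simp: Y Z_def B_def)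
    note st' = this
    show ?thesis
    proof (rule eq_step_mono[OF st'(3)])
      fix r u v assume uv: "eqf r u v" "r \<in> conds R" "\<exists>q. hpair u q \<in> elts s'" "\<exists>q. hpair v q \<in> elts t'"
      then have "u \<in> elts T" "v \<in> elts T"
        using hpair_fst_trans[OF T(3)] st'(1,2) by blast+
      then show "hpair r (hpair u v) \<in> elts Y"
        using uv(1,2) by (auto simp: Y Z_def B_def conds_def)
    qed
  qed
  show "eqf p s t"
    unfolding eqf_def using post YV Y by (intro bexI[of _ Y]) auto
qed (rule eqf_imp_step)

lemma eqf_mono:
  assumes "eqf p s t" "le R q p"
  shows "eqf q s t"
proof -
  have st: "s \<in> V" "t \<in> V" using eqf_V[OF assms(1)] by auto
  have "le R r q \<Longrightarrow> le R r p" for r using le_trans assms(2) by blast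
  then show ?thesis
    using assms le_conds[OF assms(2)] unfolding eqf_iff[OF st] eq_step_def half_def by blast
qed

text \<open>A first-order form of the inductive \<open>is_name\<close>: membership in a set of the
  model that is closed under taking constituent names.\<close>

definition nm :: "hc \<Rightarrow> bool" where
  "nm x \<longleftrightarrow> (\<exists>w\<in>V. x \<in> elts w \<and> (\<forall>s\<in>elts w. \<forall>z\<in>elts s. \<exists>s'\<in>elts w. \<exists>p\<in>elts (fst R). z = hpair s' p))"

definition fNm :: "nat \<Rightarrow> fm" where
  "fNm x = fEx (x + 10) (And (Mem x (x + 10)) (fBall (x + 11) (x + 10) (fBall (x + 12) (x + 11)
     (fBex (x + 13) (x + 10) (fBex (x + 14) 1 (fPair (x + 12) (x + 13) (x + 14)))))))"

lemma pred_free_fNm [simp]: "pred_free (fNm x)"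
  by (simp add: fNm_def)

lemma sat_fNm [simp]: "penv e \<Longrightarrow> sat V U e (fNm x) \<longleftrightarrow> nm (e x)"
  by (simp add: fNm_def nm_def)

text \<open>From left to right, well-foundedness turns the closed set into a derivation. From right
  to left, the closed set consists of \<open>x\<close> and those elements of its transitive closure
  that satisfy \<open>nm\<close>; Separation for \<open>fNm\<close> puts it into
  \<open>V\<close>.\<close>

lemma nm_iff:
  assumes "x \<in> V"
  shows "nm x \<longleftrightarrow> is_name R x"
proof
  assume "nm x"
  then obtain w where w: "x \<in> elts w"
    "\<And>s z. s \<in> elts w \<Longrightarrow> z \<in> elts s \<Longrightarrow> \<exists>s'\<in>elts w. \<exists>p\<in>elts (fst R). z = hpair s' p"
    by (auto simp: nm_def)
  have "s \<in> elts w \<Longrightarrow> is_name R s" for s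
  proof (induction s rule: tc_induct)
    case (step s)
    show ?case
    proof (rule is_name.intros)
      fix z assume "z \<in> elts s"
      with w step.prems obtain s' p where "s' \<in> elts w" "p \<in> elts (fst R)" "z = hpair s' p" by blast
      then show "\<exists>s p. z = hpair s p \<and> p \<in> conds R \<and> is_name R s"
        using step.IH[of s'] hpair_fst_tc \<open>z \<in> elts s\<close> by (auto simp: conds_def)
    qed
  qed
  then show "is_name R x" using w by blast
next
  assume "is_name R x"
  then show "nm x"
    using assms
  proof (induction x rule: tc_induct)
    case (step x)
    define Z where "Z = {s \<in> elts (tc x). nm s}"
    have "hset Z \<in> V"
      by (rule sep_set[where \<phi> = "fNm 0" and e = E0 and a = "tc x"]) (use step.prems in \<open>auto simp: Z_def\<close>)
    define w where "w = hset (insert x Z)"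
    have cZ: "countable Z"
      by (rule countable_subset[OF _ countable_elts[of "tc x"]]) (auto simp: Z_def)
    have w: "elts w = insert x Z" using cZ by (simp add: w_def)
    have wV: "w \<in> V"
      using insert_N[of x "hset Z"] \<open>hset Z \<in> V\<close> cZ step.prems by (simp add: w_def)
    have "\<exists>s'\<in>elts w. \<exists>p\<in>elts (fst R). z = hpair s' p" if s: "s \<in> elts w" "z \<in> elts s" for s z
    proof (cases "s = x")
      case True
      with s step.prems(1) obtain s' p where z: "z = hpair s' p" "p \<in> conds R" "is_name R s'"
        using is_nameD by blast
      then have "s' \<in> elts (tc x)" using hpair_fst_tc s True by blast
      then have "s' \<in> V" using mem_N tc_N step.prems(2) by blast
      then have "nm s'" using step.IH \<open>s' \<in> elts (tc x)\<close> z by blast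
      then show ?thesis using z \<open>s' \<in> elts (tc x)\<close> by (auto simp: w Z_def conds_def)
    next
      case False
      then have "nm s" "s \<in> elts (tc x)" using s by (auto simp: w Z_def)
      then obtain v where v: "v \<in> V" "s \<in> elts v"
        and vc: "\<forall>s\<in>elts v. \<forall>z\<in>elts s. \<exists>s'\<in>elts v. \<exists>p\<in>elts (fst R). z = hpair s' p"
        by (auto simp: nm_def)
      with s obtain s' p where z: "s' \<in> elts v" "p \<in> elts (fst R)" "z = hpair s' p" by blast
      then have "nm s'" using v vc by (auto simp: nm_def)
      moreover have "s' \<in> elts (tc x)"
        using hpair_fst_trans[OF transitive_tc \<open>s \<in> elts (tc x)\<close>] s z by blast
      ultimately show ?thesis using z by (auto simp: w Z_def)
    qed
    then show ?case
      unfolding nm_def using w wV by blast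
  qed
qed

end

context forcing_poset
begin

text \<open>The arguments are copied one at a time into the fixed variables of \<open>fEqf\<close>.
  None may have been overwritten when its turn comes, whence the side conditions of
  \<open>sat_fEqfAt\<close>.\<close>

definition fEqfAt :: "nat \<Rightarrow> nat \<Rightarrow> nat \<Rightarrow> fm" where
  "fEqfAt a b c = fEx 0 (And (Eq 0 a) (fEx 3 (And (Eq 3 b) (fEx 4 (And (Eq 4 c) fEqf)))))"

lemma pred_free_fEqfAt [simp]: "pred_free (fEqfAt a b c)"
  by (simp add: fEqfAt_def)

lemma sat_fEqfAt [simp]:
  "penv e \<Longrightarrow> a \<noteq> 0 \<Longrightarrow> b \<notin> {0, 3} \<Longrightarrow> c \<notin> {0, 3, 4} \<Longrightarrow> sat V U e (fEqfAt a b c) \<longleftrightarrow> eqf (e a) (e b) (e c)"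
  by (auto simp: fEqfAt_def)

text \<open>A strong form of forcing \<open>s \<in> t\<close>, which holds densely below \<open>p\<close> iff \<open>p\<close> forces \<open>s \<in> t\<close>.\<close>

definition memf :: "hc \<Rightarrow> hc \<Rightarrow> hc \<Rightarrow> bool" where
  "memf p s t \<longleftrightarrow> (\<exists>v\<in>V. \<exists>q\<in>V. hpair v q \<in> elts t \<and> le R p q \<and> eqf p s v)"

definition fMemf :: "nat \<Rightarrow> nat \<Rightarrow> nat \<Rightarrow> fm" where
  "fMemf a b c = fEx 8 (fEx 9 (And (fPairIn 8 9 c) (And (fPairIn a 9 2) (fEqfAt a b 8))))"

lemma pred_free_fMemf [simp]: "pred_free (fMemf a b c)"
  by (simp add: fMemf_def)

lemma sat_fMemf [simp]:
  "penv e \<Longrightarrow> a \<notin> {0, 8, 9} \<Longrightarrow> b \<notin> {0, 3, 8, 9} \<Longrightarrow> c \<notin> {8, 9} \<Longrightarrow>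
    sat V U e (fMemf a b c) \<longleftrightarrow> memf (e a) (e b) (e c)"
  by (auto simp: fMemf_def memf_def le_def)

text \<open>The strong atomic notions may hold only densely below a condition; asking for density in
  the atomic clauses makes \<open>forced_dense\<close> true at every formula.\<close>

primrec forced :: "(nat \<Rightarrow> hc) \<Rightarrow> hc \<Rightarrow> fm \<Rightarrow> bool" where
  "forced e p (Mem m n) \<longleftrightarrow> (\<forall>q\<in>V. le R q p \<longrightarrow> (\<exists>r\<in>V. le R r q \<and> memf r (e m) (e n)))"
| "forced e p (Eq m n) \<longleftrightarrow> (\<forall>q\<in>V. le R q p \<longrightarrow> (\<exists>r\<in>V. le R r q \<and> eqf r (e m) (e n)))"
| "forced e p (Pred n) \<longleftrightarrow> False"
| "forced e p (Neg \<phi>) \<longleftrightarrow> (\<forall>q\<in>V. le R q p \<longrightarrow> \<not> forced e q \<phi>)"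
| "forced e p (And \<phi> \<psi>) \<longleftrightarrow> forced e p \<phi> \<and> forced e p \<psi>"
| "forced e p (All n \<phi>) \<longleftrightarrow> (\<forall>x\<in>V. nm x \<longrightarrow> forced (e(n := x)) p \<phi>)"

text \<open>The variables of a formula are shifted by 20 to make room for the condition and the poset.\<close>

primrec fForced :: "fm \<Rightarrow> fm" where
  "fForced (Mem m n) = All 6 (fImp (fPairIn 6 0 2) (fEx 7 (And (fPairIn 7 6 2) (fMemf 7 (m + 20) (n + 20)))))"
| "fForced (Eq m n) = All 6 (fImp (fPairIn 6 0 2) (fEx 7 (And (fPairIn 7 6 2) (fEqfAt 7 (m + 20) (n + 20)))))"
| "fForced (Pred n) = Neg (Eq 0 0)"
| "fForced (Neg \<phi>) = All 6 (fImp (fPairIn 6 0 2) (All 0 (fImp (Eq 0 6) (Neg (fForced \<phi>)))))"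
| "fForced (And \<phi> \<psi>) = And (fForced \<phi>) (fForced \<psi>)"
| "fForced (All n \<phi>) = All (n + 20) (fImp (fNm (n + 20)) (fForced \<phi>))"

lemma pred_free_fForced [simp]: "pred_free (fForced \<phi>)"
  by (induction \<phi>) auto

lemma shift_upd: "(\<lambda>i::nat. (e(n + 20 := x)) (i + 20)) = (\<lambda>i. e (i + 20))(n := x)"
  by auto

lemma sat_fForced: "penv e \<Longrightarrow> sat V {} e (fForced \<phi>) \<longleftrightarrow> forced (\<lambda>i. e (i + 20)) (e 0) \<phi>"
proof (induction \<phi> arbitrary: e)
  case (All n \<phi>)
  have "sat V {} (e(n + 20 := x)) (fForced \<phi>) \<longleftrightarrow> forced ((\<lambda>i. e (i + 20))(n := x)) (e 0) \<phi>" if "x \<in> V" for x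
  proof -
    have "sat V {} (e(n + 20 := x)) (fForced \<phi>) \<longleftrightarrow>
        forced (\<lambda>i. (e(n + 20 := x)) (i + 20)) ((e(n + 20 := x)) 0) \<phi>"
      by (intro All.IH penv_upd All.prems that) simp_all
    then show ?thesis by (simp only: shift_upd) simp
  qed
  then show ?case using All.prems by simp
qed (auto simp: le_def)

lemma forced_mono: "forced e p \<phi> \<Longrightarrow> le R q p \<Longrightarrow> forced e q \<phi>"
  by (induction \<phi> arbitrary: e) (auto dest: le_trans)

lemma le_V: "le R q p \<Longrightarrow> q \<in> V \<and> p \<in> V \<and> le R q q"
  using le_conds conds_V le_refl by blast

lemma densely_densely:
  assumes "\<And>q. le R q p \<Longrightarrow> \<exists>r. le R r q \<and> (\<forall>q\<in>V. le R q r \<longrightarrow> (\<exists>s\<in>V. le R s q \<and> Q s))"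
    and "le R q p"
  shows "\<exists>r\<in>V. le R r q \<and> Q r"
proof -
  obtain r where r: "le R r q" "\<forall>q\<in>V. le R q r \<longrightarrow> (\<exists>s\<in>V. le R s q \<and> Q s)"
    using assms by blast
  then obtain s where "s \<in> V" "le R s r" "Q s"
    using le_V[OF r(1)] by blast
  then show ?thesis using le_trans r(1) by blast
qed

text \<open>Used in contraposition: if \<open>p\<close> does not force \<open>\<phi>\<close>, some
  \<open>q\<close> below \<open>p\<close> has no extension forcing \<open>\<phi>\<close>, which
  means that \<open>q\<close> forces its negation.\<close>

lemma forced_dense:
  "p \<in> conds R \<Longrightarrow> (\<And>q. le R q p \<Longrightarrow> \<exists>r. le R r q \<and> forced e r \<phi>) \<Longrightarrow> forced e p \<phi>"
proof (induction \<phi> arbitrary: e)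
  case (Mem m n)
  then show ?case
    unfolding forced.simps by (intro ballI impI densely_densely)
next
  case (Eq m n)
  then show ?case
    unfolding forced.simps by (intro ballI impI densely_densely)
next
  case (Pred n)
  from Pred.prems(2)[OF le_refl[OF Pred.prems(1)]] show ?case by simp
next
  case (Neg \<phi>)
  show ?case
  proof (simp, intro ballI impI notI)
    fix q assume q: "q \<in> V" "le R q p" "forced e q \<phi>"
    with Neg.prems obtain r where r: "le R r q" "forced e r (Neg \<phi>)" by blast
    then have "r \<in> V" "le R r r" using le_V by blast+
    moreover have "forced e r \<phi>" using forced_mono[OF q(3) r(1)] .
    ultimately show False using r(2) by simp
  qed
next
  case (And \<phi> \<psi>)
  have "\<exists>r. le R r q \<and> forced e r \<phi>" "\<exists>r. le R r q \<and> forced e r \<psi>" if "le R q p" for q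
    using And.prems(2)[OF that] by auto
  then show ?case
    using And.IH And.prems(1) by simp
next
  case (All n \<phi>)
  show ?case
  proof (simp, intro ballI impI)
    fix x assume x: "x \<in> V" "nm x"
    show "forced (e(n := x)) p \<phi>"
    proof (rule All.IH[OF All.prems(1)])
      fix q assume "le R q p"
      then obtain r where "le R r q" "forced e r (All n \<phi>)"
        using All.prems(2) by blast
      then show "\<exists>r. le R r q \<and> forced (e(n := x)) r \<phi>"
        using x by auto
    qed
  qed
qed

lemma half_memf: "half eqf p s t \<longleftrightarrow>
    (\<forall>u\<in>V. \<forall>q\<in>V. \<forall>r\<in>V. hpair u q \<in> elts s \<and> le R r p \<and> le R r q \<longrightarrow> (\<exists>r'\<in>V. le R r' r \<and> memf r' u t))"
  unfolding half_def memf_def ..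

lemma half_mono:
  assumes "\<And>r u v q q'. hpair u q \<in> elts s \<Longrightarrow> hpair v q' \<in> elts t \<Longrightarrow> Q r u v \<Longrightarrow> Q' r u v"
    and "half Q p s t"
  shows "half Q' p s t"
  unfolding half_def
proof (intro ballI impI)
  fix u q r assume u: "u \<in> V" "q \<in> V" "r \<in> V" "hpair u q \<in> elts s \<and> le R r p \<and> le R r q"
  then obtain r' v q' where "r' \<in> V" "le R r' r" "v \<in> V" "q' \<in> V" "hpair v q' \<in> elts t" "le R r' q'" "Q r' u v"
    using assms(2) unfolding half_def by blast
  then show "\<exists>r'\<in>V. le R r' r \<and> (\<exists>v\<in>V. \<exists>q'\<in>V. hpair v q' \<in> elts t \<and> le R r' q' \<and> Q' r' u v)"
    using assms(1) u by blast
qed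

lemma half_cong:
  assumes "\<And>r u v q q'. hpair u q \<in> elts s \<Longrightarrow> hpair v q' \<in> elts t \<Longrightarrow> Q r u v \<longleftrightarrow> Q' r u v"
  shows "half Q p s t \<longleftrightarrow> half Q' p s t"
  using half_mono[of s t Q Q'] half_mono[of s t Q' Q] assms by blast

text \<open>Induction on \<open>s\<close>: the names compared on the \<open>s\<close> side lie in
  its transitive closure, so the hypothesis exchanges the transposed and the plain relation. At
  names outside \<open>V\<close> both sides fail.\<close>

lemma eqf_sym: "s \<in> V \<Longrightarrow> t \<in> V \<Longrightarrow> eqf p s t \<longleftrightarrow> eqf p t s"
proof (induction s arbitrary: p t rule: tc_induct)
  case (step s)
  have IH: "eqf p u v \<longleftrightarrow> eqf p v u" if "hpair u q \<in> elts s" for p u v q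
  proof (cases "v \<in> V")
    case True
    then show ?thesis
      using step.IH[OF hpair_fst_tc[OF that]] pair_V[OF that step.prems(1)] by blast
  qed (use eqf_V in blast)
  have "half eqf p s t \<longleftrightarrow> half (\<lambda>r v u. eqf r u v) p s t"
    "half (\<lambda>r v u. eqf r u v) p t s \<longleftrightarrow> half eqf p t s"
    using IH by (intro half_cong; blast)+
  then show ?case
    unfolding eqf_iff[OF step.prems] eqf_iff[OF step.prems(2,1)] eq_step_def by blast
qed

lemma eqf_memf:
  assumes "s \<in> V" "t \<in> V"
  shows "eqf p s t \<longleftrightarrow> p \<in> conds R \<and> half eqf p s t \<and> half eqf p t s"
proof -
  have "eqf p u v \<longleftrightarrow> eqf p v u" if "hpair u q \<in> elts s" for p u v q
    using eqf_sym eqf_V by blast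
  then have "half (\<lambda>r v u. eqf r u v) p t s \<longleftrightarrow> half eqf p t s"
    by (intro half_cong) blast
  then show ?thesis
    unfolding eqf_iff[OF assms] eq_step_def by blast
qed

lemma memf_mono: "memf p s t \<Longrightarrow> le R q p \<Longrightarrow> memf q s t"
  unfolding memf_def using eqf_mono le_trans by blast

text \<open>Genericity meets only dense sets that belong to \<open>V\<close>. This is secured by
  definability of the property with parameters from \<open>V\<close> (\<open>csetI\<close>).\<close>

definition cset :: "(hc \<Rightarrow> bool) \<Rightarrow> bool" where
  "cset Q \<longleftrightarrow> hset {p \<in> conds R. Q p} \<in> V"

lemma countable_conds [simp]: "countable {p \<in> conds R. Q p}"
  by (rule countable_subset[OF _ countable_elts[of "fst R"]]) (auto simp: conds_def)

lemma csetI: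
  assumes "pred_free \<phi>" "env V e" "\<And>p. p \<in> conds R \<Longrightarrow> p \<in> V \<Longrightarrow> Q p \<longleftrightarrow> sat V {} (e(0 := p)) \<phi>"
  shows "cset Q"
  unfolding cset_def
  by (rule sep_set[OF assms(1,2), of "fst R"]) (use assms(3) in \<open>auto simp: conds_def\<close>)

lemma cset_or:
  assumes "cset Q" "cset Q'"
  shows "cset (\<lambda>p. Q p \<or> Q' p)"
proof -
  have "{p \<in> conds R. Q p \<or> Q' p} = {p \<in> conds R. Q p} \<union> {p \<in> conds R. Q' p}" by auto
  then show ?thesis
    using un[OF assms[unfolded cset_def]] by (simp add: cset_def)
qed

lemma cset_incompatible:
  assumes "p0 \<in> V"
  shows "cset (\<lambda>p. \<not> (\<exists>r\<in>V. le R r p \<and> le R r p0))"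
  by (rule csetI[where \<phi> = "Neg (fEx 3 (And (fPairIn 3 0 2) (fPairIn 3 4 2)))" and e = "E0(4 := p0)"])
     (use assms in \<open>auto simp: le_def\<close>)

lemma cset_memf: "s \<in> V \<Longrightarrow> t \<in> V \<Longrightarrow> cset (\<lambda>p. memf p s t)"
  by (rule csetI[where \<phi> = "fEx 7 (And (Eq 7 0) (fMemf 7 12 13))" and e = "E0(12 := s, 13 := t)"]) auto

lemma cset_eqf: "s \<in> V \<Longrightarrow> t \<in> V \<Longrightarrow> cset (\<lambda>p. eqf p s t)"
  by (rule csetI[where \<phi> = "fEx 7 (And (Eq 7 0) (fEqfAt 7 12 13))" and e = "E0(12 := s, 13 := t)"]) auto

text \<open>The poset parameters sit below index 20 and the assignment proper from 20 on, to match
  the shift made by \<open>fForced\<close>.\<close>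

definition fenv :: "(nat \<Rightarrow> hc) \<Rightarrow> nat \<Rightarrow> hc" where
  "fenv e i = (if i < 20 then E0 i else e (i - 20))"

lemma penv_fenv [simp]: "env V e \<Longrightarrow> penv (fenv e)"
proof -
  assume "env V e"
  then have "\<forall>i\<in>UNIV. fenv e i \<in> V"
    using env_in[OF penv_env[OF penv_E0]] env_in[of V e] by (simp add: fenv_def)
  then show ?thesis
    unfolding penv_def env_def image_subset_iff by (simp add: fenv_def E0_def)
qed

lemma fenv_shift [simp]: "fenv e (i + 20) = e i" "(\<lambda>i. fenv e (i + 20)) = e"
  by (auto simp: fenv_def)

lemma cset_forced: "env V e \<Longrightarrow> cset (\<lambda>p. forced e p \<phi>)"
  by (rule csetI[where \<phi> = "fForced \<phi>" and e = "fenv e"]) (auto simp: sat_fForced)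

lemma cset_forced_ex:
  assumes "env V e"
  shows "cset (\<lambda>p. \<exists>x\<in>V. nm x \<and> forced (e(n := x)) p \<phi>)"
proof (rule csetI[where \<phi> = "fEx (n + 20) (And (fNm (n + 20)) (fForced \<phi>))" and e = "fenv e"])
  fix p assume p: "p \<in> V"
  have "sat V {} ((fenv e)(0 := p, n + 20 := x)) (fForced \<phi>) \<longleftrightarrow> forced (e(n := x)) p \<phi>" if "x \<in> V" for x
  proof -
    have "sat V {} ((fenv e)(0 := p, n + 20 := x)) (fForced \<phi>) \<longleftrightarrow>
        forced (\<lambda>i. ((fenv e)(0 := p, n + 20 := x)) (i + 20)) (((fenv e)(0 := p, n + 20 := x)) 0) \<phi>"
      by (intro sat_fForced penv_upd penv_fenv p that assms) simp_all
    then show ?thesis by (simp only: shift_upd) simp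
  qed
  then show "(\<exists>x\<in>V. nm x \<and> forced (e(n := x)) p \<phi>) \<longleftrightarrow>
      sat V {} ((fenv e)(0 := p)) (fEx (n + 20) (And (fNm (n + 20)) (fForced \<phi>)))"
    using p assms by simp
qed (use assms in auto)

end

section \<open>The truth lemma for a fixed generic filter\<close>

locale generic_ext = forcing_poset +
  fixes H :: hc
  assumes generic: "generic V R H"
begin

abbreviation W :: "hc set" where "W \<equiv> gen_ext V R H"

lemma H_conds: "p \<in> elts H \<Longrightarrow> p \<in> conds R"
  using generic by (auto simp: generic_def is_filter_def)

lemma H_V: "p \<in> elts H \<Longrightarrow> p \<in> V"
  using H_conds conds_V by blast

lemma H_up: "q \<in> elts H \<Longrightarrow> le R q p \<Longrightarrow> p \<in> elts H"
  using generic le_conds unfolding generic_def is_filter_def by blast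

lemma H_common: "p \<in> elts H \<Longrightarrow> q \<in> elts H \<Longrightarrow> \<exists>r\<in>elts H. le R r p \<and> le R r q"
  using generic unfolding generic_def is_filter_def by blast

lemma H_nonempty: "\<exists>p. p \<in> elts H"
  using generic unfolding generic_def is_filter_def by blast

lemma generic_meets:
  assumes "cset Q" "\<And>p. p \<in> conds R \<Longrightarrow> \<exists>q. le R q p \<and> Q q"
  shows "\<exists>p\<in>elts H. Q p"
proof -
  have "dense R (elts (hset {p \<in> conds R. Q p}))"
    using assms(2) le_conds by (auto simp: dense_def) blast
  then have "elts (hset {p \<in> conds R. Q p}) \<inter> elts H \<noteq> {}"
    using assms(1) generic unfolding generic_def cset_def by blast
  then show ?thesis by auto
qed

text \<open>Density below \<open>p0\<close> becomes density everywhere after adding the conditions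
  incompatible with \<open>p0\<close>; none of these is in \<open>H\<close>, which contains
  \<open>p0\<close>.\<close>

lemma generic_meets_below:
  assumes "cset Q" "p0 \<in> elts H" "\<And>p. le R p p0 \<Longrightarrow> \<exists>q. le R q p \<and> Q q"
  shows "\<exists>p\<in>elts H. Q p"
proof -
  have "\<exists>p\<in>elts H. Q p \<or> \<not> (\<exists>r\<in>V. le R r p \<and> le R r p0)"
  proof (rule generic_meets[OF cset_or[OF assms(1) cset_incompatible]])
    show "p0 \<in> V" using assms(2) H_V by blast
    fix p assume p: "p \<in> conds R"
    show "\<exists>q. le R q p \<and> (Q q \<or> \<not> (\<exists>r\<in>V. le R r q \<and> le R r p0))"
      using assms(3) le_trans le_refl[OF p] by blast
  qed
  then show ?thesis
    using H_common[OF _ assms(2)] H_V by blast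
qed

lemma val_memI: "hpair s p \<in> elts t \<Longrightarrow> p \<in> elts H \<Longrightarrow> val H s \<in> elts (val H t)"
  by (auto simp: elts_val)

lemma memf_sound_step:
  assumes "half eqf p s t" "s \<in> V" "t \<in> V" "p \<in> elts H" "hpair u q \<in> elts s" "q \<in> elts H"
  shows "\<exists>r\<in>elts H. memf r u t"
proof -
  obtain r where r: "r \<in> elts H" "le R r p" "le R r q"
    using H_common assms by blast
  have uV: "u \<in> V" "q \<in> V" using pair_V assms by blast+
  show ?thesis
  proof (rule generic_meets_below[OF cset_memf r(1)])
    fix r1 assume "le R r1 r"
    then have "r1 \<in> V" "le R r1 p" "le R r1 q"
      using le_V le_trans r by blast+
    then show "\<exists>r'. le R r' r1 \<and> memf r' u t"
      using assms uV unfolding half_memf by blast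
  qed (use uV assms in auto)
qed

text \<open>Induction on \<open>s\<close>. For an element of the value of \<open>s\<close> named by
  \<open>u\<close>, genericity provides a condition in \<open>H\<close> that realises the dense
  witness of \<open>half\<close>; by induction \<open>u\<close> and its counterpart in
  \<open>t\<close> have the same value.\<close>

lemma eqf_sound: "eqf p s t \<Longrightarrow> p \<in> elts H \<Longrightarrow> val H s = val H t"
proof (induction s arbitrary: p t rule: tc_induct)
  case (step s)
  have V: "s \<in> V" "t \<in> V" using eqf_V[OF step.prems(1)] by auto
  have st: "half eqf p s t" "half eqf p t s"
    using step.prems(1) eqf_memf[OF V] by auto
  have "val H u \<in> elts (val H t)" if u: "hpair u q \<in> elts s" "q \<in> elts H" for u q
  proof -
    obtain r v q' where "r \<in> elts H" "hpair v q' \<in> elts t" "le R r q'" "eqf r u v"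
      using memf_sound_step[OF st(1) V step.prems(2) u] by (auto simp: memf_def)
    then show ?thesis
      using step.IH[OF hpair_fst_tc[OF u(1)]] val_memI H_up by metis
  qed
  moreover have "val H v \<in> elts (val H s)" if v: "hpair v q \<in> elts t" "q \<in> elts H" for v q
  proof -
    obtain r u q' where r: "r \<in> elts H" "hpair u q' \<in> elts s" "le R r q'" "eqf r v u"
      using memf_sound_step[OF st(2) V(2,1) step.prems(2) v] by (auto simp: memf_def)
    then have "eqf r u v"
      using eqf_sym eqf_V by blast
    then show ?thesis
      using r step.IH[OF hpair_fst_tc] val_memI H_up by metis
  qed
  ultimately show ?case
    by (intro hc_eqI) (auto simp: elts_val[of _ s] elts_val[of _ t])
qed

lemma memf_sound: "memf p s t \<Longrightarrow> p \<in> elts H \<Longrightarrow> val H s \<in> elts (val H t)"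
  unfolding memf_def using eqf_sound val_memI H_up by metis

lemma cset_no_memf:
  assumes "s \<in> V" "t \<in> V"
  shows "cset (\<lambda>p. \<exists>u\<in>V. \<exists>q\<in>V. hpair u q \<in> elts s \<and> le R p q \<and> (\<forall>r\<in>V. le R r p \<longrightarrow> \<not> memf r u t))"
  by (rule csetI[where e = "E0(12 := s, 13 := t)" and
      \<phi> = "fEx 14 (fEx 15 (And (fPairIn 14 15 12) (And (fPairIn 0 15 2)
        (All 16 (fImp (fPairIn 16 0 2) (Neg (fMemf 16 14 13)))))))"])
     (use assms in \<open>auto simp: le_def\<close>)

text \<open>A condition that does not force the equality has an extension witnessing a failure of
  one of the two inclusions, so the conditions of these three kinds are dense. A failure in
  \<open>H\<close> would contradict the equality of the values, by induction at the constituent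
  names.\<close>

lemma eqf_complete: "s \<in> V \<Longrightarrow> t \<in> V \<Longrightarrow> val H s = val H t \<Longrightarrow> \<exists>p\<in>elts H. eqf p s t"
proof (induction s arbitrary: t rule: tc_induct)
  case (step s)
  let ?no = "\<lambda>s t p. \<exists>u\<in>V. \<exists>q\<in>V. hpair u q \<in> elts s \<and> le R p q \<and> (\<forall>r\<in>V. le R r p \<longrightarrow> \<not> memf r u t)"
  have "cset (\<lambda>p. (eqf p s t \<or> ?no s t p) \<or> ?no t s p)"
    using step.prems by (intro cset_or cset_no_memf cset_eqf)
  moreover have "\<exists>q. le R q p \<and> ((eqf q s t \<or> ?no s t q) \<or> ?no t s q)" if p: "p \<in> conds R" for p
  proof -
    have no: "\<exists>r. le R r p \<and> ?no s t r" if "\<not> half eqf p s t" for s t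
    proof -
      note a = that
      from a obtain u q r where r: "u \<in> V" "q \<in> V" "r \<in> V" "hpair u q \<in> elts s" "le R r p" "le R r q"
        "\<forall>r'\<in>V. le R r' r \<longrightarrow> \<not> memf r' u t"
        unfolding half_memf by blast
      then show ?thesis by blast
    qed
    show ?thesis
      using no[of s t] no[of t s] eqf_memf[OF step.prems(1,2), of p] p le_refl[OF p] by blast
  qed
  ultimately obtain p where p: "p \<in> elts H" and Q: "(eqf p s t \<or> ?no s t p) \<or> ?no t s p"
    using generic_meets[of "\<lambda>p. (eqf p s t \<or> ?no s t p) \<or> ?no t s p"] by blast
  have eqf_ex: "\<exists>r\<in>elts H. le R r p \<and> le R r q' \<and> eqf r u v"
    if "hpair u q \<in> elts s" "v \<in> V" "val H u = val H v" "q' \<in> elts H" for u q v q'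
  proof -
    note a = that
    obtain r where r: "r \<in> elts H" "eqf r u v"
      using step.IH[OF hpair_fst_tc[OF a(1)]] pair_V[OF a(1) step.prems(1)] a by blast
    obtain r1 where r1: "r1 \<in> elts H" "le R r1 r" "le R r1 p" using H_common[OF r(1) p] by blast
    obtain r2 where r2: "r2 \<in> elts H" "le R r2 r1" "le R r2 q'" using H_common[OF r1(1) a(4)] by blast
    have "le R r2 r" "le R r2 p" using r1 r2 le_trans by blast+
    then show ?thesis using r r2 eqf_mono by blast
  qed
  have "\<not> ?no s t p"
  proof
    assume "?no s t p"
    then obtain u q where u: "hpair u q \<in> elts s" "le R p q" "\<forall>r\<in>V. le R r p \<longrightarrow> \<not> memf r u t" by blast
    then have "val H u \<in> elts (val H t)"
      using val_memI H_up p step.prems(3) by metis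
    then obtain v q' where v: "hpair v q' \<in> elts t" "q' \<in> elts H" "val H u = val H v"
      by (auto simp: elts_val[of _ t])
    have vV: "v \<in> V" "q' \<in> V" using pair_V v step.prems by blast+
    obtain r where r: "r \<in> elts H" "le R r p" "le R r q'" "eqf r u v"
      using eqf_ex[OF u(1) vV(1) v(3,2)] by blast
    have "memf r u t"
      unfolding memf_def using r v vV by blast
    then show False using u r H_V by blast
  qed
  moreover have "\<not> ?no t s p"
  proof
    assume "?no t s p"
    then obtain v q where v: "hpair v q \<in> elts t" "le R p q" "\<forall>r\<in>V. le R r p \<longrightarrow> \<not> memf r v s" by blast
    then have "val H v \<in> elts (val H s)"
      using val_memI H_up p step.prems(3) by metis
    then obtain u q' where u: "hpair u q' \<in> elts s" "q' \<in> elts H" "val H u = val H v"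
      by (auto simp: elts_val[of _ s])
    have uV: "u \<in> V" "q' \<in> V" "v \<in> V" using pair_V u v step.prems by blast+
    obtain r where r: "r \<in> elts H" "le R r p" "le R r q'" "eqf r u v"
      using eqf_ex[OF u(1) uV(3) u(3,2)] by blast
    \<comment> \<open>The induction runs over names below \<open>s\<close>, so the equality comes
      with \<open>u\<close> on the left and has to be turned round.\<close>
    then have "eqf r v u" using eqf_sym uV by blast
    then have "memf r v s"
      unfolding memf_def using r u uV by blast
    then show False using v r H_V by blast
  qed
  ultimately show ?case using Q p by blast
qed

lemma memf_complete:
  assumes "s \<in> V" "t \<in> V" "val H s \<in> elts (val H t)"
  shows "\<exists>p\<in>elts H. memf p s t"
proof -
  from assms(3) obtain v q where v: "hpair v q \<in> elts t" "q \<in> elts H" "val H s = val H v"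
    by (auto simp: elts_val[of _ t])
  have vV: "v \<in> V" "q \<in> V" using pair_V v assms by blast+
  obtain p where p: "p \<in> elts H" "eqf p s v" using eqf_complete[OF assms(1) vV(1) v(3)] by blast
  obtain r where "r \<in> elts H" "le R r p" "le R r q" using H_common p v by blast
  then show ?thesis unfolding memf_def using v vV p eqf_mono by blast
qed

end

text \<open>The canonical name of \<open>x\<close>. All conditions are attached, as a largest
  condition need not exist.\<close>

function check :: "hc \<Rightarrow> hc \<Rightarrow> hc" where
  "check c x = hset {hpair s p | s p. s \<in> check c ` elts x \<and> p \<in> elts c}"
  by pat_completeness auto
termination
  by (relation "inv_image mem_rel snd") (rule wf_inv_image[OF wf_mem_rel], simp add: mem_rel_def)

declare check.simps [simp del]

lemma check_eq: "check c x = hprod (hset (check c ` elts x)) c"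
  by (subst check.simps) (simp add: hprod_def)

lemma elts_check: "elts (check c x) = {hpair (check c y) p | y p. y \<in> elts x \<and> p \<in> elts c}"
  by (subst check_eq) auto

context generic_ext
begin

lemma W_iff: "w \<in> W \<longleftrightarrow> (\<exists>t\<in>V. nm t \<and> w = val H t)"
  by (auto simp: gen_ext_def nm_iff)

lemma forced_common:
  "p \<in> elts H \<Longrightarrow> q \<in> elts H \<Longrightarrow> \<exists>r\<in>elts H. le R r p \<and> le R r q \<and> r \<in> V"
  using H_common H_V by blast

lemma densely_iff:
  assumes "cset Q" "\<And>p q. Q p \<Longrightarrow> le R q p \<Longrightarrow> Q q"
  shows "(\<exists>p\<in>elts H. \<forall>q\<in>V. le R q p \<longrightarrow> (\<exists>r\<in>V. le R r q \<and> Q r)) \<longleftrightarrow> (\<exists>p\<in>elts H. Q p)"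
proof
  assume "\<exists>p\<in>elts H. \<forall>q\<in>V. le R q p \<longrightarrow> (\<exists>r\<in>V. le R r q \<and> Q r)"
  then obtain p where p: "p \<in> elts H" "\<forall>q\<in>V. le R q p \<longrightarrow> (\<exists>r\<in>V. le R r q \<and> Q r)" by blast
  show "\<exists>p\<in>elts H. Q p"
    by (rule generic_meets_below[OF assms(1) p(1)]) (use p(2) le_V in blast)
next
  assume "\<exists>p\<in>elts H. Q p"
  then show "\<exists>p\<in>elts H. \<forall>q\<in>V. le R q p \<longrightarrow> (\<exists>r\<in>V. le R r q \<and> Q r)"
    using assms(2) le_V by blast
qed

text \<open>Negation rests on the density of the conditions deciding the formula, conjunction on the
  directedness of \<open>H\<close>, and the universal quantifier on the density of the conditions
  that force it or refute an instance at some name.\<close>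

lemma truth:
  "env V e \<Longrightarrow> (\<And>i. nm (e i)) \<Longrightarrow> pred_free \<phi> \<Longrightarrow>
    sat W {} (\<lambda>i. val H (e i)) \<phi> \<longleftrightarrow> (\<exists>p\<in>elts H. forced e p \<phi>)"
proof (induction \<phi> arbitrary: e)
  case (Mem m n)
  have V: "e m \<in> V" "e n \<in> V" using Mem.prems by auto
  have "(\<exists>p\<in>elts H. forced e p (Mem m n)) \<longleftrightarrow> (\<exists>p\<in>elts H. memf p (e m) (e n))"
    unfolding forced.simps by (rule densely_iff[OF cset_memf[OF V]]) (rule memf_mono)
  then show ?case
    using memf_sound memf_complete[OF V] by auto
next
  case (Eq m n)
  have V: "e m \<in> V" "e n \<in> V" using Eq.prems by auto
  have "(\<exists>p\<in>elts H. forced e p (Eq m n)) \<longleftrightarrow> (\<exists>p\<in>elts H. eqf p (e m) (e n))"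
    unfolding forced.simps by (rule densely_iff[OF cset_eqf[OF V]]) (rule eqf_mono)
  then show ?case
    using eqf_sound eqf_complete[OF V] by auto
next
  case (Neg \<phi>)
  have IH: "sat W {} (\<lambda>i. val H (e i)) \<phi> \<longleftrightarrow> (\<exists>p\<in>elts H. forced e p \<phi>)"
    using Neg by simp
  have "\<exists>p\<in>elts H. forced e p \<phi> \<or> forced e p (Neg \<phi>)"
    by (rule generic_meets[OF cset_or[OF cset_forced cset_forced]])
       (use Neg.prems le_refl in \<open>auto\<close>)
  moreover have False if "p \<in> elts H" "forced e p \<phi>" "q \<in> elts H" "forced e q (Neg \<phi>)" for p q
    using forced_common[OF that(1,3)] that(2,4) forced_mono by auto
  ultimately show ?case
    using IH by (metis sat.simps(4))
next
  case (And \<phi> \<psi>)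
  have IH: "sat W {} (\<lambda>i. val H (e i)) \<phi> \<longleftrightarrow> (\<exists>p\<in>elts H. forced e p \<phi>)"
    "sat W {} (\<lambda>i. val H (e i)) \<psi> \<longleftrightarrow> (\<exists>p\<in>elts H. forced e p \<psi>)"
    using And by simp_all
  have "\<exists>r\<in>elts H. forced e r (And \<phi> \<psi>)" if "p \<in> elts H" "forced e p \<phi>" "q \<in> elts H" "forced e q \<psi>" for p q
    using forced_common[OF that(1,3)] that(2,4) forced_mono unfolding forced.simps by blast
  then show ?case
    using IH by auto
next
  case (All n \<phi>)
  have upd: "(\<lambda>i. val H ((e(n := x)) i)) = (\<lambda>i. val H (e i))(n := val H x)" for x
    by auto
  have IH: "sat W {} ((\<lambda>i. val H (e i))(n := val H x)) \<phi> \<longleftrightarrow> (\<exists>p\<in>elts H. forced (e(n := x)) p \<phi>)"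
    if "x \<in> V" "nm x" for x
    unfolding upd[symmetric]
    by (rule All.IH) (use All.prems that in \<open>simp_all add: env_upd del: fun_upd_apply, simp\<close>)
  show ?case
  proof
    assume sat: "sat W {} (\<lambda>i. val H (e i)) (All n \<phi>)"
    have "cset (\<lambda>p. forced e p (All n \<phi>) \<or> (\<exists>x\<in>V. nm x \<and> forced (e(n := x)) p (Neg \<phi>)))"
      by (intro cset_or cset_forced cset_forced_ex All.prems)
    moreover have "\<exists>q. le R q p \<and> (forced e q (All n \<phi>) \<or> (\<exists>x\<in>V. nm x \<and> forced (e(n := x)) q (Neg \<phi>)))"
      if p: "p \<in> conds R" for p
    proof (cases "forced e p (All n \<phi>)")
      case True
      then show ?thesis using le_refl p by blast
    next
      case False
      then obtain x where x: "x \<in> V" "nm x" "\<not> forced (e(n := x)) p \<phi>" by auto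
      then obtain q where "le R q p" "\<And>r. le R r q \<Longrightarrow> \<not> forced (e(n := x)) r \<phi>"
        using forced_dense[OF p] by blast
      then show ?thesis using x by auto
    qed
    ultimately obtain p where p: "p \<in> elts H"
      "forced e p (All n \<phi>) \<or> (\<exists>x\<in>V. nm x \<and> forced (e(n := x)) p (Neg \<phi>))"
      using generic_meets[of "\<lambda>p. forced e p (All n \<phi>) \<or> (\<exists>x\<in>V. nm x \<and> forced (e(n := x)) p (Neg \<phi>))"]
      by blast
    moreover have "\<not> forced (e(n := x)) p (Neg \<phi>)" if "x \<in> V" "nm x" for x
    proof
      assume neg: "forced (e(n := x)) p (Neg \<phi>)"
      note x = that
      have "val H x \<in> W" using x W_iff by blast
      then obtain q where q: "q \<in> elts H" "forced (e(n := x)) q \<phi>"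
        using sat IH[OF x] by auto
      then show False
        using forced_common[OF p(1) q(1)] neg forced_mono by auto
    qed
    ultimately show "\<exists>p\<in>elts H. forced e p (All n \<phi>)" by blast
  next
    assume "\<exists>p\<in>elts H. forced e p (All n \<phi>)"
    then show "sat W {} (\<lambda>i. val H (e i)) (All n \<phi>)"
      using IH by (auto simp: W_iff) blast
  qed
qed simp

lemma tmodel_W [simp]: "tmodel W"
  unfolding tmodel_def transitive_def
proof (intro ballI subsetI)
  fix w z assume "w \<in> W" "z \<in> elts w"
  then obtain t s p where t: "t \<in> V" "is_name R t" "hpair s p \<in> elts t" "z = val H s"
    by (auto simp: gen_ext_def elts_val)
  then have "is_name R s" using is_nameD by fastforce
  moreover have "s \<in> V" using pair_V t by blast
  ultimately show "z \<in> W" using t by (auto simp: gen_ext_def)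
qed

lemma countable_W: "countable W"
  unfolding gen_ext_def by simp

text \<open>The name for the subset attaches to each constituent name \<open>s\<close> of
  \<open>ta\<close> the conditions below its own that force the formula at \<open>s\<close>.
  Definability of \<open>forced\<close> puts this name into \<open>V\<close>, and the truth lemma
  evaluates it.\<close>

lemma W_sep:
  assumes \<phi>: "pred_free \<phi>" and e: "env W e" and a: "a \<in> W"
  shows "hset {x \<in> elts a. sat W {} (e(0 := x)) \<phi>} \<in> W"
proof -
  have "\<forall>i. \<exists>t. t \<in> V \<and> nm t \<and> e i = val H t"
    using e W_iff env_in by blast
  then obtain d where d: "\<And>i. d i \<in> V" "\<And>i. nm (d i)" "\<And>i. e i = val H (d i)"
    by metis
  obtain ta where ta: "ta \<in> V" "nm ta" "a = val H ta"
    using a W_iff by blast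
  have dV: "env V d" using d by (auto simp: env_def)
  define B where "B = {z. \<exists>s\<in>V. \<exists>p\<in>V. z = hpair s p \<and>
    (\<exists>q\<in>V. hpair s q \<in> elts ta \<and> le R p q) \<and> forced (d(0 := s)) p \<phi>}"
  have B_sub: "B \<subseteq> elts (hprod (tc ta) (fst R))"
    using hpair_fst_tc le_conds by (fastforce simp: B_def conds_def)
  have "hset B \<in> V"
  proof (rule sep_set[OF _ _ _ B_sub])
    \<comment> \<open>Index 9 holds \<open>ta\<close>, 20 is variable 0 of \<open>\<phi>\<close>
      after the shift, 0 holds the condition, and 7 keeps the candidate pair.\<close>
    let ?e = "(fenv d)(9 := ta)"
    let ?\<phi> = "fEx 7 (And (Eq 7 0) (fEx 20 (fEx 0 (And (fPair 7 20 0)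
      (And (fEx 8 (And (fPairIn 20 8 9) (fPairIn 0 8 2))) (fForced \<phi>))))))"
    show "pred_free ?\<phi>" "env V ?e" using ta dV by simp_all
    show "hprod (tc ta) (fst R) \<in> V" using ta by simp
    fix z assume z: "z \<in> V"
    have "sat V {} (?e(0 := z, 7 := z, 20 := s, 0 := p)) (fForced \<phi>) \<longleftrightarrow> forced (d(0 := s)) p \<phi>"
      if "s \<in> V" "p \<in> V" for s p
    proof -
      have "sat V {} (?e(0 := z, 7 := z, 20 := s, 0 := p)) (fForced \<phi>) \<longleftrightarrow>
        forced (\<lambda>i. (?e(0 := z, 7 := z, 20 := s, 0 := p)) (i + 20)) ((?e(0 := z, 7 := z, 20 := s, 0 := p)) 0) \<phi>"
        by (intro sat_fForced penv_upd penv_fenv dV ta that z) simp_all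
      moreover have "(\<lambda>i. (?e(0 := z, 7 := z, 20 := s, 0 := p)) (i + 20)) = d(0 := s)"
        by (auto simp: fenv_def)
      ultimately show ?thesis by (simp del: fun_upd_apply) simp
    qed
    then show "z \<in> B \<longleftrightarrow> sat V {} (?e(0 := z)) ?\<phi>"
      using z ta dV by (simp add: B_def le_def)
  qed
  moreover have cB: "countable B"
    by (rule countable_subset[OF B_sub]) simp
  moreover have "is_name R (hset B)"
  proof (rule is_name.intros)
    fix z assume "z \<in> elts (hset B)"
    then obtain s p q where z: "z = hpair s p" "hpair s q \<in> elts ta" "le R p q"
      using cB by (auto simp: B_def)
    then have "is_name R s"
      using is_nameD[of R ta] nm_iff[OF ta(1)] ta(2) by fastforce
    then show "\<exists>s p. z = hpair s p \<and> p \<in> conds R \<and> is_name R s"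
      using z le_conds by blast
  qed
  ultimately have W: "val H (hset B) \<in> W"
    using W_iff nm_iff by blast
  have sat: "sat W {} (e(0 := val H s)) \<phi> \<longleftrightarrow> (\<exists>p\<in>elts H. forced (d(0 := s)) p \<phi>)" if "s \<in> V" "nm s" for s
  proof -
    have "e(0 := val H s) = (\<lambda>i. val H ((d(0 := s)) i))"
      using d by auto
    then show ?thesis
      using truth[of "d(0 := s)" \<phi>] dV d that \<phi> by (simp del: fun_upd_apply) simp
  qed
  have "elts (val H (hset B)) = {x \<in> elts a. sat W {} (e(0 := x)) \<phi>}"
  proof (intro set_eqI iffI)
    fix x assume "x \<in> elts (val H (hset B))"
    then obtain s p q where x: "x = val H s" "p \<in> elts H" "hpair s q \<in> elts ta" "le R p q"
      "forced (d(0 := s)) p \<phi>" "s \<in> V"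
      using cB by (auto simp: elts_val B_def)
    have "nm s"
      using is_nameD[of R ta] nm_iff[OF ta(1)] ta(2) x nm_iff by fastforce
    then show "x \<in> {x \<in> elts a. sat W {} (e(0 := x)) \<phi>}"
      using x sat ta(3) val_memI H_up by auto
  next
    fix x assume "x \<in> {x \<in> elts a. sat W {} (e(0 := x)) \<phi>}"
    then obtain s q where x: "x = val H s" "hpair s q \<in> elts ta" "q \<in> elts H" "sat W {} (e(0 := x)) \<phi>"
      using ta by (auto simp: elts_val)
    have sV: "s \<in> V" "q \<in> V" using pair_V x ta by blast+
    have "nm s"
      using is_nameD[of R ta] nm_iff[OF ta(1)] ta(2) x nm_iff[OF sV(1)] by fastforce
    then obtain p where p: "p \<in> elts H" "forced (d(0 := s)) p \<phi>"
      using sat sV x by blast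
    then obtain r where r: "r \<in> elts H" "le R r p" "le R r q" "r \<in> V"
      using forced_common x by blast
    then have "hpair s r \<in> B"
      using x sV p forced_mono by (auto simp: B_def)
    then show "x \<in> elts (val H (hset B))"
      using x(1) r val_memI cB by simp
  qed
  then have "val H (hset B) = hset {x \<in> elts a. sat W {} (e(0 := x)) \<phi>}"
    by (metis countable_elts elts_hset hc_eqI)
  then show ?thesis using W by simp
qed

text \<open>Recursion on membership in \<open>V\<close>. The conjuncts of the formula ask that
  \<open>z\<close> have a value at every element of the argument, that every element of the result
  pair such a value with a condition, and that all these pairs occur.\<close>

lemma check_V: "x \<in> V \<Longrightarrow> check (fst R) x \<in> V"
proof -
  let ?\<phi> = "And (fBall 4 0 (fEx 5 (fPairIn 4 5 2)))
    (And (fBall 6 1 (fBex 4 0 (fBex 7 3 (fEx 5 (And (fPairIn 4 5 2) (fPair 6 5 7))))))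
      (fBall 4 0 (fBall 7 3 (All 5 (fImp (fPairIn 4 5 2) (fPairIn 5 7 1))))))"
  interpret zf_rec V UNIV "check (fst R)" ?\<phi> "\<lambda>_. fst R"
  proof
    show "pred_free ?\<phi>" "env V (\<lambda>_. fst R)" by simp_all
  next
    fix z y d
    assume V: "z \<in> V" "y \<in> V" "d \<in> V"
      and sat: "sat V {} ((\<lambda>_. fst R)(2 := z, 0 := y, 1 := d)) ?\<phi>"
      and IH: "\<And>y' d'. y' \<in> elts y \<Longrightarrow> hpair y' d' \<in> elts z \<Longrightarrow> y' \<in> UNIV \<and> d' = check (fst R) y'"
    from sat V have s: "\<And>y'. y' \<in> elts y \<Longrightarrow> \<exists>d'\<in>V. hpair y' d' \<in> elts z"
      "\<And>u. u \<in> elts d \<Longrightarrow> \<exists>y'\<in>elts y. \<exists>p\<in>elts (fst R). \<exists>d'\<in>V. hpair y' d' \<in> elts z \<and> u = hpair d' p"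
      "\<And>y' p d'. y' \<in> elts y \<Longrightarrow> p \<in> elts (fst R) \<Longrightarrow> d' \<in> V \<Longrightarrow> hpair y' d' \<in> elts z \<Longrightarrow> hpair d' p \<in> elts d"
      by simp_all
    have "elts d = elts (check (fst R) y)"
      unfolding elts_check using s IH by (intro set_eqI iffI) (blast, auto, blast)
    then show "y \<in> UNIV \<and> d = check (fst R) y"
      using hc_eqI by blast
  next
    fix z y
    assume V: "z \<in> V" "y \<in> V"
      and sub: "\<And>y'. y' \<in> elts y \<Longrightarrow> hpair y' (check (fst R) y') \<in> elts z"
      and z: "\<And>y' d'. hpair y' d' \<in> elts z \<Longrightarrow> y' \<in> UNIV \<and> d' = check (fst R) y'"
    \<comment> \<open>The values stored in the graph \<open>z\<close> lie in its double union, where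
      Separation collects those belonging to elements of \<open>y\<close>.\<close>
    let ?U = "\<lambda>x. hset (\<Union>y\<in>elts x. elts y)"
    have UU: "?U (?U z) \<in> V" using V union by blast
    have inUU: "d \<in> elts (?U (?U z))" if "hpair c d \<in> elts z" for c d
    proof -
      have "hset {c, d} \<in> elts (hpair c d)"
        by (simp add: hpair_def)
      then show ?thesis
        using that by simp (rule bexI[of _ "hpair c d"], rule bexI[of _ "hset {c, d}"], simp_all)
    qed
    have "hset (check (fst R) ` elts y) \<in> V"
    proof (rule sep_set[OF _ _ UU])
      let ?\<psi> = "fBex 3 1 (fPairIn 3 0 2)"
      show "pred_free ?\<psi>" "env V ((\<lambda>_. z)(1 := y))" using V by auto
      show "check (fst R) ` elts y \<subseteq> elts (?U (?U z))" using inUU sub by blast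
      fix d assume "d \<in> V"
      then show "d \<in> check (fst R) ` elts y \<longleftrightarrow> sat V {} ((\<lambda>_. z)(1 := y, 0 := d)) ?\<psi>"
        using V sub z by auto
    qed
    then have ch: "check (fst R) y \<in> V"
      unfolding check_eq[of _ y] by simp
    moreover have "check (fst R) y' \<in> V" if "y' \<in> elts y" for y'
      using pair_V sub[OF that] V by blast
    ultimately show "check (fst R) y \<in> V \<and> sat V {} ((\<lambda>_. fst R)(2 := z, 0 := y, 1 := check (fst R) y)) ?\<phi>"
      using V sub z by (auto simp: elts_check) blast+
  qed simp
  assume "x \<in> V"
  then show ?thesis by (rule value_N) simp
qed

lemma V_subset_W: "V \<subseteq> W"
proof
  fix x assume x: "x \<in> V"
  have "is_name R (check (fst R) x)" for x
  proof (induction x rule: hc_induct)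
    case (step x)
    then show ?case
      by (intro is_name.intros) (auto simp: elts_check conds_def)
  qed
  moreover have "val H (check (fst R) x) = x" for x
  proof (induction x rule: hc_induct)
    case (step x)
    obtain p where "p \<in> elts H" "p \<in> elts (fst R)"
      using H_nonempty H_conds by (auto simp: conds_def)
    then show ?case
      using step by (intro hc_eqI) (auto simp: elts_val[of _ "check _ _"] elts_check, metis)
  qed
  ultimately show "x \<in> W"
    using check_V[OF x] unfolding gen_ext_def by (metis (mono_tags, lifting) image_eqI mem_Collect_eq)
qed

end

section \<open>Decoding hereditarily countable sets\<close>

lemma mem_irrefl [simp]: "x \<notin> elts x"
  by (induction x rule: hc_induct) blast

text \<open>Replacement along the inverse of \<open>\<Phi>\<close>, which injectivity makes
  functional: a set of codes in \<open>N\<close> yields the set of coded objects.\<close>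

lemma (in zf_rec) repl_inverse:
  assumes I: "I \<in> N" and K0: "K0 \<subseteq> N \<inter> K" "inj_on \<Phi> K" "\<Phi> ` K0 = elts I"
  shows "hset K0 \<in> N"
proof -
  obtain k where k: "fbound fGraph \<le> k" "k > 1"
    by (meson le_SucI less_Suc_eq_le linorder_le_less_linear max.cobounded1 max.strict_coboundedI2)
  then have [simp]: "k \<noteq> 0" "k \<noteq> Suc 0" "0 \<noteq> k" "Suc 0 \<noteq> k" by auto
  \<comment> \<open>The variables \<open>k\<close> and \<open>Suc k\<close> serve to exchange
    variables 0 and 1, since \<open>fGraph\<close> expects the argument in 0 and the value in
    1.\<close>
  let ?\<psi> = "fEx k (And (Eq k 0) (fEx (Suc k) (And (Eq (Suc k) 1)
    (fEx 0 (And (Eq 0 (Suc k)) (fEx 1 (And (Eq 1 k) fGraph)))))))"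
  have inv: "inv_into K \<Phi> (\<Phi> y) = y" if "y \<in> K" for y
    using K0(2) that by simp
  have "hset (inv_into K \<Phi> ` elts I) \<in> N"
  proof (rule repl_fun[where \<phi> = ?\<psi> and e = e])
    show "pred_free ?\<psi>" "env N e" using e by simp_all
    fix i assume "i \<in> elts I"
    then obtain z where z: "z \<in> K0" "i = \<Phi> z" "i \<in> N" "z \<in> N" "z \<in> K"
      using K0 I mem_N by blast
    then show "inv_into K \<Phi> i \<in> N" using inv by simp
    fix y assume y: "y \<in> N"
    have "sat N {} (e(k := i, Suc k := y, 0 := y, Suc 0 := i)) fGraph \<longleftrightarrow> sat N {} (e(0 := y, 1 := i)) fGraph"
      using k by (intro sat_cong) auto
    also have "\<dots> \<longleftrightarrow> y = inv_into K \<Phi> i"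
      unfolding sat_fGraph[OF y z(3)] using z inv inv_into_injective by metis
    finally show "sat N {} (e(0 := i, 1 := y)) ?\<psi> \<longleftrightarrow> y = inv_into K \<Phi> i"
      using y z(3) by simp
  qed (rule I)
  moreover have "inv_into K \<Phi> ` elts I = K0"
    unfolding K0(3)[symmetric] image_image using inv K0(1) by force
  ultimately show ?thesis by simp
qed

context zf
begin

text \<open>Mostowski collapse. The reflexive closure of membership is coded, so that the field of the
  relation is determined by its code \<open>E\<close>.\<close>

lemma decode:
  assumes K: "transitive K" "countable K" and f: "inj_on f K" "f ` K \<subseteq> elts homega"
    and E: "E \<in> N" "\<And>n m. hpair n m \<in> elts E \<longleftrightarrow> (\<exists>a\<in>K. \<exists>b\<in>K. n = f a \<and> m = f b \<and> (a \<in> elts b \<or> a = b))"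
  shows "hset K \<in> N" "hset ((\<lambda>y. hpair y (f y)) ` K) \<in> N"
proof -
  \<comment> \<open>The recursion is on membership and computes the code of a set: the code lies in
    the field of \<open>E\<close>, and its proper predecessors are exactly the codes of the
    elements. The collapse is obtained by inverting this function.\<close>
  let ?\<phi> = "And (fPairIn 1 1 3) (And
    (fBall 4 0 (fEx 5 (And (fPairIn 4 5 2) (And (fPairIn 5 1 3) (Neg (Eq 5 1))))))
    (All 5 (fImp (And (fPairIn 5 1 3) (Neg (Eq 5 1))) (fBex 4 0 (fPairIn 4 5 2)))))"
  have Kd: "z \<in> K" if "y \<in> K" "z \<in> elts y" for y z
    using K that by (auto simp: transitive_def)
  have fN: "f y \<in> N" if "y \<in> K" for y
    using f(2) that omega mem_N by blast
  have feq: "f a = f b \<longleftrightarrow> a = b" if "a \<in> K" "b \<in> K" for a b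
    using f(1) that by (auto simp: inj_on_def)
  have E': "hpair i (f b) \<in> elts E \<and> i \<noteq> f b \<longleftrightarrow> (\<exists>a\<in>elts b. i = f a)" if "b \<in> K" for i b
    using that feq Kd unfolding E(2) by (metis mem_irrefl)
  interpret zf_rec N K f ?\<phi> "\<lambda>_. E"
  proof
    show "pred_free ?\<phi>" "env N (\<lambda>_. E)" using E by simp_all
    show "y \<in> K \<Longrightarrow> z \<in> elts y \<Longrightarrow> z \<in> K" for y z by (rule Kd)
  next
    fix z y d
    assume N: "z \<in> N" "y \<in> N" "d \<in> N"
      and sat: "sat N {} ((\<lambda>_. E)(2 := z, 0 := y, 1 := d)) ?\<phi>"
      and IH: "\<And>y' d'. y' \<in> elts y \<Longrightarrow> hpair y' d' \<in> elts z \<Longrightarrow> y' \<in> K \<and> d' = f y'"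
    from sat N E have s: "hpair d d \<in> elts E"
      "\<And>y'. y' \<in> elts y \<Longrightarrow> \<exists>i\<in>N. hpair y' i \<in> elts z \<and> hpair i d \<in> elts E \<and> i \<noteq> d"
      "\<And>i. i \<in> N \<Longrightarrow> hpair i d \<in> elts E \<Longrightarrow> i \<noteq> d \<Longrightarrow> \<exists>y'\<in>elts y. hpair y' i \<in> elts z"
      by simp_all
    from s(1) obtain w where w: "w \<in> K" "d = f w" using E(2) by blast
    have "y' \<in> elts w" if "y' \<in> elts y" for y'
    proof -
      from s(2)[OF that] obtain i where i: "hpair y' i \<in> elts z" "hpair i d \<in> elts E" "i \<noteq> d" by blast
      then have "y' \<in> K" "i = f y'" using IH that by blast+
      moreover obtain a where "a \<in> elts w" "i = f a" using E'[OF w(1), of i] i w by blast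
      ultimately show ?thesis using feq Kd w(1) by metis
    qed
    moreover have "a \<in> elts y" if a: "a \<in> elts w" for a
    proof -
      have "hpair (f a) d \<in> elts E" "f a \<noteq> d" "a \<in> K"
        using E'[OF w(1), of "f a"] a w Kd by blast+
      then obtain y' where "y' \<in> elts y" "hpair y' (f a) \<in> elts z" using s(3) fN by blast
      then show ?thesis using IH feq \<open>a \<in> K\<close> by metis
    qed
    ultimately have "y = w" by (intro hc_eqI) blast
    then show "y \<in> K \<and> d = f y" using w by simp
  next
    fix z y
    assume N: "z \<in> N" "y \<in> N" and y: "y \<in> K"
      and sub: "\<And>y'. y' \<in> elts y \<Longrightarrow> hpair y' (f y') \<in> elts z"
      and z: "\<And>y' d'. hpair y' d' \<in> elts z \<Longrightarrow> y' \<in> K \<and> d' = f y'"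
    have "\<exists>i\<in>N. hpair y' i \<in> elts z \<and> hpair i (f y) \<in> elts E \<and> i \<noteq> f y" if "y' \<in> elts y" for y'
      using sub[OF that] E'[OF y, of "f y'"] that fN Kd[OF y] by blast
    moreover have "\<exists>y'\<in>elts y. hpair y' i \<in> elts z" if "hpair i (f y) \<in> elts E" "i \<noteq> f y" for i
      using E'[OF y, of i] that sub by blast
    moreover have "hpair (f y) (f y) \<in> elts E" using y E(2) by blast
    ultimately show "f y \<in> N \<and> sat N {} ((\<lambda>_. E)(2 := z, 0 := y, 1 := f y)) ?\<phi>"
      using N E(1) fN[OF y] by simp
  qed
  \<comment> \<open>Separation extracts from \<open>E\<close> the codes of the elements of
    \<open>y\<close>; once these elements are in \<open>N\<close>, \<open>repl_inverse\<close> turns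
    the codes into \<open>y\<close>.\<close>
  have KN: "y \<in> K \<Longrightarrow> y \<in> N" for y
  proof (induction y rule: hc_induct)
    case (step y)
    have "hset (f ` elts y) \<in> N"
    proof (rule sep_set[OF _ _ omega])
      let ?\<psi> = "And (fPairIn 0 2 1) (Neg (Eq 0 2))"
      show "pred_free ?\<psi>" "env N ((\<lambda>_. E)(2 := f y))" using E fN step.prems by simp_all
      show "f ` elts y \<subseteq> elts homega" using f(2) Kd[OF step.prems] by blast
      fix i assume "i \<in> N"
      then show "i \<in> f ` elts y \<longleftrightarrow> sat N {} ((\<lambda>_. E)(2 := f y, 0 := i)) ?\<psi>"
        using E(1) fN[OF step.prems] E'[OF step.prems, of i] by auto
    qed
    then have "hset (elts y) \<in> N"
      by (rule repl_inverse) (use step Kd f in auto)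
    moreover have "hset (elts y) = y" by (intro hc_eqI) simp
    ultimately show ?case by simp
  qed
  \<comment> \<open>The coded relation is reflexive, so its diagonal recovers all codes from
    \<open>E\<close>.\<close>
  have "hset (f ` K) \<in> N"
  proof (rule sep_set[OF _ _ omega])
    show "pred_free (fPairIn 0 0 1)" "env N (\<lambda>_. E)" using E by simp_all
    show "f ` K \<subseteq> elts homega" by (rule f(2))
    fix i assume "i \<in> N"
    then show "i \<in> f ` K \<longleftrightarrow> sat N {} ((\<lambda>_. E)(0 := i)) (fPairIn 0 0 1)"
      using E by auto
  qed
  then show "hset K \<in> N"
    by (rule repl_inverse) (use KN f K(2) in auto)
  then show "hset ((\<lambda>y. hpair y (f y)) ` K) \<in> N"
    using graph_N[of "hset K"] K(2) by simp
qed

end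

section \<open>The cumulative hierarchy\<close>

lemma elts_Vstage:
  assumes "countable N"
  shows "elts (Vstage N a) = {x \<in> N. \<exists>b\<in>elts a. elts x \<subseteq> elts (Vstage N b)}"
proof -
  have "(\<Union>b\<in>elts a. {x \<in> N. elts x \<subseteq> elts (Vstage N b)}) = {x \<in> N. \<exists>b\<in>elts a. elts x \<subseteq> elts (Vstage N b)}"
    by auto
  moreover have "countable {x \<in> N. \<exists>b\<in>elts a. elts x \<subseteq> elts (Vstage N b)}"
    by (rule countable_subset[OF _ assms]) auto
  ultimately show ?thesis by (subst Vstage.simps) simp
qed

lemma Vstage_mono: "countable N \<Longrightarrow> elts a \<subseteq> elts b \<Longrightarrow> elts (Vstage N a) \<subseteq> elts (Vstage N b)"
  unfolding elts_Vstage[of N a] elts_Vstage[of N b] by blast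

lemma hnat_Vstage:
  assumes N: "countable N" "range hnat \<subseteq> N" "m < n"
  shows "hnat m \<in> elts (Vstage N (hnat n))"
  using \<open>m < n\<close>
proof (induction n arbitrary: m rule: less_induct)
  case (less n)
  have "elts (hnat m) \<subseteq> elts (Vstage N (hnat m))"
    using less.IH[OF less.prems] by (auto simp: elts_hnat)
  moreover have "hnat m \<in> elts (hnat n)"
    using less.prems by (simp add: elts_hnat)
  ultimately show ?case
    unfolding elts_Vstage[OF N(1), of "hnat n"] using N(2) by blast
qed

lemma hpair_hnat_Vstage:
  assumes N: "tmodel N" "countable N" "range hnat \<subseteq> N" "hpair (hnat m) (hnat n) \<in> N"
  shows "hpair (hnat m) (hnat n) \<in> elts (Vstage N homega)"
proof -
  \<comment> \<open>Both numbers lie in the stage of index \<open>k\<close>; \<open>{m}\<close> and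
    \<open>{m, n}\<close> lie one stage higher, and the pair in stage
    \<open>\<omega>\<close>.\<close>
  define k where "k = Suc (max m n)"
  have n: "hnat m \<in> elts (Vstage N (hnat k))" "hnat n \<in> elts (Vstage N (hnat k))"
    by (rule hnat_Vstage; use N k_def in simp)+
  have step: "x \<in> elts (Vstage N (hnat (Suc i)))" if "x \<in> N" "elts x \<subseteq> elts (Vstage N (hnat i))" for x i
    unfolding elts_Vstage[OF N(2), of "hnat (Suc i)"] using that by (simp add: hnat_Suc del: hnat.simps(2))
  have "u \<in> N" if "u \<in> elts (hpair (hnat m) (hnat n))" for u
    using that N(1,4) by simp
  then have "u \<in> elts (Vstage N (hnat (Suc k)))" if "u \<in> elts (hpair (hnat m) (hnat n))" for u
    using that n by (intro step) (auto simp: hpair_def)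
  then show ?thesis
    unfolding elts_Vstage[OF N(2), of homega] using N(4) by (auto simp del: hnat.simps)
qed

text \<open>Natural numbers and their pairs have finite rank, so the set is included in stage
  \<open>\<omega>\<close> and belongs to every stage whose index contains
  \<open>\<omega>\<close>.\<close>

lemma real_Vstage:
  assumes N: "tmodel N" "countable N" "range hnat \<subseteq> N" and x: "x \<in> N" and a: "homega \<in> elts a"
    and sub: "elts x \<subseteq> elts homega \<or> elts x \<subseteq> elts (hprod homega homega)"
  shows "x \<in> elts (Vstage N a)"
proof -
  have "elts homega \<subseteq> elts (Vstage N homega)"
  proof
    fix n assume "n \<in> elts homega"
    then obtain i where "n = hnat i" by auto
    then show "n \<in> elts (Vstage N homega)"
      using hnat_Vstage[OF N(2,3) lessI[of i]] Vstage_mono[OF N(2), of "hnat (Suc i)" homega]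
      by (auto simp: elts_hnat)
  qed
  moreover have "z \<in> elts (Vstage N homega)" if z: "z \<in> elts x" "z \<in> elts (hprod homega homega)" for z
  proof -
    obtain m n where "z = hpair (hnat m) (hnat n)" using z by auto
    moreover have "z \<in> N" using N(1) z x by simp
    ultimately show ?thesis using hpair_hnat_Vstage[OF N] by simp
  qed
  ultimately have "elts x \<subseteq> elts (Vstage N homega)"
    using sub by blast
  then show ?thesis
    unfolding elts_Vstage[OF N(2), of a] using a x by blast
qed

section \<open>Hereditarily countable sets of a model\<close>

definition fInj :: "nat \<Rightarrow> nat \<Rightarrow> nat \<Rightarrow> fm" where
  "fInj f t w = (let a = Suc (f + t + w); b = Suc a; c = Suc b; d = Suc c in
     And (fBall a f (fBex b t (fBex c w (fPair a b c))))
    (And (fBall b t (fEx c (All d (fIff (fPairIn b d f) (Eq d c)))))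
      (All a (All b (All c (fImp (And (fPairIn a c f) (fPairIn b c f)) (Eq a b)))))))"

definition fH1 :: "nat \<Rightarrow> fm" where
  "fH1 x = fEx (x + 1) (And (fTc (x + 1) x)
     (fEx (x + 2) (fEx (x + 3) (And (fOmega (x + 3)) (fInj (x + 2) (x + 1) (x + 3))))))"

lemma pred_free_fH1 [simp]: "pred_free (fInj f t w)" "pred_free (fH1 x)"
  by (simp_all add: fInj_def fH1_def Let_def)

context zf
begin

lemma pair_N: "hpair x y \<in> elts s \<Longrightarrow> s \<in> N \<Longrightarrow> x \<in> N \<and> y \<in> N"
  using mem_N[of "hpair x y" s] by simp

lemma sat_fInj [simp]:
  assumes "env N e"
  shows "sat N U e (fInj f t w) \<longleftrightarrow> hinj (e f) (e t) (e w)"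
proof -
  have [simp]: "e f \<in> N" "e t \<in> N" using assms by auto
  have "(\<forall>x\<in>elts (e t). \<exists>y\<in>N. \<forall>y'\<in>N. hpair x y' \<in> elts (e f) \<longleftrightarrow> y' = y) \<longleftrightarrow>
      (\<forall>x\<in>elts (e t). \<exists>!y. hpair x y \<in> elts (e f))"
    by (intro ball_cong refl) (metis pair_N \<open>e f \<in> N\<close>)
  moreover have "(\<forall>x\<in>N. \<forall>x'\<in>N. \<forall>y\<in>N. hpair x y \<in> elts (e f) \<and> hpair x' y \<in> elts (e f) \<longrightarrow> x = x') \<longleftrightarrow>
      (\<forall>x x' y. hpair x y \<in> elts (e f) \<and> hpair x' y \<in> elts (e f) \<longrightarrow> x = x')"
    using pair_N \<open>e f \<in> N\<close> by blast
  ultimately show ?thesis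
    using assms by (simp add: fInj_def Let_def hinj_def hfun_def)
qed

lemma sat_fH1 [simp]: "env N e \<Longrightarrow> sat N U e (fH1 x) \<longleftrightarrow> e x \<in> H_aleph1 N"
  by (auto simp: fH1_def H_aleph1_def card_le_def)

end

text \<open>Relativisation to the hereditarily countable sets; variables are shifted by 1 and the
  predicate becomes membership in variable 0.\<close>

primrec relativise :: "fm \<Rightarrow> fm" where
  "relativise (Mem m n) = Mem (Suc m) (Suc n)"
| "relativise (Eq m n) = Eq (Suc m) (Suc n)"
| "relativise (Pred n) = Mem (Suc n) 0"
| "relativise (Neg \<phi>) = Neg (relativise \<phi>)"
| "relativise (And \<phi> \<psi>) = And (relativise \<phi>) (relativise \<psi>)"
| "relativise (All n \<phi>) = All (Suc n) (fImp (fH1 (Suc n)) (relativise \<phi>))"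

lemma pred_free_relativise [simp]: "pred_free (relativise \<phi>)"
  by (induction \<phi>) auto

text \<open>Elementarity of \<open>j\<close> concerns formulas without the predicate. The predicate
  is therefore turned into an element of the model held by variable 0, to which \<open>j\<close> can
  be applied.\<close>

lemma (in zf) sat_relativise:
  "env N e \<Longrightarrow> sat N {} e (relativise \<phi>) \<longleftrightarrow> sat (H_aleph1 N) (elts (e 0)) (\<lambda>i. e (Suc i)) \<phi>"
proof (induction \<phi> arbitrary: e)
  case (All n \<phi>)
  have upd: "(\<lambda>i. (e(Suc n := x)) (Suc i)) = (\<lambda>i. e (Suc i))(n := x)" for x by auto
  have IH: "sat N {} (e(Suc n := x)) (relativise \<phi>) \<longleftrightarrow>
      sat (H_aleph1 N) (elts (e 0)) ((\<lambda>i. e (Suc i))(n := x)) \<phi>" if "x \<in> N" for x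
  proof -
    have "sat N {} (e(Suc n := x)) (relativise \<phi>) \<longleftrightarrow>
      sat (H_aleph1 N) (elts ((e(Suc n := x)) 0)) (\<lambda>i. (e(Suc n := x)) (Suc i)) \<phi>"
      by (intro All.IH env_upd All.prems that)
    then show ?thesis by (simp only: upd) simp
  qed
  show ?case
    using All.prems IH by (auto simp: H_aleph1_def)
qed auto

lemma comp_const: "j \<circ> (\<lambda>_. x) = (\<lambda>_. j x)"
  by auto

section \<open>The embedding on hereditarily countable sets\<close>

locale elementary = V: zf V + M: zf M for V M :: "hc set" +
  fixes j :: "hc \<Rightarrow> hc"
  assumes j: "elem_embedding j V M"
begin

lemma sat_j: "pred_free \<phi> \<Longrightarrow> env V e \<Longrightarrow> sat V {} e \<phi> \<longleftrightarrow> sat M {} (j \<circ> e) \<phi>"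
  using elem_sat[OF j] by (simp add: comp_def)

lemma sat_jD: "sat V {} e \<phi> \<Longrightarrow> pred_free \<phi> \<Longrightarrow> env V e \<Longrightarrow> sat M {} (j \<circ> e) \<phi>"
  using sat_j by blast

lemma j_M [simp]: "x \<in> V \<Longrightarrow> j x \<in> M"
  using j by (auto simp: elem_embedding_def)

lemma j_mem: "x \<in> V \<Longrightarrow> y \<in> V \<Longrightarrow> j x \<in> elts (j y) \<longleftrightarrow> x \<in> elts y"
  using sat_j[of "Mem 0 1" "(\<lambda>_. y)(0 := x)"] by (simp add: fun_upd_comp comp_const)

lemma j_pair: "x \<in> V \<Longrightarrow> y \<in> V \<Longrightarrow> j (hpair x y) = hpair (j x) (j y)"
  using sat_j[of "fPair 0 1 2" "(\<lambda>_. hpair x y)(1 := x, 2 := y)"] by (simp add: fun_upd_comp comp_const)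

lemma j_homega [simp]: "j homega = homega"
  using sat_j[of "fOmega 0" "\<lambda>_. homega"] by (simp add: comp_const)

lemma hnat_V [simp]: "hnat n \<in> V"
  using V.mem_N[OF _ V.omega, of "hnat n"] by simp

lemma hnat_M [simp]: "hnat n \<in> M"
  using M.mem_N[OF _ M.omega, of "hnat n"] by simp

lemma j_hnat [simp]: "j (hnat n) = hnat n"
proof (induction n)
  case 0
  show ?case
    using sat_j[of "fEmpty 0" "\<lambda>_. hnat 0"] hnat_V[of 0] j_M[OF hnat_V[of 0]] by (simp add: comp_const)
next
  case (Suc n)
  show ?case
    using sat_j[of "fSucc 0 1" "(\<lambda>_. hnat (Suc n))(1 := hnat n)"] Suc
      hnat_V[of n] hnat_V[of "Suc n"] hnat_M[of n] j_M[OF hnat_V[of "Suc n"]]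
    by (simp add: fun_upd_comp comp_const hnat_Suc del: hnat.simps hnat_V hnat_M)
qed

lemma j_H_aleph1: "x \<in> V \<Longrightarrow> j x \<in> H_aleph1 M \<longleftrightarrow> x \<in> H_aleph1 V"
  using sat_j[of "fH1 0" "\<lambda>_. x"] by (simp add: comp_const)

text \<open>An element \<open>z\<close> of \<open>j y\<close> receives a number \<open>n\<close>
  from \<open>j f\<close>. As \<open>n\<close> is fixed by \<open>j\<close>, elementarity provides
  \<open>z'\<close> in \<open>y\<close> with \<open>f\<close>-value \<open>n\<close>. By induction
  \<open>z'\<close> is fixed, so it has the value \<open>n\<close> under \<open>j f\<close> as well,
  and injectivity gives \<open>z = z'\<close>.\<close>

lemma j_fixes_H_aleph1:
  assumes x: "x \<in> H_aleph1 V"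
  shows "j x = x"
proof -
  obtain f where f: "f \<in> V" "hinj f (tc x) homega" and xV: "x \<in> V"
    using x by (auto simp: H_aleph1_def card_le_def)
  have f_inj: "a = b" if "hpair a c \<in> elts (j f)" "hpair b c \<in> elts (j f)" for a b c
  proof -
    let ?\<phi> = "All 3 (All 4 (All 5 (fImp (And (fPairIn 3 5 0) (fPairIn 4 5 0)) (Eq 3 4))))"
    have "sat V {} (\<lambda>_. f) ?\<phi>"
      using f by (simp add: hinj_def) blast
    then have "sat M {} (j \<circ> (\<lambda>_. f)) ?\<phi>"
      by (rule sat_jD) (use f(1) in simp_all)
    then have "\<And>a b c. a \<in> M \<Longrightarrow> b \<in> M \<Longrightarrow> c \<in> M \<Longrightarrow>
        hpair a c \<in> elts (j f) \<Longrightarrow> hpair b c \<in> elts (j f) \<Longrightarrow> a = b"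
      using f(1) by (simp add: comp_const) blast
    then show ?thesis
      using that M.pair_N j_M[OF f(1)] by blast
  qed
  have "y \<in> V \<Longrightarrow> elts y \<subseteq> elts (tc x) \<Longrightarrow> j y = y" for y
  proof (induction y rule: hc_induct)
    case (step y)
    have fix_j: "z \<in> V \<and> j z = z" if "z \<in> elts y" for z
      using step.IH[OF that] step.prems that V.mem_N transitive_tc[of x] by (auto simp: transitive_def)
    have "z \<in> elts y" if z: "z \<in> elts (j y)" for z
    proof -
      let ?e = "(\<lambda>_. y)(1 := homega, 2 := f)"
      have "sat V {} ?e (fBall 3 0 (fBex 4 1 (fPairIn 3 4 2)))"
      proof -
        have "\<exists>n\<in>elts homega. hpair z n \<in> elts f" if "z \<in> elts y" for z
          using f(2) step.prems(2) that unfolding hinj_def hfun_def by (metis hpair_inject subsetD)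
        then show ?thesis using f(1) step.prems(1) by simp
      qed
      then have "sat M {} (j \<circ> ?e) (fBall 3 0 (fBex 4 1 (fPairIn 3 4 2)))"
        by (rule sat_jD) (use f(1) step.prems(1) in simp_all)
      then obtain n where n: "hpair z (hnat n) \<in> elts (j f)"
        using z f(1) step.prems(1) by (auto simp: fun_upd_comp comp_const)
      let ?e = "(\<lambda>_. y)(1 := hnat n, 2 := f)"
      have "sat M {} (j \<circ> ?e) (fBex 3 0 (fPairIn 3 1 2))"
        using z n f(1) step.prems(1) by (auto simp: fun_upd_comp comp_const)
      then have "sat V {} ?e (fBex 3 0 (fPairIn 3 1 2))"
        by (subst sat_j) (use f(1) step.prems(1) in simp_all)
      then obtain z' where z': "z' \<in> elts y" "hpair z' (hnat n) \<in> elts f"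
        using f(1) step.prems(1) by auto
      have "hpair z' (hnat n) \<in> elts (j f)"
        using j_mem[of "hpair z' (hnat n)" f] j_pair[of z' "hnat n"] fix_j[OF z'(1)] z'(2) f(1) by simp
      then show ?thesis
        using f_inj n z'(1) by blast
    qed
    moreover have "z \<in> elts (j y)" if "z \<in> elts y" for z
      using j_mem[of z y] fix_j[OF that] that step.prems(1) by simp
    ultimately show ?case by (intro hc_eqI) blast
  qed
  then show ?thesis using xV elts_subset_tc by blast
qed

lemma elem_H_aleph1:
  assumes A: "A \<in> V"
  shows "elem_substructure (H_aleph1 V) (elts A) (H_aleph1 M) (elts (j A))"
  unfolding elem_substructure_def
proof (intro conjI allI impI subsetI)
  fix x assume "x \<in> H_aleph1 V"
  then show "x \<in> H_aleph1 M"
    using j_H_aleph1[of x] j_fixes_H_aleph1[of x] by (simp add: H_aleph1_def)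
next
  fix \<phi> and e :: "nat \<Rightarrow> hc" assume e: "range e \<subseteq> H_aleph1 V"
  define e' where "e' = case_nat A e"
  have "e i \<in> V" for i
    using e by (auto simp: H_aleph1_def)
  then have e': "env V e'"
    using A by (auto simp: e'_def env_def split: nat.splits)
  then have je': "env M (j \<circ> e')"
    by (auto simp: env_def)
  have "(\<lambda>i. (j \<circ> e') (Suc i)) = e"
    using e j_fixes_H_aleph1 by (auto simp: e'_def)
  then show "sat (H_aleph1 V) (elts A) e \<phi> \<longleftrightarrow> sat (H_aleph1 M) (elts (j A)) e \<phi>"
    using V.sat_relativise[OF e', of \<phi>] M.sat_relativise[OF je', of \<phi>]
      sat_j[OF pred_free_relativise e', of \<phi>]
    by (simp add: e'_def)
qed

lemma j_subset_H_aleph1: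
  assumes A: "A \<in> V" "elts A \<subseteq> H_aleph1 V"
  shows "elts (j A) \<subseteq> H_aleph1 M"
proof -
  have "sat V {} (\<lambda>_. A) (fBall 1 0 (fH1 1))"
    using A by auto
  then have "sat M {} (j \<circ> (\<lambda>_. A)) (fBall 1 0 (fH1 1))"
    by (rule sat_jD) (use A(1) in simp_all)
  then show ?thesis
    using A(1) by (auto simp: comp_const)
qed

end

section \<open>The iteration is a forcing poset\<close>

text \<open>Forcing statements here range over generic filters, so reflexivity and transitivity are
  inherited, filter by filter, from the evaluated second factor. From here on the iteration is
  treated as a single forcing.\<close>

lemma iteration_poset:
  assumes V: "zf V" and P: "is_poset P" and Q: "is_poset_name V P Q" and R: "is_iteration V P Q R"
  shows "forcing_poset V R"
proof -
  interpret V: zf V by (rule V)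
  have le_R: "le R r c \<longleftrightarrow> (\<exists>p' q' p q. r = hpair p' q' \<and> c = hpair p q \<and> r \<in> conds R \<and> c \<in> conds R \<and>
      le P p' p \<and> forces V P p' (\<lambda>G. hpair (val G q') (val G q) \<in> elts (val G (snd Q))))" for r c
    using R by (auto simp: is_iteration_def le_def)
  have conds_R: "c \<in> conds R \<longleftrightarrow> (\<exists>p q. c = hpair p q \<and> p \<in> conds P \<and> (\<exists>s. hpair q s \<in> elts (fst Q)) \<and>
      forces V P p (\<lambda>G. val G q \<in> elts (val G (fst Q))))" for c
    using R by (auto simp: is_iteration_def)
  have poset: "is_poset (val G (fst Q), val G (snd Q))" if "generic V P G" "p \<in> elts G" for G p
    using Q that unfolding is_poset_name_def forces_def generic_def is_filter_def by blast
  have up: "p \<in> elts G" if "generic V P G" "q \<in> elts G" "le P q p" for G p q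
    using that P unfolding generic_def is_filter_def is_poset_def
    by (metis hpair_inject le_def)
  show ?thesis
  proof
    show "fst R \<in> V" "snd R \<in> V"
      using R by (auto simp: is_iteration_def code_def)
    show "le R q p \<Longrightarrow> q \<in> conds R \<and> p \<in> conds R" for q p
      using le_R by blast
  next
    fix c assume c: "c \<in> conds R"
    then obtain p q where pq: "c = hpair p q" "p \<in> conds P"
      and f: "forces V P p (\<lambda>G. val G q \<in> elts (val G (fst Q)))"
      using conds_R by blast
    have "forces V P p (\<lambda>G. hpair (val G q) (val G q) \<in> elts (val G (snd Q)))"
      using f poset unfolding forces_def is_poset_def le_def conds_def by fastforce
    then show "le R c c"
      using le_R c pq P unfolding is_poset_def by blast
  next
    fix r c d assume "le R r c" "le R c d"
    then obtain p1 q1 p2 q2 p3 q3 where *: "r = hpair p1 q1" "c = hpair p2 q2" "d = hpair p3 q3"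
      "r \<in> conds R" "d \<in> conds R" "le P p1 p2" "le P p2 p3"
      "forces V P p1 (\<lambda>G. hpair (val G q1) (val G q2) \<in> elts (val G (snd Q)))"
      "forces V P p2 (\<lambda>G. hpair (val G q2) (val G q3) \<in> elts (val G (snd Q)))"
      unfolding le_R by auto
    have "forces V P p1 (\<lambda>G. hpair (val G q1) (val G q3) \<in> elts (val G (snd Q)))"
      unfolding forces_def
    proof (intro allI impI)
      fix G assume G: "generic V P G \<and> p1 \<in> elts G"
      then have "p2 \<in> elts G" using up *(6) by blast
      then have "hpair (val G q1) (val G q2) \<in> elts (val G (snd Q))"
        "hpair (val G q2) (val G q3) \<in> elts (val G (snd Q))"
        using *(8,9) G unfolding forces_def by blast+
      then show "hpair (val G q1) (val G q3) \<in> elts (val G (snd Q))"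
        using poset[of G p1] G unfolding is_poset_def le_def by (metis snd_conv)
    qed
    moreover have "le P p1 p3"
      using * P unfolding is_poset_def by blast
    ultimately show "le R r d"
      using * le_R by blast
  qed
qed

lemma (in generic_ext) H_aleph1_subset:
  assumes M: "zf M" "M \<subseteq> W" and a: "Vstage W a \<in> M" "homega \<in> elts a"
  shows "H_aleph1 W \<subseteq> H_aleph1 M"
proof
  interpret M: zf M by (rule M(1))
  fix x assume "x \<in> H_aleph1 W"
  then obtain g where x: "x \<in> W" and g: "g \<in> W" "hinj g (tc x) homega"
    by (auto simp: H_aleph1_def card_le_def)
  define K where "K = elts (tc x)"
  have K: "transitive K" "countable K" "elts x \<subseteq> K"
    by (simp_all add: K_def transitive_tc elts_subset_tc)
  define f where "f y = (THE n. hpair y n \<in> elts g)" for y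
  have ex1: "\<exists>!n. hpair y n \<in> elts g" if "y \<in> K" for y
    using g(2) that by (simp add: hinj_def hfun_def K_def)
  have f: "hpair y (f y) \<in> elts g" if "y \<in> K" for y
    unfolding f_def by (rule theI'[OF ex1[OF that]])
  have dom_g: "y \<in> K \<and> n \<in> elts homega" if "hpair y n \<in> elts g" for y n
    using g(2) that unfolding hinj_def hfun_def K_def by (metis hpair_inject)
  have g_iff: "hpair y n \<in> elts g \<longleftrightarrow> y \<in> K \<and> n = f y" for y n
    using dom_g f ex1 by metis
  have g_eq: "elts g = (\<lambda>y. hpair y (f y)) ` K"
  proof (intro set_eqI iffI)
    fix z assume "z \<in> elts g"
    then obtain y n where "z = hpair y n"
      using g(2) unfolding hinj_def hfun_def by blast
    then show "z \<in> (\<lambda>y. hpair y (f y)) ` K"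
      using g_iff[of y n] \<open>z \<in> elts g\<close> by simp
  qed (use f in blast)
  have f_inj: "inj_on f K"
    using g(2) f unfolding hinj_def inj_on_def by metis
  have f_nat: "f ` K \<subseteq> elts homega"
    using f dom_g by blast
  have g_W: "y \<in> W \<and> n \<in> W" if "hpair y n \<in> elts g" for y n
    using hpair_components[OF tmodel_W tmodel_memI[OF tmodel_W that g(1)]] ..
  have omW: "homega \<in> W" "hprod homega homega \<in> W"
    by (rule subsetD[OF V_subset_W], simp)+
  have natW: "range hnat \<subseteq> W"
    using tmodel_memI[OF tmodel_W _ omW(1)] unfolding elts_homega by blast
  have stage: "y \<in> M" if "y \<in> W" "elts y \<subseteq> elts homega \<or> elts y \<subseteq> elts (hprod homega homega)" for y
    using real_Vstage[OF tmodel_W countable_W natW that(1) a(2) that(2)] M.mem_N[OF _ a(1)] by blast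
  \<comment> \<open>Variables 2 and 3 range over sets whose codes under \<open>g\<close> are 4 and
    5, so this codes the reflexive closure of membership on \<open>K\<close>.\<close>
  define E where "E = hset {z \<in> elts (hprod homega homega). sat W {} ((\<lambda>_. g)(0 := z))
    (fEx 2 (fEx 3 (fEx 4 (fEx 5 (And (fPair 0 4 5) (And (fPairIn 2 4 1) (And (fPairIn 3 5 1)
      (fOr (Mem 2 3) (Eq 2 3)))))))))}"
  have E_iff: "hpair n m \<in> elts E \<longleftrightarrow> (\<exists>a\<in>K. \<exists>b\<in>K. n = f a \<and> m = f b \<and> (a \<in> elts b \<or> a = b))" for n m
  proof -
    have "z \<in> W" if "z \<in> elts (hprod homega homega)" for z
      using tmodel_memI[OF tmodel_W that omW(2)] .
    moreover have "countable {z \<in> elts (hprod homega homega). Q z}" for Q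
      by (rule countable_subset[OF _ countable_elts[of "hprod homega homega"]]) auto
    ultimately have "hpair n m \<in> elts E \<longleftrightarrow> hpair n m \<in> elts (hprod homega homega) \<and>
        (\<exists>a\<in>W. \<exists>b\<in>W. \<exists>n'\<in>W. \<exists>m'\<in>W. hpair n m = hpair n' m' \<and> hpair a n' \<in> elts g \<and> hpair b m' \<in> elts g \<and>
          (a \<in> elts b \<or> a = b))"
      using g(1) unfolding E_def by (simp del: elts_hprod cong: conj_cong)
    also have "\<dots> \<longleftrightarrow> (\<exists>a b. hpair a n \<in> elts g \<and> hpair b m \<in> elts g \<and> (a \<in> elts b \<or> a = b))"
      using g_W dom_g by (auto; metis)
    finally show ?thesis unfolding g_iff by blast
  qed
  have "E \<in> W"
    unfolding E_def by (rule W_sep) (use g(1) omW in auto)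
  moreover have "elts E \<subseteq> elts (hprod homega homega)"
    unfolding E_def by (subst elts_hset) (auto intro: countable_subset[OF _ countable_elts[of "hprod homega homega"]])
  ultimately have EM: "E \<in> M" using stage by blast
  note dec = M.decode[OF K(1,2) f_inj f_nat EM E_iff]
  have "hset ((\<lambda>y. hpair y (f y)) ` K) = g"
    by (intro hc_eqI) (simp add: g_eq K(2))
  then have gM: "g \<in> M" using dec(2) by simp
  \<comment> \<open>Since \<open>x\<close> is not an element of its own transitive closure, decoding
    gives only the surrounding set \<open>K\<close>; the codes of the elements of \<open>x\<close>
    form a second real that cuts \<open>x\<close> out of it.\<close>
  define X where "X = hset {n \<in> elts homega. sat W {} ((\<lambda>_. g)(2 := x, 0 := n)) (fBex 3 2 (fPairIn 3 0 1))}"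
  have cX: "countable {n \<in> elts homega. Q n}" for Q
    by (rule countable_subset[OF _ countable_elts[of homega]]) auto
  have "n \<in> W" if "n \<in> elts homega" for n
    using tmodel_memI[OF tmodel_W that omW(1)] .
  then have X_iff: "n \<in> elts X \<longleftrightarrow> (\<exists>z\<in>elts x. hpair z n \<in> elts g)" for n
    using g(1) x dom_g cX unfolding X_def by (simp del: elts_homega cong: conj_cong) blast
  have "X \<in> W"
    unfolding X_def by (rule W_sep[of _ "(\<lambda>_. g)(2 := x)"]) (use g(1) x omW in auto)
  moreover have "elts X \<subseteq> elts homega"
    using X_iff dom_g by blast
  ultimately have XM: "X \<in> M" using stage by blast
  have "hset (elts x) \<in> M"
  proof (rule M.sep_set[of "fBex 3 1 (fPairIn 0 3 2)" "(\<lambda>_. g)(1 := X)" "hset K"])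
    show "elts x \<subseteq> elts (hset K)" using K by simp
    fix z assume z: "z \<in> elts (hset K)" "z \<in> M"
    have "z \<in> elts x \<longleftrightarrow> (\<exists>n\<in>elts X. hpair z n \<in> elts g)"
      using z(1) K g_iff X_iff f_inj by (auto simp: inj_on_def; metis subsetD)
    then show "z \<in> elts x \<longleftrightarrow> sat M {} ((\<lambda>_. g)(1 := X, 0 := z)) (fBex 3 1 (fPairIn 0 3 2))"
      using z(2) XM gM by simp
  qed (use XM gM dec(1) in auto)
  moreover have "hset (elts x) = x" by (intro hc_eqI) simp
  ultimately have "x \<in> M" by simp
  then show "x \<in> H_aleph1 M"
    using gM g(2) by (auto simp: H_aleph1_def card_le_def)
qed

lemma ordinal_homega: "ordinal homega"
  by (auto simp: ordinal_def transitive_def elts_hnat)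

lemma ordinal_hsucc: "ordinal a \<Longrightarrow> ordinal (hsucc a)"
  by (auto simp: ordinal_def transitive_def)

lemma ordinal_un: "ordinal a \<Longrightarrow> ordinal b \<Longrightarrow> ordinal (hset (elts a \<union> elts b))"
  unfolding ordinal_def transitive_def by simp blast

theorem theorem8p3:
  fixes V :: "hc set"
  assumes "ctm V"
    and "LgLCAA_extendible V"
  shows "\<forall>A P. A \<in> V \<and> elts A \<subseteq> H_aleph1 V \<and> is_poset P \<and> code P \<in> V \<longrightarrow>
           (\<exists>Q R. is_poset_name V P Q \<and> is_iteration V P Q R \<and>
             (\<forall>H. generic V R H \<longrightarrow>
               (\<exists>A'. A' \<in> gen_ext V R H \<and> elts A' \<subseteq> H_aleph1 (gen_ext V R H) \<and>
                 elem_substructure (H_aleph1 V) (elts A)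
                   (H_aleph1 (gen_ext V R H)) (elts A'))))"
proof (intro allI impI)
  fix A P assume AP: "A \<in> V \<and> elts A \<subseteq> H_aleph1 V \<and> is_poset P \<and> code P \<in> V"
  interpret V: zf V by (rule zf_of_ctm[OF assms(1)])
  obtain k where k: "is_continuum V k"
    and ax: "\<forall>l\<in>V. ordinal l \<and> k \<in> elts l \<longrightarrow>
        (\<forall>P. is_poset P \<and> code P \<in> V \<longrightarrow>
          (\<exists>Q R. is_poset_name V P Q \<and> is_iteration V P Q R \<and>
            (\<forall>H. generic V R H \<longrightarrow>
              (let W = gen_ext V R H in
                \<exists>j M. M \<subseteq> W \<and> class_of W M \<and> class_of W ((\<lambda>x. hpair x (j x)) ` V) \<and>
                  transitive M \<and> elem_embedding j V M \<and> crit j k \<and> l \<in> elts (j k) \<and>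
                  code P \<in> M \<and> code R \<in> M \<and> H \<in> M \<and>
                  card_le V (RO V R) (j k) \<and>
                  Vstage W (j l) \<in> M))))"
    using assms(2) unfolding LgLCAA_extendible_def by blast
  \<comment> \<open>The union gives an ordinal above both \<open>k\<close> and
    \<open>\<omega>\<close> without comparing the two.\<close>
  define l where "l = hset (elts (hsucc k) \<union> elts (hsucc homega))"
  have kV: "k \<in> V" "ordinal k"
    using k by (auto simp: is_continuum_def Let_def)
  have l: "l \<in> V" "ordinal l" "k \<in> elts l" "homega \<in> elts l"
    unfolding l_def using kV by (auto intro!: ordinal_un ordinal_hsucc ordinal_homega V.un simp del: elts_hsucc) (simp_all)
  obtain Q R where QR: "is_poset_name V P Q" "is_iteration V P Q R"
    and H: "\<And>H. generic V R H \<Longrightarrow> \<exists>j M. M \<subseteq> gen_ext V R H \<and>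
      transitive M \<and> elem_embedding j V M \<and> Vstage (gen_ext V R H) (j l) \<in> M"
    using ax l AP unfolding Let_def by meson
  have R: "forcing_poset V R"
    by (rule iteration_poset[OF V.zf_axioms _ QR]) (use AP in simp)
  have "\<exists>A'. A' \<in> gen_ext V R H \<and> elts A' \<subseteq> H_aleph1 (gen_ext V R H) \<and>
      elem_substructure (H_aleph1 V) (elts A) (H_aleph1 (gen_ext V R H)) (elts A')" if "generic V R H" for H
  proof -
    note gen = that
    interpret generic_ext V R H
      using R gen by (simp add: generic_ext_def generic_ext_axioms_def)
    obtain j M where M: "M \<subseteq> W" "transitive M" "elem_embedding j V M" "Vstage W (j l) \<in> M"
      using H[OF gen] by blast
    have zM: "zf M"
      by (rule zf_elem[OF V.zf_axioms M(3,2) countable_subset[OF M(1) countable_W]])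
    interpret elementary V M j
      using zM V.zf_axioms M(3) by (simp add: elementary_def elementary_axioms_def)
    \<comment> \<open>As \<open>j\<close> fixes \<open>\<omega>\<close>, its membership in
      \<open>l\<close> carries over, so the stage of index \<open>j l\<close> contains the reals of
      \<open>W\<close>.\<close>
    have "homega \<in> elts (j l)"
      using j_mem[of homega l] l by simp
    then have "H_aleph1 W \<subseteq> H_aleph1 M"
      by (rule H_aleph1_subset[OF zM M(1,4)])
    moreover have "H_aleph1 M \<subseteq> H_aleph1 W"
      using M(1) by (auto simp: H_aleph1_def card_le_def)
    ultimately have eq: "H_aleph1 W = H_aleph1 M" by blast
    show ?thesis
      unfolding eq using AP elem_H_aleph1[of A] j_subset_H_aleph1[of A] j_M[of A] M(1) by blast
  qed
  then show "\<exists>Q R. is_poset_name V P Q \<and> is_iteration V P Q R \<and>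
      (\<forall>H. generic V R H \<longrightarrow>
        (\<exists>A'. A' \<in> gen_ext V R H \<and> elts A' \<subseteq> H_aleph1 (gen_ext V R H) \<and>
          elem_substructure (H_aleph1 V) (elts A) (H_aleph1 (gen_ext V R H)) (elts A')))"
    using QR by blast
qed

end
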